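(* Let $\alpha>0$. The weak co-adjoint action of $C^0_{\mathrm{div}}(\mathbb R^2)$ on $\mathcal M(\mathbb R^2)$ is well-defined: for continuous curves $t\mapsto u_t\in C^0_{\mathrm{div}}(\mathbb R^2)$ and $t\mapsto q_t\in\mathcal M(\mathbb R^2)$, $t\in\mathbb R$, the formula $$\langle\operatorname{w-ad}^*_u(q),\phi\rangle=\int_{\mathbb R}\int_{\mathbb R^2}(\partial_t\phi+u_t\cdot\operatorname{grad}\phi)\,dq_t(x)\,dt,\qquad\phi\in C_0^\infty(\mathbb R\times\mathbb R^2),$$ defines a distribution on $\mathbb R\times\mathbb R^2$. Moreover, for any $q_0\in\mathcal M(\mathbb R^2)$, solutions of the second-grade fluid equations, equivalently of the vortex blob method, with initial data $q_0$ leave the co-Adjoint orbit $$\mathcal O_{q_0}=\{q:\ q=q_0\circ\eta,\ \eta\in\mathcal G\}$$ invariant; that is, if $q$ is the weak solution of $$\partial_tq+u\cdot\operatorname{grad}q=0,\qquad u=K^\alpha*q,\qquad q(0)=q_0,$$ then $q_t\in\mathcal O_{q_0}$ for all $t\in\mathbb R$.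
   Context: $\mathcal M(\mathbb R^2)$ is the space of finite signed Radon measures on $\mathbb R^2$ with the total variation norm; curves in it are continuous with respect to the weak topology (tested against continuous functions vanishing at infinity). $C^0_{\mathrm{div}}(\mathbb R^2)$ is the space of continuous vector fields on $\mathbb R^2$ that are divergence-free in the sense of distributions; curves in it are continuous in $t$ with respect to the distance $\sup_x|\cdot|$. $C_0^\infty$ denotes smooth compactly supported functions. $\mathcal G$ is the group of homeomorphisms of $\mathbb R^2$ preserving Lebesgue measure. For $q\in\mathcal M(\mathbb R^2)$ and $\eta\in\mathcal G$, $q\circ\eta$ is the measure with $\int\phi\,d(q\circ\eta)=\int\phi\circ\eta^{-1}\,dq$. $K^\alpha(x,y)=\nabla_x^\perp G^\alpha(|x-y|)$ with $\nabla^\perp=(-\partial_2,\partial_1)$ and $$G^\alpha(r)=\frac1{2\pi}K_0\Big(\frac r\alpha\Big)+\frac1{2\pi}\ln r,$$ $K_0$ being the modified Bessel function of the second kind of order zero, and $K^\alpha(x,x)=0$ (continuous extension); $(K^\alpha*q)(x)=\int K^\alpha(x,y)\,dq(y)$. The weak solution with initial data $q_0$ is the unique triple $(\eta,u,q)$ with $t\mapsto\eta_t\in\mathcal G$ of class $C^1$ (derivative and its continuity understood uniformly in $x\in\mathbb R^2$), $u\in C^0(\mathbb R;C^0_{\mathrm{div}}(\mathbb R^2))$, $q\in C^0(\mathbb R;\mathcal M(\mathbb R^2))$, such that $q(0)=q_0$, $u_t=K^\alpha*q_t$, $\partial_t\eta_t=u_t\circ\eta_t$, $\eta_0=\mathrm{id}$,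 and $$\int_{\mathbb R}\int_{\mathbb R^2}(\partial_t\phi+u_t\cdot\operatorname{grad}\phi)\,dq_t(x)\,dt=0\quad\text{for all }\phi\in C_0^\infty(\mathbb R\times\mathbb R^2).$$ *)

theory Defs
  imports "HOL-Analysis.Analysis"
begin

text \<open>
  On a Euclidean space every finite signed Borel measure is Radon, so regularity is not
  a separate condition. Values off the Borel sets are fixed to 0, which makes equality of
  measures the same as equality of functions. Countable additivity with real values forces the
  total variation to be finite (cf. \<open>finite_upper_variation\<close> below).
\<close>

definition signed_measures :: "('a::euclidean_space set \<Rightarrow> real) set" where
  "signed_measures = {q. q {} = 0 \<and> (\<forall>A. A \<notin> sets borel \<longrightarrow> q A = 0) \<and>
     (\<forall>A::nat \<Rightarrow> 'a set. range A \<subseteq> sets borel \<longrightarrow> disjoint_family A \<longrightarrow>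
        (\<lambda>n. q (A n)) sums q (\<Union>n. A n))}"

text \<open>
  The two parts of the Jordan decomposition. As \<^const>\<open>ennreal\<close> maps negative reals to 0 and
  \<open>B = {}\<close> is admitted, truncation does not affect the supremum.
\<close>

definition upper_variation :: "('a::euclidean_space set \<Rightarrow> real) \<Rightarrow> 'a measure" where
  "upper_variation q =
     measure_of UNIV (sets borel) (\<lambda>A. SUP B\<in>{B\<in>sets borel. B \<subseteq> A}. ennreal (q B))"

definition lower_variation :: "('a::euclidean_space set \<Rightarrow> real) \<Rightarrow> 'a measure" where
  "lower_variation q = upper_variation (\<lambda>A. - q A)"

definition signed_integrable ::
    "('a::euclidean_space set \<Rightarrow> real) \<Rightarrow> ('a \<Rightarrow> 'b::{banach, second_countable_topology}) \<Rightarrow> bool" where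
  "signed_integrable q f \<longleftrightarrow> integrable (upper_variation q) f \<and> integrable (lower_variation q) f"

definition signed_integral ::
    "('a::euclidean_space set \<Rightarrow> real) \<Rightarrow> ('a \<Rightarrow> 'b::{banach, second_countable_topology}) \<Rightarrow> 'b" where
  "signed_integral q f = (\<integral>x. f x \<partial>upper_variation q) - (\<integral>x. f x \<partial>lower_variation q)"

text \<open>
  \<open>q \<circ> \<eta>\<close>, that is, the image of \<open>q\<close> under \<open>inv \<eta>\<close>; the defining identity
  \<open>\<integral> \<phi> d(q \<circ> \<eta>) = \<integral> \<phi> \<circ> \<eta>\<^sup>-\<^sup>1 dq\<close> is \<open>signed_integral_pullback\<close> below.
\<close>

definition pullback_measure :: "('a::euclidean_space set \<Rightarrow> real) \<Rightarrow> ('a \<Rightarrow> 'a) \<Rightarrow> 'a set \<Rightarrow> real" where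
  "pullback_measure q \<eta> = (\<lambda>A. if A \<in> sets borel then q (\<eta> ` A) else 0)"

lemma signed_measure_empty: "q \<in> signed_measures \<Longrightarrow> q {} = 0"
  by (simp add: signed_measures_def)

lemma signed_measure_sums:
  "q \<in> signed_measures \<Longrightarrow> range A \<subseteq> sets borel \<Longrightarrow> disjoint_family A \<Longrightarrow>
     (\<lambda>n. q (A n)) sums q (\<Union>n. A n)"
  by (simp add: signed_measures_def)

lemma signed_measure_uminus:
  assumes "q \<in> signed_measures"
  shows "(\<lambda>A. - q A) \<in> signed_measures"
  using assms unfolding signed_measures_def by (auto intro: sums_minus)

lemma signed_measure_Un:
  assumes q: "q \<in> signed_measures" and AB: "A \<in> sets borel" "B \<in> sets borel" "A \<inter> B = {}"
  shows "q (A \<union> B) = q A + q B"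
proof -
  have "(\<lambda>n. q (binaryset A B n)) sums q (\<Union>n. binaryset A B n)"
    using AB by (intro signed_measure_sums[OF q])
      (auto simp: disjoint_family_on_def binaryset_def split: if_splits)
  moreover have "(\<lambda>n. q (binaryset A B n)) sums (q A + q B)"
    by (rule binaryset_sums) (rule signed_measure_empty[OF q])
  ultimately show ?thesis
    unfolding UN_binaryset_eq by (rule sums_unique2)
qed

lemma signed_measure_Diff:
  assumes q: "q \<in> signed_measures" and AB: "A \<in> sets borel" "B \<in> sets borel" "B \<subseteq> A"
  shows "q (A - B) = q A - q B"
proof -
  have "q (B \<union> (A - B)) = q B + q (A - B)"
    using AB by (intro signed_measure_Un[OF q]) auto
  moreover have "B \<union> (A - B) = A" using AB by auto
  ultimately show ?thesis by simp
qed

lemma sets_upper_variation [simp, measurable_cong]: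
  fixes q :: "'a::euclidean_space set \<Rightarrow> real"
  shows "sets (upper_variation q) = sets borel"
  unfolding upper_variation_def using sets.sigma_sets_eq[of "borel :: 'a measure"]
  by (subst sets_measure_of) (auto simp: space_borel)

lemma space_upper_variation [simp]: "space (upper_variation q) = UNIV"
  unfolding upper_variation_def by (subst space_measure_of) auto

lemma sets_lower_variation [simp, measurable_cong]: "sets (lower_variation q) = sets borel"
  by (simp add: lower_variation_def)

lemma space_lower_variation [simp]: "space (lower_variation q) = UNIV"
  by (simp add: lower_variation_def)

lemma emeasure_upper_variation:
  fixes q :: "'a::euclidean_space set \<Rightarrow> real"
  assumes q: "q \<in> signed_measures" and A: "A \<in> sets borel"
  shows "emeasure (upper_variation q) A = (SUP B\<in>{B\<in>sets borel. B \<subseteq> A}. ennreal (q B))"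
  unfolding upper_variation_def
proof (rule emeasure_measure_of_sigma)
  let ?\<mu> = "\<lambda>A. SUP B\<in>{B\<in>sets borel. B \<subseteq> A}. ennreal (q B)"
  show "sigma_algebra UNIV (sets (borel :: 'a measure))"
    by (metis sets.sigma_algebra_axioms space_borel)
  have "{B \<in> sets borel. B \<subseteq> ({} :: 'a set)} = {{}}" by auto
  then show "positive (sets borel) ?\<mu>"
    using signed_measure_empty[OF q] by (simp add: positive_def)
  have mono: "?\<mu> C \<le> ?\<mu> D" if "C \<subseteq> D" for C D
    using that by (intro SUP_subset_mono) auto
  have add: "?\<mu> C + ?\<mu> D \<le> ?\<mu> (C \<union> D)"
    if CD: "C \<inter> D = {}" for C D :: "'a set"
  proof -
    have ne: "{B\<in>sets borel. B \<subseteq> E} \<noteq> {}" for E :: "'a set"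
      by blast
    have "ennreal (q X) + ennreal (q Y) \<le> ?\<mu> (C \<union> D)"
      if X: "X \<in> sets borel" "X \<subseteq> C" and Y: "Y \<in> sets borel" "Y \<subseteq> D" for X Y
    proof -
      define X' where "X' = (if q X \<ge> 0 then X else {})"
      define Y' where "Y' = (if q Y \<ge> 0 then Y else {})"
      have X': "X' \<in> sets borel" "X' \<subseteq> C" "ennreal (q X) = ennreal (q X')" "q X' \<ge> 0"
        and Y': "Y' \<in> sets borel" "Y' \<subseteq> D" "ennreal (q Y) = ennreal (q Y')" "q Y' \<ge> 0"
        using X Y signed_measure_empty[OF q] by (auto simp: X'_def Y'_def ennreal_neg)
      have "q (X' \<union> Y') = q X' + q Y'"
        using X' Y' CD by (intro signed_measure_Un[OF q]) auto
      then have "ennreal (q X) + ennreal (q Y) = ennreal (q (X' \<union> Y'))"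
        using X' Y' by (simp add: ennreal_plus)
      also have "\<dots> \<le> ?\<mu> (C \<union> D)"
        using X' Y' by (intro SUP_upper) auto
      finally show ?thesis .
    qed
    then have "(SUP X\<in>{B\<in>sets borel. B \<subseteq> C}. SUP Y\<in>{B\<in>sets borel. B \<subseteq> D}. ennreal (q X) + ennreal (q Y))
        \<le> ?\<mu> (C \<union> D)"
      by (intro SUP_least) auto
    then show ?thesis
      by (simp only: ennreal_SUP_add_right[OF ne, symmetric] ennreal_SUP_add_left[OF ne])
  qed
  show "countably_additive (sets borel) ?\<mu>"
  proof (rule countably_additiveI)
    fix A :: "nat \<Rightarrow> 'a set"
    assume A: "range A \<subseteq> sets borel" "disjoint_family A" "(\<Union>i. A i) \<in> sets borel"
    show "(\<Sum>i. ?\<mu> (A i)) = ?\<mu> (\<Union>i. A i)"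
    proof (rule antisym)
      have fin: "(\<Sum>i<n. ?\<mu> (A i)) \<le> ?\<mu> (\<Union>i<n. A i)" for n
      proof (induction n)
        case (Suc n)
        have "A i \<inter> A n = {}" if "i < n" for i
          using disjoint_family_onD[OF A(2), of i n] that by simp
        then have disj: "(\<Union>i<n. A i) \<inter> A n = {}" by blast
        have "(\<Sum>i<Suc n. ?\<mu> (A i)) \<le> ?\<mu> (\<Union>i<n. A i) + ?\<mu> (A n)"
          unfolding sum.lessThan_Suc by (rule add_right_mono[OF Suc])
        also have "\<dots> \<le> ?\<mu> ((\<Union>i<n. A i) \<union> A n)"
          by (rule add[OF disj])
        also have "(\<Union>i<n. A i) \<union> A n = (\<Union>i<Suc n. A i)"
          by (auto simp: lessThan_Suc)
        finally show ?case .
      qed simp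
      show "(\<Sum>i. ?\<mu> (A i)) \<le> ?\<mu> (\<Union>i. A i)"
        by (rule suminf_le_const[OF summableI], rule order.trans[OF fin mono]) auto
    next
      show "?\<mu> (\<Union>i. A i) \<le> (\<Sum>i. ?\<mu> (A i))"
      proof (rule SUP_least, clarify)
        fix B assume B: "B \<in> sets borel" "B \<subseteq> (\<Union>i. A i)"
        have "(\<lambda>n. q (B \<inter> A n)) sums q (\<Union>n. B \<inter> A n)"
          using A B by (intro signed_measure_sums[OF q]) (auto simp: disjoint_family_on_def)
        moreover have "(\<Union>n. B \<inter> A n) = B" using B by auto
        ultimately have lim: "(\<lambda>n. ennreal (\<Sum>i<n. q (B \<inter> A i))) \<longlonglongrightarrow> ennreal (q B)"
          by (auto simp: sums_def intro: tendsto_ennrealI)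
        have "ennreal (\<Sum>i<n. q (B \<inter> A i)) \<le> (\<Sum>i. ?\<mu> (A i))" for n
        proof -
          have pos: "ennreal (max 0 (q (B \<inter> A i))) = ennreal (q (B \<inter> A i))" for i
            by (simp add: max_def ennreal_neg)
          have "ennreal (\<Sum>i<n. q (B \<inter> A i)) \<le> ennreal (\<Sum>i<n. max 0 (q (B \<inter> A i)))"
            by (intro ennreal_leI sum_mono) auto
          also have "\<dots> = (\<Sum>i<n. ennreal (q (B \<inter> A i)))"
            by (subst sum_ennreal[symmetric]) (simp_all only: pos max.cobounded1)
          also have "\<dots> \<le> (\<Sum>i<n. ?\<mu> (A i))"
            using A B by (intro sum_mono SUP_upper) auto
          also have "\<dots> \<le> (\<Sum>i. ?\<mu> (A i))"
            by (intro sum_le_suminf) auto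
          finally show ?thesis .
        qed
        with lim show "ennreal (q B) \<le> (\<Sum>i. ?\<mu> (A i))"
          by (intro LIMSEQ_le_const2[OF lim]) auto
      qed
    qed
  qed
qed (use A in auto)

lemma finite_upper_variation:
  fixes q :: "'a::euclidean_space set \<Rightarrow> real"
  assumes q: "q \<in> signed_measures"
  shows "finite_measure (upper_variation q)"
proof (rule ccontr)
  let ?\<mu> = "emeasure (upper_variation q)"
  assume "\<not> finite_measure (upper_variation q)"
  then have inf: "?\<mu> UNIV = \<infinity>"
    using finite_measureI[of "upper_variation q"] by auto
  have split: "\<exists>F. F \<in> sets borel \<and> F \<subseteq> E \<and> ?\<mu> F = \<infinity> \<and> 1 \<le> \<bar>q (E - F)\<bar>"
    if E: "E \<in> sets borel" "?\<mu> E = \<infinity>" for E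
  proof -
    have "ennreal (\<bar>q E\<bar> + 1) < (SUP B\<in>{B\<in>sets borel. B \<subseteq> E}. ennreal (q B))"
      unfolding emeasure_upper_variation[OF q E(1), symmetric] E(2) infinity_ennreal_def
      by (rule ennreal_less_top)
    then obtain A where A: "A \<in> sets borel" "A \<subseteq> E" "ennreal (\<bar>q E\<bar> + 1) < ennreal (q A)"
      unfolding less_SUP_iff by auto
    from A(3) have qA: "\<bar>q E\<bar> + 1 < q A"
      by (subst (asm) ennreal_less_iff) auto
    have d: "q (E - A) = q E - q A" "E - (E - A) = A"
      using A E by (auto intro!: signed_measure_Diff[OF q])
    have "?\<mu> A + ?\<mu> (E - A) = ?\<mu> (A \<union> (E - A))"
      using A E by (intro plus_emeasure) auto
    moreover have "A \<union> (E - A) = E" using A by auto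
    ultimately have "?\<mu> A = \<infinity> \<or> ?\<mu> (E - A) = \<infinity>"
      using E by (auto simp: ennreal_add_eq_top)
    then show ?thesis
    proof
      assume "?\<mu> A = \<infinity>"
      then show ?thesis using A qA d by (intro exI[of _ A]) auto
    next
      assume "?\<mu> (E - A) = \<infinity>"
      then show ?thesis using A E qA d by (intro exI[of _ "E - A"]) auto
    qed
  qed
  have "\<exists>E. \<forall>n::nat. (E n \<in> sets borel \<and> ?\<mu> (E n) = \<infinity>) \<and>
          (E (Suc n) \<subseteq> E n \<and> 1 \<le> \<bar>q (E n - E (Suc n))\<bar>)"
  proof (rule dependent_nat_choice)
    show "\<exists>E. E \<in> sets borel \<and> ?\<mu> E = \<infinity>" using inf by (intro exI[of _ UNIV]) auto
  qed (use split in blast)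
  then obtain E where E: "\<And>n. E n \<in> sets borel" "\<And>n. E (Suc n) \<subseteq> E n"
      "\<And>n. 1 \<le> \<bar>q (E n - E (Suc n))\<bar>"
    by auto
  have dec: "decseq E" using E(2) by (simp add: decseq_Suc_iff)
  have "disjoint_family (\<lambda>n. E n - E (Suc n))"
    unfolding disjoint_family_on_def
  proof (intro ballI impI)
    fix m n :: nat assume "m \<noteq> n"
    then have "Suc m \<le> n \<or> Suc n \<le> m" by auto
    then show "(E m - E (Suc m)) \<inter> (E n - E (Suc n)) = {}"
      using dec by (auto simp: decseq_def)
  qed
  then have "(\<lambda>n. q (E n - E (Suc n))) sums q (\<Union>n. E n - E (Suc n))"
    using E by (intro signed_measure_sums[OF q]) auto
  then have "(\<lambda>n. q (E n - E (Suc n))) \<longlonglongrightarrow> 0"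
    by (simp add: sums_iff summable_LIMSEQ_zero)
  then have "\<forall>\<^sub>F n in sequentially. dist (q (E n - E (Suc n))) 0 < 1"
    by (rule tendstoD) simp
  then obtain n where "dist (q (E n - E (Suc n))) 0 < 1"
    by (auto simp: eventually_sequentially)
  with E(3)[of n] show False by simp
qed

lemma finite_lower_variation:
  "q \<in> signed_measures \<Longrightarrow> finite_measure (lower_variation q)"
  unfolding lower_variation_def by (intro finite_upper_variation signed_measure_uminus)

lemma signed_measure_le_upper_variation:
  assumes q: "q \<in> signed_measures" and AB: "A \<in> sets borel" "B \<in> sets borel" "B \<subseteq> A"
  shows "q B \<le> measure (upper_variation q) A"
proof -
  interpret finite_measure "upper_variation q" by (rule finite_upper_variation[OF q])
  have "ennreal (q B) \<le> emeasure (upper_variation q) A"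
    unfolding emeasure_upper_variation[OF q AB(1)] using AB by (intro SUP_upper) auto
  then show ?thesis
    by (cases "q B \<ge> 0") (auto simp: emeasure_eq_measure intro: order_trans[OF less_imp_le measure_nonneg])
qed

lemma upper_variation_le:
  assumes q: "q \<in> signed_measures" and A: "A \<in> sets borel"
    and c: "\<And>B. B \<in> sets borel \<Longrightarrow> B \<subseteq> A \<Longrightarrow> q B \<le> c"
  shows "measure (upper_variation q) A \<le> c"
proof -
  interpret finite_measure "upper_variation q" by (rule finite_upper_variation[OF q])
  have "c \<ge> 0" using c[of "{}"] signed_measure_empty[OF q] by simp
  have "emeasure (upper_variation q) A \<le> ennreal c"
    unfolding emeasure_upper_variation[OF q A] using c by (intro SUP_least ennreal_leI) auto
  with \<open>c \<ge> 0\<close> show ?thesis by (simp add: emeasure_eq_measure)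
qed

lemma Jordan_decomposition:
  assumes q: "q \<in> signed_measures" and A: "A \<in> sets borel"
  shows "q A = measure (upper_variation q) A - measure (lower_variation q) A"
proof -
  have q': "(\<lambda>A. - q A) \<in> signed_measures" by (rule signed_measure_uminus[OF q])
  have "measure (upper_variation q) A \<le> q A + measure (lower_variation q) A"
  proof (rule upper_variation_le[OF q A])
    fix B assume B: "B \<in> sets borel" "B \<subseteq> A"
    have "- q (A - B) \<le> measure (lower_variation q) A"
      unfolding lower_variation_def using A B
      by (intro signed_measure_le_upper_variation[OF q']) auto
    then show "q B \<le> q A + measure (lower_variation q) A"
      using signed_measure_Diff[OF q A B] by simp
  qed
  moreover have "measure (lower_variation q) A \<le> measure (upper_variation q) A - q A"
    unfolding lower_variation_def
  proof (rule upper_variation_le[OF q' A])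
    fix B assume B: "B \<in> sets borel" "B \<subseteq> A"
    have "q (A - B) \<le> measure (upper_variation q) A"
      using A B by (intro signed_measure_le_upper_variation[OF q]) auto
    then show "- q B \<le> measure (upper_variation q) A - q A"
      using signed_measure_Diff[OF q A B] by simp
  qed
  ultimately show ?thesis by simp
qed

lemma homeomorphism_inv_facts:
  fixes f :: "'a::euclidean_space \<Rightarrow> 'a"
  assumes h: "homeomorphism UNIV UNIV f (inv f)"
  shows "bij f" "f \<in> borel_measurable borel" "inv f \<in> borel_measurable borel"
    "inv f -` A = f ` A"
proof -
  have inv: "inv f (f x) = x" "f (inv f x) = x" for x
    using h unfolding homeomorphism_def by blast+
  show "bij f" by (rule o_bij[of "inv f"]) (auto simp: fun_eq_iff inv)
  show "f \<in> borel_measurable borel" "inv f \<in> borel_measurable borel"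
    using h unfolding homeomorphism_def by (blast intro: borel_measurable_continuous_onI)+
  show "inv f -` A = f ` A"
  proof (intro equalityI subsetI)
    fix x assume "x \<in> inv f -` A"
    then have "f (inv f x) \<in> f ` A" by blast
    then show "x \<in> f ` A" by (simp only: inv)
  qed (auto simp only: image_iff vimage_eq inv)
qed

lemma homeomorphism_image_borel:
  fixes f :: "'a::euclidean_space \<Rightarrow> 'a"
  assumes h: "homeomorphism UNIV UNIV f (inv f)" and A: "A \<in> sets borel"
  shows "f ` A \<in> sets borel"
  using measurable_sets_borel[OF homeomorphism_inv_facts(3)[OF h] A] homeomorphism_inv_facts(4)[OF h]
  by simp

lemma pullback_measure_in_signed_measures:
  fixes q :: "'a::euclidean_space set \<Rightarrow> real"
  assumes q: "q \<in> signed_measures" and h: "homeomorphism UNIV UNIV \<eta> (inv \<eta>)"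
  shows "pullback_measure q \<eta> \<in> signed_measures"
proof -
  have inj: "inj \<eta>" using homeomorphism_inv_facts(1)[OF h] by (rule bij_is_inj)
  have "(\<lambda>n. pullback_measure q \<eta> (A n)) sums pullback_measure q \<eta> (\<Union>n. A n)"
    if A: "range A \<subseteq> sets borel" "disjoint_family A" for A :: "nat \<Rightarrow> 'a set"
  proof -
    have "(\<lambda>n. q (\<eta> ` A n)) sums q (\<Union>n. \<eta> ` A n)"
    proof (rule signed_measure_sums[OF q])
      show "range (\<lambda>n. \<eta> ` A n) \<subseteq> sets borel"
        using A homeomorphism_image_borel[OF h] by auto
      show "disjoint_family (\<lambda>n. \<eta> ` A n)"
        using A(2) inj by (auto simp: disjoint_family_on_def inj_def) blast
    qed
    moreover have "(\<Union>n. A n) \<in> sets borel" using A by auto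
    ultimately show ?thesis using A by (auto simp: pullback_measure_def image_UN)
  qed
  then show ?thesis
    using signed_measure_empty[OF q] by (auto simp: signed_measures_def pullback_measure_def)
qed

lemma upper_variation_pullback:
  fixes q :: "'a::euclidean_space set \<Rightarrow> real"
  assumes q: "q \<in> signed_measures" and h: "homeomorphism UNIV UNIV \<eta> (inv \<eta>)"
  shows "upper_variation (pullback_measure q \<eta>) = distr (upper_variation q) borel (inv \<eta>)"
proof (rule measure_eqI)
  fix A :: "'a set" assume "A \<in> sets (upper_variation (pullback_measure q \<eta>))"
  then have A: "A \<in> sets borel" by simp
  note mble = homeomorphism_inv_facts(3,2)[OF h] and im = homeomorphism_inv_facts(4)[OF h]
  note bij = homeomorphism_inv_facts(1)[OF h]
  have img: "(\<lambda>B. \<eta> ` B) ` {B \<in> sets borel. B \<subseteq> A} = {B \<in> sets borel. B \<subseteq> \<eta> ` A}"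
  proof (intro equalityI subsetI)
    fix C assume C: "C \<in> {B \<in> sets borel. B \<subseteq> \<eta> ` A}"
    have "C = \<eta> ` (\<eta> -` C)" using bij by (simp add: bij_is_surj surj_image_vimage_eq)
    moreover have "\<eta> -` C \<in> sets borel"
      using C by (intro measurable_sets_borel[OF mble(2)]) auto
    moreover have "\<eta> -` C \<subseteq> A"
      using C bij_is_inj[OF bij] by (auto dest!: subsetD simp: inj_eq)
    ultimately show "C \<in> (\<lambda>B. \<eta> ` B) ` {B \<in> sets borel. B \<subseteq> A}" by blast
  qed (auto intro: homeomorphism_image_borel[OF h])
  have "emeasure (upper_variation (pullback_measure q \<eta>)) A
      = (SUP B\<in>{B \<in> sets borel. B \<subseteq> A}. ennreal (q (\<eta> ` B)))"
    unfolding emeasure_upper_variation[OF pullback_measure_in_signed_measures[OF q h] A]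
    by (rule SUP_cong) (auto simp: pullback_measure_def)
  also have "\<dots> = (SUP B\<in>{B \<in> sets borel. B \<subseteq> \<eta> ` A}. ennreal (q B))"
    unfolding img[symmetric] by (simp add: image_image)
  also have "\<dots> = emeasure (upper_variation q) (\<eta> ` A)"
    by (rule emeasure_upper_variation[OF q homeomorphism_image_borel[OF h A], symmetric])
  also have "\<dots> = emeasure (distr (upper_variation q) borel (inv \<eta>)) A"
    using A mble by (subst emeasure_distr) (auto simp: im measurable_cong_sets[OF sets_upper_variation refl])
  finally show "emeasure (upper_variation (pullback_measure q \<eta>)) A = \<dots>" .
qed simp

lemma signed_integral_pullback:
  fixes q :: "'a::euclidean_space set \<Rightarrow> real" and \<phi> :: "'a \<Rightarrow> real"
  assumes q: "q \<in> signed_measures" and h: "homeomorphism UNIV UNIV \<eta> (inv \<eta>)"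
    and \<phi>: "\<phi> \<in> borel_measurable borel"
  shows "signed_integral (pullback_measure q \<eta>) \<phi> = signed_integral q (\<phi> \<circ> inv \<eta>)"
proof -
  note mble = homeomorphism_inv_facts(3)[OF h]
  have neg: "(\<lambda>A. - pullback_measure q \<eta> A) = pullback_measure (\<lambda>A. - q A) \<eta>"
    by (auto simp: pullback_measure_def)
  have "integral\<^sup>L (upper_variation (pullback_measure p \<eta>)) \<phi>
      = integral\<^sup>L (upper_variation p) (\<lambda>x. \<phi> (inv \<eta> x))" if "p \<in> signed_measures" for p
    unfolding upper_variation_pullback[OF that h]
    using mble \<phi> by (subst integral_distr) (auto simp: measurable_cong_sets[OF sets_upper_variation refl])
  from this[OF q] this[OF signed_measure_uminus[OF q]] show ?thesis
    by (simp add: signed_integral_def lower_variation_def neg o_def)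
qed

fun iterated_partial :: "'a::euclidean_space list \<Rightarrow> ('a \<Rightarrow> real) \<Rightarrow> 'a \<Rightarrow> real" where
  "iterated_partial [] f = f"
| "iterated_partial (b # bs) f = (\<lambda>x. frechet_derivative (iterated_partial bs f) (at x) b)"

text \<open>
  All iterated partial derivatives exist and are differentiable (hence continuous); this is
  \<open>C\<^sup>\<infinity>\<close>.
\<close>

definition smooth :: "('a::euclidean_space \<Rightarrow> real) \<Rightarrow> bool" where
  "smooth f \<longleftrightarrow> (\<forall>bs. set bs \<subseteq> Basis \<longrightarrow> (\<forall>x. iterated_partial bs f differentiable at x))"

definition supp :: "('a::euclidean_space \<Rightarrow> real) \<Rightarrow> 'a set" where
  "supp f = closure {x. f x \<noteq> 0}"

definition test_functions :: "('a::euclidean_space \<Rightarrow> real) set" where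
  "test_functions = {f. smooth f \<and> compact (supp f)}"

text \<open>
  Linear functionals on the test functions that are continuous in the usual sense: on each
  compact set they are bounded by finitely many of the seminorms \<open>sup \<bar>\<partial>\<^sup>\<beta> \<phi>\<bar>\<close>.
\<close>

definition distribution :: "(('a::euclidean_space \<Rightarrow> real) \<Rightarrow> real) \<Rightarrow> bool" where
  "distribution T \<longleftrightarrow>
     (\<forall>\<phi>\<in>test_functions. \<forall>\<psi>\<in>test_functions. T (\<lambda>z. \<phi> z + \<psi> z) = T \<phi> + T \<psi>) \<and>
     (\<forall>c. \<forall>\<phi>\<in>test_functions. T (\<lambda>z. c * \<phi> z) = c * T \<phi>) \<and>
     (\<forall>C. compact C \<longrightarrow> (\<exists>B N. \<forall>\<phi>\<in>test_functions. supp \<phi> \<subseteq> C \<longrightarrow>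
        \<bar>T \<phi>\<bar> \<le> B * (\<Sum>bs | set bs \<subseteq> Basis \<and> length bs \<le> N. SUP z. \<bar>iterated_partial bs \<phi> z\<bar>)))"

definition grad :: "(real^'n \<Rightarrow> real) \<Rightarrow> real^'n \<Rightarrow> real^'n" where
  "grad f x = (\<chi> i. frechet_derivative f (at x) (axis i 1))"

definition C0_div :: "(real^2 \<Rightarrow> real^2) set" where
  "C0_div = {v. continuous_on UNIV v \<and>
     (\<forall>\<psi>\<in>test_functions. (\<integral>x. v x \<bullet> grad \<psi> x \<partial>lborel) = 0)}"

text \<open>
  Fields in \<^const>\<open>C0_div\<close> may be unbounded, so the sup-distance can be infinite; continuity with
  respect to it is uniform convergence.
\<close>

definition C0_div_curve :: "(real \<Rightarrow> real^2 \<Rightarrow> real^2) \<Rightarrow> bool" where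
  "C0_div_curve u \<longleftrightarrow> (\<forall>t. u t \<in> C0_div) \<and> (\<forall>t. uniform_limit UNIV u (u t) (at t))"

definition measure_curve :: "(real \<Rightarrow> (real^2) set \<Rightarrow> real) \<Rightarrow> bool" where
  "measure_curve q \<longleftrightarrow> (\<forall>t. q t \<in> signed_measures) \<and>
     (\<forall>f :: real^2 \<Rightarrow> real. continuous_on UNIV f \<and> (f \<longlongrightarrow> 0) at_infinity \<longrightarrow>
        continuous_on UNIV (\<lambda>t. signed_integral (q t) f))"

definition transport_integrand ::
    "(real \<Rightarrow> real^2 \<Rightarrow> real^2) \<Rightarrow> (real \<times> (real^2) \<Rightarrow> real) \<Rightarrow> real \<Rightarrow> real^2 \<Rightarrow> real" where
  "transport_integrand u \<phi> t x =
     deriv (\<lambda>s. \<phi> (s, x)) t + u t x \<bullet> grad (\<lambda>y. \<phi> (t, y)) x"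

definition w_ad ::
    "(real \<Rightarrow> real^2 \<Rightarrow> real^2) \<Rightarrow> (real \<Rightarrow> (real^2) set \<Rightarrow> real) \<Rightarrow> (real \<times> (real^2) \<Rightarrow> real) \<Rightarrow> real" where
  "w_ad u q \<phi> = (\<integral>t. signed_integral (q t) (transport_integrand u \<phi> t) \<partial>lborel)"

text \<open>Existence of the integrals in \<^const>\<open>w_ad\<close>, since undefined integrals are 0 in HOL.\<close>

definition w_ad_integrable ::
    "(real \<Rightarrow> real^2 \<Rightarrow> real^2) \<Rightarrow> (real \<Rightarrow> (real^2) set \<Rightarrow> real) \<Rightarrow> (real \<times> (real^2) \<Rightarrow> real) \<Rightarrow> bool" where
  "w_ad_integrable u q \<phi> \<longleftrightarrow>
     (\<forall>t. signed_integrable (q t) (transport_integrand u \<phi> t)) \<and>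
     integrable lborel (\<lambda>t. signed_integral (q t) (transport_integrand u \<phi> t))"

definition measure_preserving_homeos :: "(real^2 \<Rightarrow> real^2) set" where
  "measure_preserving_homeos =
     {\<eta>. homeomorphism UNIV UNIV \<eta> (inv \<eta>) \<and> distr lborel borel \<eta> = lborel}"

definition coadjoint_orbit :: "((real^2) set \<Rightarrow> real) \<Rightarrow> ((real^2) set \<Rightarrow> real) set" where
  "coadjoint_orbit q\<^sub>0 = {q. \<exists>\<eta>\<in>measure_preserving_homeos. q = pullback_measure q\<^sub>0 \<eta>}"

definition C1_curve_with_deriv ::
    "(real \<Rightarrow> real^2 \<Rightarrow> real^2) \<Rightarrow> (real \<Rightarrow> real^2 \<Rightarrow> real^2) \<Rightarrow> bool" where
  "C1_curve_with_deriv \<eta> v \<longleftrightarrow>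
     (\<forall>t. uniform_limit UNIV (\<lambda>h x. (\<eta> (t + h) x - \<eta> t x) /\<^sub>R h) (v t) (at 0)) \<and>
     (\<forall>t. uniform_limit UNIV v (v t) (at t))"

text \<open>
  The modified Bessel function \<open>K\<^sub>0\<close> through its integral representation (DLMF 10.32.9), which
  converges for \<open>r > 0\<close>; values elsewhere do not affect the kernel below.
\<close>

definition bessel_K0 :: "real \<Rightarrow> real" where
  "bessel_K0 r = (LINT s:{0..}|lborel. exp (- r * cosh s))"

definition G_kernel :: "real \<Rightarrow> real \<Rightarrow> real" where
  "G_kernel \<alpha> r = bessel_K0 (r / \<alpha>) / (2 * pi) + ln r / (2 * pi)"

text \<open>Rotation turning \<open>(\<partial>\<^sub>1 f, \<partial>\<^sub>2 f)\<close> into \<open>(- \<partial>\<^sub>2 f, \<partial>\<^sub>1 f)\<close>.\<close>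

definition perp :: "real^2 \<Rightarrow> real^2" where
  "perp v = vector [- v $ 2, v $ 1]"

definition K_kernel :: "real \<Rightarrow> real^2 \<Rightarrow> real^2 \<Rightarrow> real^2" where
  "K_kernel \<alpha> x y = (if x = y then 0 else perp (grad (\<lambda>z. G_kernel \<alpha> (norm (z - y))) x))"

definition K_conv :: "real \<Rightarrow> ((real^2) set \<Rightarrow> real) \<Rightarrow> real^2 \<Rightarrow> real^2" where
  "K_conv \<alpha> q x = signed_integral q (\<lambda>y. K_kernel \<alpha> x y)"

definition weak_solution ::
    "real \<Rightarrow> ((real^2) set \<Rightarrow> real) \<Rightarrow> (real \<Rightarrow> real^2 \<Rightarrow> real^2) \<Rightarrow> (real \<Rightarrow> real^2 \<Rightarrow> real^2) \<Rightarrow>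
     (real \<Rightarrow> (real^2) set \<Rightarrow> real) \<Rightarrow> bool" where
  "weak_solution \<alpha> q\<^sub>0 \<eta> u q \<longleftrightarrow>
     (\<forall>t. \<eta> t \<in> measure_preserving_homeos) \<and> C0_div_curve u \<and> measure_curve q \<and>
     q 0 = q\<^sub>0 \<and> (\<forall>t. u t = K_conv \<alpha> (q t)) \<and>
     C1_curve_with_deriv \<eta> (\<lambda>t. u t \<circ> \<eta> t) \<and> \<eta> 0 = id \<and>
     (\<forall>\<phi>\<in>test_functions. w_ad u q \<phi> = 0)"

end

theory Submission
  imports Defs "HOL-Real_Asymp.Real_Asymp"
begin

text \<open>
  By Banach--Steinhaus a weakly continuous curve of measures is locally bounded as a family of
  functionals on \<open>C\<^sub>0\<close>; this gives the first claim.

  For the second, fix a Lipschitz \<open>\<psi>\<close> with compact support and test the equation with the mollification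
  \<open>\<phi>\<^sub>t(x) = \<integral> \<rho>\<^sub>\<epsilon>(x - \<eta>\<^sub>t z) \<psi>(z) dz\<close> of \<open>\<psi> \<circ> \<eta>\<^sub>t\<^sup>-\<^sup>1\<close>. As \<open>\<eta>\<^sub>t\<close> preserves Lebesgue measure and \<open>u\<^sub>t\<close> is
  divergence-free, \<open>\<partial>\<^sub>t\<phi> + u \<cdot> grad \<phi>\<close> equals the commutator
  \<open>\<integral> grad \<rho>\<^sub>\<epsilon>(x - y) \<cdot> (u\<^sub>t(x) - u\<^sub>t(y)) (\<psi>(\<eta>\<^sub>t\<^sup>-\<^sup>1 y) - \<psi>(\<eta>\<^sub>t\<^sup>-\<^sup>1 x)) dy\<close>.
  The blob kernel is log-Lipschitz, hence so is \<open>u\<^sub>t\<close>, and by Osgood's argument \<open>\<eta>\<^sub>t\<^sup>-\<^sup>1\<close> is Hoelder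
  continuous with some exponent \<open>\<kappa> > 0\<close>; the commutator is therefore of order \<open>\<epsilon>\<^sup>\<kappa> ln (1 / \<epsilon>)\<close>. Letting
  \<open>\<epsilon>\<close> tend to 0 shows that \<open>\<integral> \<psi> \<circ> \<eta>\<^sub>t\<^sup>-\<^sup>1 dq\<^sub>t\<close> does not depend on \<open>t\<close>, which means
  \<open>q\<^sub>t = q\<^sub>0 \<circ> \<eta>\<^sub>t\<^sup>-\<^sup>1\<close>.
\<close>

section \<open>Smooth functions\<close>

text \<open>The measure \<open>q t\<close> may charge points and null sets, so the commutator must
  be small uniformly in \<open>x\<close>; smallness in an integrated norm, which suffices for
  transport of densities, would say nothing. Uniform smallness is a matter of powers: the gradient
  of the mollifier has integral norm of order 1 / \<epsilon>, a log-Lipschitz velocity alone gains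
  only \<epsilon> ln (1 / \<epsilon>), which just fails, and the Hoelder modulus of the transported
  function supplies the missing power. The exponent exp (- 2 C T) degenerates as the time horizon
  grows, which is harmless because T is fixed before \<epsilon> is chosen. The inverse flow is never
  differentiated in time: the mollified function is an integral over starting points
  \<open>z\<close>, where only the trajectories move. The log-Lipschitz bound comes from writing the
  radial derivative of the kernel, up to scaling 1 / p - K_1(p), as an integral of profiles that are
  Lipschitz uniformly in the parameter \<open>s\<close> and decay like exp (- s); cutting at s = S
  leaves a bound of the form d S + exp (- S).\<close>

inductive_set fun_span :: "('a \<Rightarrow> real) set \<Rightarrow> ('a \<Rightarrow> real) set" for G where
  fun_span_zero: "(\<lambda>x. 0) \<in> fun_span G"
| fun_span_base: "g \<in> G \<Longrightarrow> g \<in> fun_span G"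
| fun_span_add: "f \<in> fun_span G \<Longrightarrow> g \<in> fun_span G \<Longrightarrow> (\<lambda>x. f x + g x) \<in> fun_span G"
| fun_span_scale: "f \<in> fun_span G \<Longrightarrow> (\<lambda>x. c * f x) \<in> fun_span G"

lemma fun_span_sum:
  "(\<And>i. i \<in> I \<Longrightarrow> f i \<in> fun_span G) \<Longrightarrow> (\<lambda>x. \<Sum>i\<in>I. f i x) \<in> fun_span G"
  by (induction I rule: infinite_finite_induct) (auto intro: fun_span.intros)

abbreviation partial :: "'a::euclidean_space \<Rightarrow> ('a \<Rightarrow> real) \<Rightarrow> 'a \<Rightarrow> real" where
  "partial b f \<equiv> (\<lambda>x. frechet_derivative f (at x) b)"

lemma partial_eq: "(\<And>x. (f has_derivative D x) (at x)) \<Longrightarrow> partial b f = (\<lambda>x. D x b)"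
  by (rule ext) (metis frechet_derivative_at)

lemma iterated_partial_append:
  "iterated_partial (as @ bs) f = iterated_partial as (iterated_partial bs f)"
  by (induction as) auto

text \<open>Membership in \<open>G\<close> is a coinductive invariant for smoothness, up to linear combinations.\<close>

lemma smooth_fun_span:
  assumes diff: "\<And>g x. g \<in> G \<Longrightarrow> g differentiable at x"
    and partial: "\<And>g b. g \<in> G \<Longrightarrow> b \<in> Basis \<Longrightarrow> partial b g \<in> fun_span G"
    and f: "f \<in> fun_span G"
  shows "smooth f"
proof -
  have step: "(\<forall>x. g differentiable at x) \<and> (\<forall>b\<in>Basis. partial b g \<in> fun_span G)"
    if "g \<in> fun_span G" for g
    using that
  proof induction
    case fun_span_zero
    have "partial b (\<lambda>x. 0) = (\<lambda>x. 0)" for b :: 'a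
      by (rule partial_eq) (rule derivative_intros)
    then show ?case by (auto intro: fun_span.intros)
  next
    case (fun_span_add f g)
    then have "partial b (\<lambda>x. f x + g x) = (\<lambda>x. partial b f x + partial b g x)" for b
      by (intro partial_eq[where D = "\<lambda>x h. partial h f x + partial h g x"])
        (auto intro!: derivative_eq_intros simp: frechet_derivative_works[symmetric])
    with fun_span_add show ?case by (auto intro: fun_span.intros)
  next
    case (fun_span_scale f c)
    then have "partial b (\<lambda>x. c * f x) = (\<lambda>x. c * partial b f x)" for b
      by (intro partial_eq[where D = "\<lambda>x h. c * partial h f x"])
        (auto intro!: derivative_eq_intros simp: frechet_derivative_works[symmetric])
    with fun_span_scale show ?case by (auto intro: fun_span.intros)
  qed (use diff partial in auto)
  have "iterated_partial bs f \<in> fun_span G" if "set bs \<subseteq> Basis" for bs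
    using that by (induction bs) (use f step in auto)
  then show ?thesis
    using step unfolding smooth_def by blast
qed

lemma smooth_differentiable: "smooth f \<Longrightarrow> f differentiable at x"
  unfolding smooth_def by (metis empty_subsetI iterated_partial.simps(1) list.set(1))

lemma smooth_has_derivative: "smooth f \<Longrightarrow> (f has_derivative frechet_derivative f (at x)) (at x)"
  using smooth_differentiable frechet_derivative_works by blast

lemma smooth_partial:
  assumes "smooth f" "b \<in> Basis"
  shows "smooth (partial b f)"
  unfolding smooth_def
proof (intro allI impI)
  fix bs :: "'a list" and x assume "set bs \<subseteq> Basis"
  \<comment> \<open>The head of the list is the outermost derivative, so the one taken before all
    others goes to the end.\<close>
  then have "iterated_partial (bs @ [b]) f differentiable at x"
    using assms unfolding smooth_def by (metis Un_subset_iff empty_set empty_subsetI insert_subset list.simps(15) set_append)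
  then show "iterated_partial bs (partial b f) differentiable at x"
    by (simp add: iterated_partial_append)
qed

text \<open>The set of all smooth functions is closed under partial derivatives and can itself serve
  as the invariant; the span contributes the sum.\<close>

lemma smooth_add: "smooth f \<Longrightarrow> smooth g \<Longrightarrow> smooth (\<lambda>x. f x + g x)"
  by (rule smooth_fun_span[where G = "{f. smooth f}"])
    (auto intro: fun_span.intros smooth_partial smooth_differentiable)

lemma smooth_scale: "smooth f \<Longrightarrow> smooth (\<lambda>x. c * f x)"
  by (rule smooth_fun_span[where G = "{f. smooth f}"])
    (auto intro: fun_span.intros smooth_partial smooth_differentiable)

lemma smooth_const: "smooth (\<lambda>x::'a::euclidean_space. c)"
proof (rule smooth_fun_span[where G = "{\<lambda>x. c}"])
  fix g :: "'a \<Rightarrow> real" and b assume "g \<in> {\<lambda>x. c}"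
  then have "partial b g = (\<lambda>x. 0)"
    by (intro partial_eq) (auto intro!: derivative_eq_intros)
  then show "partial b g \<in> fun_span {\<lambda>x. c}" by (simp add: fun_span.intros)
qed (auto intro: fun_span.intros)

lemma smooth_sum: "(\<And>i. i \<in> I \<Longrightarrow> smooth (f i)) \<Longrightarrow> smooth (\<lambda>x. \<Sum>i\<in>I. f i x)"
  by (induction I rule: infinite_finite_induct) (auto intro: smooth_const smooth_add)

lemma partial_mult:
  assumes "f differentiable at x" "g differentiable at x"
  shows "partial b (\<lambda>x. f x * g x) x = f x * partial b g x + partial b f x * g x"
  using frechet_derivative_at[OF has_derivative_mult[OF assms[unfolded frechet_derivative_works]]]
  by metis

text \<open>By the Leibniz rule a partial derivative of a product is a sum of two products of smooth
  functions, so the products form an invariant.\<close>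

lemma smooth_mult:
  fixes f g :: "'a::euclidean_space \<Rightarrow> real"
  assumes "smooth f" "smooth g"
  shows "smooth (\<lambda>x. f x * g x)"
proof (rule smooth_fun_span)
  let ?G = "{(\<lambda>x::'a. f x * g x) |f g. smooth f \<and> smooth g}"
  have mem: "(\<lambda>x. f x * g x) \<in> ?G" if "smooth f" "smooth g" for f g
    using that by blast
  show "(\<lambda>x. f x * g x) \<in> fun_span ?G"
    by (intro fun_span_base mem assms)
  fix h :: "'a \<Rightarrow> real" assume "h \<in> ?G"
  then obtain f g where h: "h = (\<lambda>x. f x * g x)" and fg: "smooth f" "smooth g" by auto
  show "h differentiable at x" for x
    unfolding h using fg by (blast intro: differentiable_mult smooth_differentiable)
  fix b :: 'a assume b: "b \<in> Basis"
  have "partial b h = (\<lambda>x. f x * partial b g x + partial b f x * g x)"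
    unfolding h using fg by (intro ext partial_mult smooth_differentiable)
  also have "\<dots> \<in> fun_span ?G"
    by (intro fun_span_add fun_span_base mem smooth_partial fg b)
  finally show "partial b h \<in> fun_span ?G" .
qed

lemma derivative_basis_expansion:
  fixes f :: "'a::euclidean_space \<Rightarrow> real"
  assumes "f differentiable at x"
  shows "frechet_derivative f (at x) v = (\<Sum>i\<in>Basis. (v \<bullet> i) * partial i f x)"
proof -
  interpret linear "frechet_derivative f (at x)"
    by (rule linear_frechet_derivative[OF assms])
  have "frechet_derivative f (at x) (\<Sum>i\<in>Basis. (v \<bullet> i) *\<^sub>R i) = (\<Sum>i\<in>Basis. (v \<bullet> i) * partial i f x)"
    by (simp add: sum scaleR)
  then show ?thesis by (simp add: euclidean_representation)
qed

lemma partial_compose_affine: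
  assumes f: "\<And>x. f differentiable at x" and A: "\<And>x. (A has_derivative A') (at x)"
  shows "partial b (\<lambda>x. f (A x)) = (\<lambda>x. \<Sum>i\<in>Basis. (A' b \<bullet> i) * partial i f (A x))"
proof -
  have "((\<lambda>x. f (A x)) has_derivative (\<lambda>h. frechet_derivative f (at (A x)) (A' h))) (at x)" for x
    by (rule has_derivative_compose[OF A]) (use f frechet_derivative_works in blast)
  then have "partial b (\<lambda>x. f (A x)) = (\<lambda>x. frechet_derivative f (at (A x)) (A' b))"
    by (rule partial_eq)
  then show ?thesis using derivative_basis_expansion f by metis
qed

text \<open>The derivative \<open>A'\<close> is the same at every point, so the chain rule gives a
  combination with constant coefficients, which is what the span allows.\<close>

lemma smooth_compose_affine:
  fixes A :: "'a::euclidean_space \<Rightarrow> 'b::euclidean_space"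
  assumes "smooth f" and A: "\<And>x. (A has_derivative A') (at x)"
  shows "smooth (\<lambda>x. f (A x))"
proof (rule smooth_fun_span)
  let ?G = "{(\<lambda>x. f (A x)) |f. smooth f}"
  show "(\<lambda>x. f (A x)) \<in> fun_span ?G" using assms by (auto intro!: fun_span_base)
  fix h :: "'a \<Rightarrow> real" assume "h \<in> ?G"
  then obtain f where h: "h = (\<lambda>x. f (A x))" and f: "smooth f" by auto
  show "h differentiable at x" for x
    unfolding h using f A
    by (metis differentiable_def has_derivative_compose smooth_has_derivative)
  fix b :: 'a
  have "partial b h = (\<lambda>x. \<Sum>i\<in>Basis. (A' b \<bullet> i) * partial i f (A x))"
    unfolding h by (rule partial_compose_affine[OF smooth_differentiable[OF f] A])
  also have "\<dots> \<in> fun_span ?G"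
    using f by (intro fun_span_sum fun_span_scale fun_span_base) (auto intro: smooth_partial)
  finally show "partial b h \<in> fun_span ?G" .
qed

lemma smooth_inner: "smooth (\<lambda>x. x \<bullet> a)"
proof (rule smooth_fun_span[where G = "{\<lambda>x. x \<bullet> a, \<lambda>x. 1}"])
  fix g b assume "g \<in> {\<lambda>x. x \<bullet> a, \<lambda>x. 1}"
  then have "partial b g = (\<lambda>x. (b \<bullet> a) * 1) \<or> partial b g = (\<lambda>x. 0)"
  proof
    assume "g = (\<lambda>x. x \<bullet> a)"
    then have "partial b g = (\<lambda>x. (b \<bullet> a))"
      by (intro partial_eq) (auto intro!: derivative_eq_intros)
    then show ?thesis by simp
  next
    assume "g \<in> {\<lambda>x. 1}"
    then have "partial b g = (\<lambda>x. 0)"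
      by (intro partial_eq) (auto intro!: derivative_eq_intros)
    then show ?thesis by simp
  qed
  then show "partial b g \<in> fun_span {\<lambda>x. x \<bullet> a, \<lambda>x. 1}"
    by (elim disjE) (auto simp only: intro!: fun_span_zero fun_span_scale intro: fun_span_base)
next
  fix g :: "'a \<Rightarrow> real" and x assume "g \<in> {\<lambda>x. x \<bullet> a, \<lambda>x. 1}"
  then show "g differentiable at x"
    by (auto intro: bounded_linear_imp_differentiable bounded_linear_inner_left)
qed (intro fun_span_base insertI1)

text \<open>The factor \<open>k\<close> collects the derivatives of the inner function that the
  chain rule produces; with it the products \<open>h (f x) * k x\<close> are closed under
  differentiation.\<close>

lemma smooth_compose_real:
  fixes h :: "real \<Rightarrow> real" and f :: "'a::euclidean_space \<Rightarrow> real"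
  assumes "smooth h" "smooth f"
  shows "smooth (\<lambda>x. h (f x))"
proof (rule smooth_fun_span)
  let ?G = "{(\<lambda>x::'a. h (f x) * k x) |h k. smooth h \<and> smooth k}"
  have mem: "(\<lambda>x. h (f x) * k x) \<in> ?G" if "smooth h" "smooth k" for h k
    using that by blast
  have "(\<lambda>x. h (f x) * 1) \<in> ?G"
    by (intro mem assms smooth_const)
  then show "(\<lambda>x. h (f x)) \<in> fun_span ?G" by (auto intro!: fun_span_base)
  fix g :: "'a \<Rightarrow> real" assume "g \<in> ?G"
  then obtain h k where g: "g = (\<lambda>x. h (f x) * k x)" and hk: "smooth h" "smooth k" by auto
  have hf: "((\<lambda>x. h (f x)) has_derivative (\<lambda>v. partial 1 h (f x) * partial v f x)) (at x)" for x
  proof -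
    have "((\<lambda>x. h (f x)) has_derivative (\<lambda>v. frechet_derivative h (at (f x)) (partial v f x))) (at x)"
      by (rule has_derivative_compose[OF smooth_has_derivative[OF assms(2)] smooth_has_derivative[OF hk(1)]])
    moreover have "frechet_derivative h (at (f x)) (partial v f x) = partial 1 h (f x) * partial v f x" for v
      by (subst derivative_basis_expansion) (auto intro: smooth_differentiable hk simp: mult.commute)
    ultimately show ?thesis by simp
  qed
  then have dh: "(\<lambda>x. h (f x)) differentiable at x" for x
    by (auto simp: differentiable_def)
  show "g differentiable at x" for x
    unfolding g by (intro differentiable_mult dh smooth_differentiable[OF hk(2)])
  fix b :: 'a assume b: "b \<in> Basis"
  have "partial b g = (\<lambda>x. h (f x) * partial b k x + partial 1 h (f x) * (partial b f x * k x))"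
    unfolding g by (rule ext, subst partial_mult)
      (simp_all add: dh smooth_differentiable hk fun_cong[OF partial_eq[OF hf]])
  also have "\<dots> \<in> fun_span ?G"
    by (intro fun_span_add fun_span_base mem smooth_mult smooth_partial hk assms b) auto
  finally show "partial b g \<in> fun_span ?G" .
qed

text \<open>The functions \<open>x\<^sup>-\<^sup>n exp (- 1 / x)\<close> on the positive half line span a space closed under
  differentiation.\<close>

definition exp_cutoff :: "nat \<Rightarrow> real \<Rightarrow> real" where
  "exp_cutoff n x = (if x > 0 then exp (- 1 / x) / x ^ n else 0)"

text \<open>On the right of 0 the substitution y = 1 / x turns this into y ^ n / exp y at
  infinity.\<close>

lemma exp_cutoff_tendsto: "(exp_cutoff n \<longlongrightarrow> 0) (at 0)"
proof -
  have "((\<lambda>x::real. x ^ n / exp x) \<longlongrightarrow> 0) at_top" by (rule tendsto_power_div_exp_0)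
  then have "((\<lambda>x::real. inverse x ^ n / exp (inverse x)) \<longlongrightarrow> 0) (at_right 0)"
    by (rule filterlim_compose[OF _ filterlim_inverse_at_top_right])
  moreover have "\<forall>\<^sub>F x in at_right 0. inverse x ^ n / exp (inverse x) = exp_cutoff n x"
    unfolding eventually_at_filter
    by (intro always_eventually) (simp add: exp_cutoff_def exp_minus divide_inverse power_inverse mult.commute)
  ultimately have "(exp_cutoff n \<longlongrightarrow> 0) (at_right 0)"
    by (rule Lim_transform_eventually)
  moreover have "(exp_cutoff n \<longlongrightarrow> 0) (at_left 0)"
  proof (rule Lim_transform_eventually[OF tendsto_const])
    show "\<forall>\<^sub>F x in at_left 0. 0 = exp_cutoff n x"
      unfolding eventually_at_filter by (intro always_eventually) (simp add: exp_cutoff_def)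
  qed
  ultimately show ?thesis by (simp add: filterlim_split_at)
qed

lemma exp_cutoff_DERIV:
  "(exp_cutoff n has_field_derivative (exp_cutoff (n + 2) x - real n * exp_cutoff (n + 1) x)) (at x)"
proof -
  consider "x > 0" | "x < 0" | "x = 0" by linarith
  then show ?thesis
  proof cases
    case 1
    have "((\<lambda>x. exp (- 1 / x) / x ^ n) has_field_derivative
        (exp_cutoff (n + 2) x - real n * exp_cutoff (n + 1) x)) (at x)"
      using 1 by (auto intro!: derivative_eq_intros simp: exp_cutoff_def)
         (cases n; auto simp: field_simps)
    moreover have "\<forall>\<^sub>F y in nhds x. exp (- 1 / y) / y ^ n = exp_cutoff n y"
      using eventually_nhds_in_open[of "{0<..}" x] 1 by (auto elim!: eventually_mono simp: exp_cutoff_def)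
    ultimately show ?thesis by (subst DERIV_cong_ev[OF refl _ refl]) (auto elim: eventually_mono)
  next
    case 2
    then have "\<forall>\<^sub>F y in nhds x. exp_cutoff n y = 0"
      using eventually_nhds_in_open[of "{..<0}" x] by (auto elim!: eventually_mono simp: exp_cutoff_def)
    then show ?thesis using 2 by (subst DERIV_cong_ev[OF refl _ refl]) (auto simp: exp_cutoff_def)
  next
    case 3
    \<comment> \<open>At the origin the difference quotient is the next function of the family,
      whose limit is known.\<close>
    have "(\<lambda>h. (exp_cutoff n (0 + h) - exp_cutoff n 0) / h) = exp_cutoff (n + 1)"
      by (auto simp: exp_cutoff_def fun_eq_iff)
    then show ?thesis
      using exp_cutoff_tendsto[of "n + 1"] 3 by (simp add: DERIV_def exp_cutoff_def)
  qed
qed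

lemma smooth_exp_cutoff: "smooth (exp_cutoff n)"
proof (rule smooth_fun_span[where G = "range exp_cutoff"])
  fix g :: "real \<Rightarrow> real" and b assume "g \<in> range exp_cutoff"
  then obtain n where g: "g = exp_cutoff n" by auto
  show "g differentiable at x" for x
    using exp_cutoff_DERIV unfolding g by (meson real_differentiable_def)
  have "partial b g = (\<lambda>x. b * exp_cutoff (n + 2) x + (- b * real n) * exp_cutoff (n + 1) x)"
    unfolding g
    by (subst partial_eq[OF exp_cutoff_DERIV[unfolded has_field_derivative_def]]) (auto simp: algebra_simps)
  also have "\<dots> \<in> fun_span (range exp_cutoff)"
    by (intro fun_span_add fun_span_scale fun_span_base rangeI)
  finally show "partial b g \<in> fun_span (range exp_cutoff)" .
qed (auto intro!: fun_span_base)

text \<open>The standard function exp (- 1 / (1 - |x|^2)) on the unit ball. The squared norm keeps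
  the inner function polynomial, hence smooth at the origin too.\<close>

definition bump :: "'a::euclidean_space \<Rightarrow> real" where
  "bump x = exp_cutoff 0 (1 - x \<bullet> x)"

lemma smooth_bump: "smooth (bump :: 'a::euclidean_space \<Rightarrow> real)"
proof -
  have eq: "1 - x \<bullet> x = 1 + (-1) * (\<Sum>i\<in>Basis. (x \<bullet> i) * (x \<bullet> i))" for x :: 'a
    by (simp add: euclidean_inner[of x x])
  have "smooth (\<lambda>x::'a. exp_cutoff 0 (1 - x \<bullet> x))"
    unfolding eq
    by (rule smooth_compose_real[OF smooth_exp_cutoff])
      (rule smooth_add[OF smooth_const] smooth_scale smooth_sum smooth_mult smooth_inner)+
  then show ?thesis by (simp add: bump_def[abs_def])
qed

lemma bump_nonneg: "bump x \<ge> 0" by (simp add: bump_def exp_cutoff_def)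

lemma bump_pos_iff: "bump x > 0 \<longleftrightarrow> norm x < 1"
  by (simp add: bump_def exp_cutoff_def power2_norm_eq_inner[symmetric] power_less_one_iff abs_square_less_1)

lemma bump_eq_0: "norm x \<ge> 1 \<Longrightarrow> bump x = 0"
  using bump_pos_iff[of x] bump_nonneg[of x] by linarith

section \<open>Test functions\<close>

lemma test_functionsI:
  fixes f :: "'a::euclidean_space \<Rightarrow> real"
  assumes "smooth f" "\<And>x. norm x > R \<Longrightarrow> f x = 0"
  shows "f \<in> test_functions"
proof -
  have "{x. f x \<noteq> 0} \<subseteq> cball 0 R"
    using assms(2) by (auto simp: not_less[symmetric])
  then have "bounded {x. f x \<noteq> 0}" by (rule bounded_subset[OF bounded_cball])
  then show ?thesis using assms(1) by (simp add: test_functions_def supp_def)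
qed

lemma test_function_smooth: "f \<in> test_functions \<Longrightarrow> smooth f"
  by (simp add: test_functions_def)

lemma test_function_differentiable: "f \<in> test_functions \<Longrightarrow> f differentiable at x"
  by (rule smooth_differentiable[OF test_function_smooth])

lemma test_function_has_derivative:
  "f \<in> test_functions \<Longrightarrow> (f has_derivative frechet_derivative f (at x)) (at x)"
  by (rule smooth_has_derivative[OF test_function_smooth])

lemma test_function_outside_supp: "x \<notin> supp f \<Longrightarrow> f x = 0"
  unfolding supp_def using closure_subset[of "{x. f x \<noteq> 0}"] by auto

lemma test_function_zero_outside:
  assumes "f \<in> test_functions"
  obtains R where "R > 0" "\<And>x. norm x > R \<Longrightarrow> f x = 0"
proof -
  have "bounded (supp f)" using assms by (simp add: test_functions_def compact_imp_bounded)
  then obtain R where R: "R > 0" "\<And>x. x \<in> supp f \<Longrightarrow> norm x \<le> R"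
    by (auto simp: bounded_pos)
  show ?thesis
    by (rule that[OF R(1)]) (use R(2) test_function_outside_supp in \<open>force simp: not_le[symmetric]\<close>)
qed

text \<open>The complement of the support is open, so \<open>f\<close> vanishes on a neighbourhood
  of \<open>x\<close> and not merely at \<open>x\<close>.\<close>

lemma partial_outside_supp:
  assumes "x \<notin> supp f"
  shows "partial b f x = 0"
proof -
  have "(f has_derivative (\<lambda>h. 0)) (at x)"
  proof (rule has_derivative_transform_within_open[OF has_derivative_const[of 0]])
    show "open (- supp f)" unfolding supp_def by (intro open_Compl closed_closure)
  qed (use assms test_function_outside_supp in auto)
  then show ?thesis by (metis frechet_derivative_at)
qed

lemma test_function_partial:
  assumes f: "f \<in> test_functions" and "b \<in> Basis"
  shows "partial b f \<in> test_functions"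
proof -
  have "bounded (supp f)" using assms by (simp add: test_functions_def compact_imp_bounded)
  then obtain R where R: "\<And>x. x \<in> supp f \<Longrightarrow> norm x \<le> R"
    by (auto simp: bounded_pos)
  show ?thesis
    by (rule test_functionsI[where R = R])
      (use assms R partial_outside_supp in \<open>force simp: not_le[symmetric] intro: smooth_partial test_function_smooth\<close>)+
qed

lemma test_function_bump: "bump \<in> test_functions"
  by (rule test_functionsI[where R = 1]) (auto intro: smooth_bump bump_eq_0)

lemma smooth_continuous: "smooth f \<Longrightarrow> continuous_on S f"
  by (intro continuous_at_imp_continuous_on ballI differentiable_imp_continuous_within smooth_differentiable)

lemma test_function_continuous: "f \<in> test_functions \<Longrightarrow> continuous_on S f"
  by (intro smooth_continuous test_function_smooth)

section \<open>Uniform bounds and Taylor remainders for test functions\<close>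

lemma bounded_of_zero_outside:
  fixes f :: "'a::euclidean_space \<Rightarrow> 'b::real_normed_vector"
  assumes "continuous_on UNIV f" "\<And>x. norm x > R \<Longrightarrow> f x = 0"
  obtains B where "B \<ge> 0" "\<And>x. norm (f x) \<le> B"
proof -
  have "compact (f ` cball 0 R)"
    using assms(1) by (intro compact_continuous_image) (auto intro: continuous_on_subset)
  then obtain B where B: "B > 0" "\<And>x. x \<in> cball 0 R \<Longrightarrow> norm (f x) \<le> B"
    by (auto simp: bounded_pos dest!: compact_imp_bounded)
  have "norm (f x) \<le> B" for x
    using B assms(2)[of x] by (cases "norm x \<le> R") auto
  then show ?thesis using B that[of B] by auto
qed

lemma test_function_bounded:
  assumes "f \<in> test_functions"
  obtains B where "B \<ge> 0" "\<And>x. \<bar>f x\<bar> \<le> B"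
proof -
  obtain R where "\<And>x. norm x > R \<Longrightarrow> f x = 0"
    using assms test_function_zero_outside by metis
  then show ?thesis
    using bounded_of_zero_outside[OF test_function_continuous[OF assms], of R] that by auto
qed

text \<open>The sum of the absolute partial derivatives stands in for the Euclidean norm of the
  gradient, because each partial derivative of a rescaled bump can be integrated explicitly.\<close>

lemma abs_derivative_le:
  fixes f :: "'a::euclidean_space \<Rightarrow> real"
  assumes "f \<in> test_functions"
  shows "\<bar>frechet_derivative f (at x) v\<bar> \<le> (\<Sum>b\<in>Basis. \<bar>partial b f x\<bar>) * norm v"
proof -
  have "\<bar>frechet_derivative f (at x) v\<bar> = \<bar>\<Sum>i\<in>Basis. (v \<bullet> i) * partial i f x\<bar>"
    by (subst derivative_basis_expansion)
      (auto intro: smooth_differentiable test_function_smooth assms)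
  also have "\<dots> \<le> (\<Sum>i\<in>Basis. \<bar>v \<bullet> i\<bar> * \<bar>partial i f x\<bar>)"
    by (rule order_trans[OF sum_abs]) (simp add: abs_mult)
  also have "\<dots> \<le> (\<Sum>i\<in>Basis. norm v * \<bar>partial i f x\<bar>)"
    by (intro sum_mono mult_right_mono Basis_le_norm) auto
  finally show ?thesis by (simp add: sum_distrib_left mult.commute)
qed

lemma test_function_derivative_bounded:
  fixes f :: "'a::euclidean_space \<Rightarrow> real"
  assumes "f \<in> test_functions"
  obtains B where "B \<ge> 0" "\<And>x v. \<bar>frechet_derivative f (at x) v\<bar> \<le> B * norm v"
proof -
  have "\<exists>B\<ge>0. \<forall>x. \<bar>partial b f x\<bar> \<le> B" if "b \<in> Basis" for b
    using test_function_bounded[OF test_function_partial[OF assms that]] by metis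
  then obtain B where B: "\<And>b. b \<in> Basis \<Longrightarrow> B b \<ge> 0" "\<And>b x. b \<in> Basis \<Longrightarrow> \<bar>partial b f x\<bar> \<le> B b"
    by metis
  show ?thesis
  proof (rule that)
    show "sum B Basis \<ge> 0" using B by (intro sum_nonneg) auto
    fix x v
    have "\<bar>frechet_derivative f (at x) v\<bar> \<le> (\<Sum>b\<in>Basis. \<bar>partial b f x\<bar>) * norm v"
      by (rule abs_derivative_le[OF assms])
    also have "\<dots> \<le> sum B Basis * norm v"
      using B by (intro mult_right_mono sum_mono) auto
    finally show "\<bar>frechet_derivative f (at x) v\<bar> \<le> sum B Basis * norm v" .
  qed
qed

lemma test_function_Lipschitz:
  fixes f :: "'a::euclidean_space \<Rightarrow> real"
  assumes "f \<in> test_functions"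
  obtains B where "B \<ge> 0" "\<And>x y. \<bar>f x - f y\<bar> \<le> B * norm (x - y)"
proof -
  obtain B where B: "B \<ge> 0" "\<And>x v. \<bar>frechet_derivative f (at x) v\<bar> \<le> B * norm v"
    using test_function_derivative_bounded[OF assms] by metis
  have "norm (f x - f y) \<le> B * norm (x - y)" for x y
  proof (rule differentiable_bound[OF convex_UNIV _ _ UNIV_I UNIV_I])
    show "onorm (frechet_derivative f (at x)) \<le> B" for x
      using B by (intro onorm_bound) auto
  qed (auto intro: smooth_has_derivative test_function_smooth assms)
  then show ?thesis using B that by auto
qed

text \<open>The partial derivatives are again test functions, hence Lipschitz, so the remainder
  constant does not depend on the base point. This uniformity lets remainders be integrated whenever
  a derivative is taken under an integral sign.\<close>

lemma test_function_Taylor: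
  fixes f :: "'a::euclidean_space \<Rightarrow> real"
  assumes f: "f \<in> test_functions"
  obtains L where "L \<ge> 0"
    "\<And>x v. \<bar>f (x + v) - f x - frechet_derivative f (at x) v\<bar> \<le> L * (norm v)\<^sup>2"
proof -
  have "\<exists>B\<ge>0. \<forall>x y. \<bar>partial b f x - partial b f y\<bar> \<le> B * norm (x - y)" if "b \<in> Basis" for b
    using test_function_Lipschitz[OF test_function_partial[OF assms that]] by metis
  then obtain B where B: "\<And>b. b \<in> Basis \<Longrightarrow> B b \<ge> 0"
      "\<And>b x y. b \<in> Basis \<Longrightarrow> \<bar>partial b f x - partial b f y\<bar> \<le> B b * norm (x - y)"
    by metis
  have diff: "f differentiable at x" for x
    by (rule test_function_differentiable[OF f])
  show ?thesis
  proof (rule that)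
    show L: "sum B Basis \<ge> 0" using B by (intro sum_nonneg) auto
    fix x v
    have "norm (f (x + v) - f x - frechet_derivative f (at x) (x + v - x)) \<le> norm (x + v - x) * (sum B Basis * norm v)"
    proof (rule differentiable_bound_linearization[where S = "cball x (norm v)"])
      show "x + t *\<^sub>R (x + v - x) \<in> cball x (norm v)" if "t \<in> {0..1}" for t
        using that by (auto simp: dist_norm intro!: mult_left_le_one_le)
      show "(f has_derivative frechet_derivative f (at y)) (at y within cball x (norm v))" for y
        by (rule has_derivative_at_withinI[OF test_function_has_derivative[OF f]])
      fix y assume y: "y \<in> cball x (norm v)"
      show "onorm (frechet_derivative f (at y) - frechet_derivative f (at x)) \<le> sum B Basis * norm v"
      proof (rule onorm_bound)
        fix w
        have "(frechet_derivative f (at y) - frechet_derivative f (at x)) w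
            = (\<Sum>i\<in>Basis. (w \<bullet> i) * (partial i f y - partial i f x))"
          by (simp add: derivative_basis_expansion[OF diff, of _ w] sum_subtractf right_diff_distrib)
        also have "norm \<dots> \<le> (\<Sum>i\<in>Basis. \<bar>w \<bullet> i\<bar> * \<bar>partial i f y - partial i f x\<bar>)"
          unfolding real_norm_def by (rule order_trans[OF sum_abs]) (simp add: abs_mult)
        also have "\<dots> \<le> (\<Sum>i\<in>Basis. norm w * (B i * norm v))"
        proof (intro sum_mono mult_mono Basis_le_norm)
          fix i :: 'a assume i: "i \<in> Basis"
          have "\<bar>partial i f y - partial i f x\<bar> \<le> B i * norm (y - x)" using B i by auto
          also have "\<dots> \<le> B i * norm v"
            using y B(1)[OF i] by (intro mult_left_mono) (auto simp: dist_norm norm_minus_commute)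
          finally show "\<bar>partial i f y - partial i f x\<bar> \<le> B i * norm v" .
        qed auto
        also have "\<dots> = sum B Basis * norm v * norm w"
          by (simp add: sum_distrib_left sum_distrib_right mult_ac)
        finally show "norm ((frechet_derivative f (at y) - frechet_derivative f (at x)) w) \<le> sum B Basis * norm v * norm w" .
      qed (use L in auto)
    qed auto
    then show "\<bar>f (x + v) - f x - frechet_derivative f (at x) v\<bar> \<le> sum B Basis * (norm v)\<^sup>2"
      by (simp add: power2_eq_square mult_ac)
  qed
qed

text \<open>A pointwise quadratic remainder survives integration, which replaces dominated
  convergence when differentiating under an integral. It serves mollifications and the Bessel
  integral alike.\<close>

lemma has_derivative_of_quadratic_remainder:
  fixes F :: "'a::real_normed_vector \<Rightarrow> real"
  assumes D: "bounded_linear D" and d: "d > 0"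
    and rem: "\<And>v. norm v < d \<Longrightarrow> \<bar>F (x + v) - F x - D v\<bar> \<le> M * (norm v)\<^sup>2"
  shows "(F has_derivative D) (at x)"
  unfolding has_derivative_at
proof (intro conjI D)
  show "(\<lambda>v. norm (F (x + v) - F x - D v) / norm v) \<midarrow>0\<rightarrow> 0"
  proof (rule Lim_null_comparison)
    have "norm (norm (F (x + v) - F x - D v) / norm v) \<le> M * norm v" if "norm v < d" for v
    proof (cases "v = 0")
      case False
      then show ?thesis
        using rem[OF that] by (simp add: divide_le_eq power2_eq_square mult_ac)
    qed simp
    then show "\<forall>\<^sub>F v in at 0. norm (norm (F (x + v) - F x - D v) / norm v) \<le> M * norm v"
      unfolding eventually_at using d by (intro exI[of _ d]) (simp add: dist_norm)
    show "((\<lambda>v. M * norm v) \<longlongrightarrow> 0) (at (0::'a))"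
      by (rule tendsto_eq_intros refl | simp)+
  qed
qed

section \<open>Convolution along a continuous map\<close>

lemma integrable_zero_outside:
  fixes f :: "'a::euclidean_space \<Rightarrow> real"
  assumes "continuous_on UNIV f" "\<And>x. norm x > R \<Longrightarrow> f x = 0"
  shows "integrable lborel f"
proof -
  have "integrable lborel (\<lambda>x. indicator (cball 0 R) x *\<^sub>R f x)"
    by (intro borel_integrable_compact) (auto intro: continuous_on_subset assms)
  also have "(\<lambda>x. indicator (cball 0 R) x *\<^sub>R f x) = f"
    using assms(2) by (auto simp: fun_eq_iff indicator_def not_le)
  finally show ?thesis .
qed

text \<open>The convolution of \<open>f\<close> with the image of \<open>w dz\<close> under
  \<open>\<theta>\<close>; if \<open>\<theta>\<close> is a homeomorphism preserving volume, this
  mollifies \<open>w\<close> composed with the inverse of \<open>\<theta>\<close>. Keeping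
  \<open>z\<close> as integration variable means that \<open>x\<close> enters only through
  \<open>f\<close>, and that nothing beyond continuity of \<open>\<theta>\<close> is
  required.\<close>

definition transported_mollification ::
    "('a::euclidean_space \<Rightarrow> real) \<Rightarrow> ('a \<Rightarrow> 'a) \<Rightarrow> ('a \<Rightarrow> real) \<Rightarrow> 'a \<Rightarrow> real" where
  "transported_mollification f \<theta> w x = (\<integral>z. f (x - \<theta> z) * w z \<partial>lborel)"

lemma integrable_transported_mollification:
  fixes f :: "'a::euclidean_space \<Rightarrow> real"
  assumes "continuous_on UNIV f" "continuous_on UNIV \<theta>" "continuous_on UNIV w"
    "\<And>z. norm z > R \<Longrightarrow> w z = 0"
  shows "integrable lborel (\<lambda>z. f (x - \<theta> z) * w z)"
proof (rule integrable_zero_outside)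
  show "continuous_on UNIV (\<lambda>z. f (x - \<theta> z) * w z)"
    by (intro continuous_intros continuous_on_compose2[OF assms(1)] assms) auto
qed (use assms in auto)

lemma transported_mollification_has_derivative:
  fixes f :: "'a::euclidean_space \<Rightarrow> real"
  assumes f: "f \<in> test_functions" and \<theta>: "continuous_on UNIV \<theta>" and w: "continuous_on UNIV w"
    and R: "\<And>z. norm z > R \<Longrightarrow> w z = 0"
  shows "(transported_mollification f \<theta> w has_derivative
      (\<lambda>v. \<Sum>b\<in>Basis. (v \<bullet> b) * transported_mollification (partial b f) \<theta> w x)) (at x)"
proof -
  obtain L where L: "L \<ge> 0"
    "\<And>x v. \<bar>f (x + v) - f x - frechet_derivative f (at x) v\<bar> \<le> L * (norm v)\<^sup>2"
    using test_function_Taylor[OF f] by metis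
  have diff: "f differentiable at x" for x
    by (rule test_function_differentiable[OF f])
  have int: "integrable lborel (\<lambda>z. g (x - \<theta> z) * w z)" if "g \<in> test_functions" for g x
    by (rule integrable_transported_mollification[OF test_function_continuous[OF that] \<theta> w R])
  have intw: "integrable lborel w" by (rule integrable_zero_outside[OF w R])
  show ?thesis
  proof (rule has_derivative_of_quadratic_remainder[OF _ zero_less_one])
    fix v
    let ?r = "\<lambda>z. f (x + v - \<theta> z) * w z - f (x - \<theta> z) * w z
        - (\<Sum>b\<in>Basis. (v \<bullet> b) * (partial b f (x - \<theta> z) * w z))"
    have i12: "integrable lborel (\<lambda>z. f (x + v - \<theta> z) * w z)"
        "integrable lborel (\<lambda>z. f (x - \<theta> z) * w z)"
      by (rule int[OF f])+
    have i3: "integrable lborel (\<lambda>z. (v \<bullet> b) * (partial b f (x - \<theta> z) * w z))" if "b \<in> Basis" for b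
      by (intro integrable_mult_right int test_function_partial f that)
    have "transported_mollification f \<theta> w (x + v) - transported_mollification f \<theta> w x
        - (\<Sum>b\<in>Basis. (v \<bullet> b) * transported_mollification (partial b f) \<theta> w x) = (\<integral>z. ?r z \<partial>lborel)"
      unfolding transported_mollification_def
      by (simp only: Bochner_Integration.integral_diff[OF Bochner_Integration.integrable_diff[OF i12]
            Bochner_Integration.integrable_sum[OF i3]] Bochner_Integration.integral_diff[OF i12]
          Bochner_Integration.integral_sum[OF i3] integral_mult_right_zero)
    also have "\<bar>\<dots>\<bar> \<le> (\<integral>z. L * (norm v)\<^sup>2 * \<bar>w z\<bar> \<partial>lborel)"
    proof (rule order_trans[OF integral_abs_bound], rule integral_mono)
      show "integrable lborel (\<lambda>z. \<bar>?r z\<bar>)"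
        by (intro integrable_abs Bochner_Integration.integrable_diff Bochner_Integration.integrable_sum
          int f test_function_partial integrable_mult_right)
      show "integrable lborel (\<lambda>z. L * (norm v)\<^sup>2 * \<bar>w z\<bar>)"
        using intw by auto
      fix z
      have "?r z = (f ((x - \<theta> z) + v) - f (x - \<theta> z) - frechet_derivative f (at (x - \<theta> z)) v) * w z"
        by (simp add: derivative_basis_expansion[OF diff, of _ v] algebra_simps sum_distrib_left)
      then show "\<bar>?r z\<bar> \<le> L * (norm v)\<^sup>2 * \<bar>w z\<bar>"
        unfolding abs_mult by (metis L(2) abs_ge_zero abs_mult mult_right_mono)
    qed
    finally show "\<bar>transported_mollification f \<theta> w (x + v) - transported_mollification f \<theta> w x
        - (\<Sum>b\<in>Basis. (v \<bullet> b) * transported_mollification (partial b f) \<theta> w x)\<bar>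
        \<le> (L * (\<integral>z. \<bar>w z\<bar> \<partial>lborel)) * (norm v)\<^sup>2"
      by (simp add: mult_ac)
  qed (auto intro!: bounded_linear_sum bounded_linear_mult_left bounded_linear_const_mult
      bounded_linear_mult_const bounded_linear_inner_left)
qed

lemma partial_transported_mollification:
  fixes f :: "'a::euclidean_space \<Rightarrow> real"
  assumes "f \<in> test_functions" "continuous_on UNIV \<theta>" "continuous_on UNIV w"
    "\<And>z. norm z > R \<Longrightarrow> w z = 0" "b \<in> Basis"
  shows "partial b (transported_mollification f \<theta> w) = transported_mollification (partial b f) \<theta> w"
proof -
  have "(\<Sum>i\<in>Basis. (b \<bullet> i) * c i) = c b" for c :: "'a \<Rightarrow> real"
    using assms(5) by (simp add: inner_Basis if_distrib[of "\<lambda>t. t * _"] cong: if_cong)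
  then show ?thesis
    using partial_eq[OF transported_mollification_has_derivative[OF assms(1-4)]] by simp
qed

text \<open>Derivatives fall on \<open>f\<close> alone, so for fixed \<open>\<theta>\<close> and
  \<open>w\<close> these functions are an invariant for smoothness. The support lies in the support
  of \<open>f\<close> enlarged by the bounded image under \<open>\<theta>\<close> of the ball
  carrying \<open>w\<close>.\<close>

lemma test_function_transported_mollification:
  fixes f :: "'a::euclidean_space \<Rightarrow> real"
  assumes f: "f \<in> test_functions" and \<theta>: "continuous_on UNIV \<theta>" and w: "continuous_on UNIV w"
    and R: "\<And>z. norm z > R \<Longrightarrow> w z = 0"
  shows "transported_mollification f \<theta> w \<in> test_functions"
proof -
  let ?G = "{transported_mollification f \<theta> w |f. f \<in> test_functions}"
  have "smooth (transported_mollification f \<theta> w)"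
  proof (rule smooth_fun_span)
    fix g and b :: 'a assume "g \<in> ?G"
    then obtain f where g: "g = transported_mollification f \<theta> w" and f: "f \<in> test_functions"
      by auto
    show "g differentiable at x" for x
      unfolding g using transported_mollification_has_derivative[OF f \<theta> w R] differentiable_def by blast
    assume "b \<in> Basis"
    then show "partial b g \<in> fun_span ?G"
      unfolding g using partial_transported_mollification[OF f \<theta> w R] test_function_partial[OF f]
      by (auto intro!: fun_span_base)
  qed (use f in \<open>auto intro!: fun_span_base\<close>)
  moreover obtain S where S: "\<And>x. norm x > S \<Longrightarrow> f x = 0"
    using test_function_zero_outside[OF f] by metis
  moreover obtain B where B: "\<And>z. z \<in> cball 0 R \<Longrightarrow> norm (\<theta> z) \<le> B"
  proof -
    have "compact (\<theta> ` cball 0 R)"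
      using \<theta> by (intro compact_continuous_image) (auto intro: continuous_on_subset)
    then have "bounded (\<theta> ` cball 0 R)" by (rule compact_imp_bounded)
    then show ?thesis
      using that unfolding bounded_iff by (meson image_eqI)
  qed
  have "transported_mollification f \<theta> w x = 0" if "norm x > S + B" for x
  proof -
    have "f (x - \<theta> z) * w z = 0" for z
    proof (cases "norm z \<le> R")
      case True
      then have "norm (x - \<theta> z) > S"
        using B[of z] that norm_triangle_sub[of x "\<theta> z"] by auto
      then show ?thesis using S by auto
    qed (use R in auto)
    then show ?thesis
      by (simp only: transported_mollification_def Bochner_Integration.integral_zero)
  qed
  ultimately show ?thesis by (intro test_functionsI[where R = "S + B"])
qed

section \<open>Uniform boundedness of curves of measures\<close>

text \<open>Membership in C_0, the space of functions against which \<open>measure_curve\<close>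
  tests continuity.\<close>

definition vanishing :: "('a::euclidean_space \<Rightarrow> real) \<Rightarrow> bool" where
  "vanishing f \<longleftrightarrow> continuous_on UNIV f \<and> (f \<longlongrightarrow> 0) at_infinity"

lemma vanishing_zero_outside:
  fixes f :: "'a::euclidean_space \<Rightarrow> real"
  assumes "continuous_on UNIV f" "\<And>x. norm x > R \<Longrightarrow> f x = 0"
  shows "vanishing f"
proof -
  have "\<forall>\<^sub>F x in at_infinity. f x = 0"
    unfolding eventually_at_infinity using assms(2) by (intro exI[of _ "R + 1"]) auto
  then show ?thesis
    using assms(1) by (auto simp: vanishing_def intro: tendsto_eventually)
qed

lemma vanishing_bounded:
  fixes f :: "'a::euclidean_space \<Rightarrow> real"
  assumes f: "vanishing f"
  obtains B where "B \<ge> 0" "\<And>x. \<bar>f x\<bar> \<le> B"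
proof -
  have "\<forall>\<^sub>F x in at_infinity. dist (f x) 0 < 1"
    using f unfolding vanishing_def by (intro tendstoD) auto
  then obtain R where R: "\<And>x. norm x \<ge> R \<Longrightarrow> \<bar>f x\<bar> < 1"
    by (auto simp: eventually_at_infinity)
  have "compact (f ` cball 0 R)"
    using f by (intro compact_continuous_image) (auto simp: vanishing_def intro: continuous_on_subset)
  then have "bounded (f ` cball 0 R)" by (rule compact_imp_bounded)
  then obtain B where "B > 0" and B: "\<And>x. x \<in> cball 0 R \<Longrightarrow> \<bar>f x\<bar> \<le> B"
    unfolding bounded_pos real_norm_def by (meson image_eqI)
  have "\<bar>f x\<bar> \<le> max B 1" for x
    using B[of x] R[of x] by (cases "norm x \<le> R") auto
  then show ?thesis using \<open>B > 0\<close> that[of "max B 1"] by auto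
qed

lemma vanishing_diff: "vanishing f \<Longrightarrow> vanishing g \<Longrightarrow> vanishing (\<lambda>x. f x - g x)"
  unfolding vanishing_def using tendsto_diff[of f 0 at_infinity g 0] by (auto intro: continuous_on_diff)

lemma vanishing_add: "vanishing f \<Longrightarrow> vanishing g \<Longrightarrow> vanishing (\<lambda>x. f x + g x)"
  unfolding vanishing_def using tendsto_add[of f 0 at_infinity g 0] by (auto intro: continuous_on_add)

lemma vanishing_scale: "vanishing f \<Longrightarrow> vanishing (\<lambda>x. c * f x)"
  unfolding vanishing_def using tendsto_mult_left[of f 0 at_infinity c] by (auto intro: continuous_on_mult_left)

lemma vanishing_sum: "(\<And>i. i \<in> I \<Longrightarrow> vanishing (f i)) \<Longrightarrow> vanishing (\<lambda>x. \<Sum>i\<in>I. f i x)"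
proof (induction I rule: infinite_finite_induct)
  case (insert i I)
  then show ?case by (simp add: vanishing_add)
qed (simp_all add: vanishing_def)

lemma vanishing_measurable: "vanishing f \<Longrightarrow> f \<in> borel_measurable borel"
  by (auto simp: vanishing_def intro: borel_measurable_continuous_onI)

section \<open>Integration against a signed measure\<close>

lemma signed_integrable_bounded:
  fixes f :: "'a::euclidean_space \<Rightarrow> 'b::{banach, second_countable_topology}"
  assumes q: "q \<in> signed_measures" and f: "f \<in> borel_measurable borel" and B: "\<And>x. norm (f x) \<le> B"
  shows "signed_integrable q f"
proof -
  interpret u: finite_measure "upper_variation q" by (rule finite_upper_variation[OF q])
  interpret l: finite_measure "lower_variation q" by (rule finite_lower_variation[OF q])
  show ?thesis
    unfolding signed_integrable_def
    using f B by (auto intro!: u.integrable_const_bound[where B = B] l.integrable_const_bound[where B = B]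
        simp: measurable_cong_sets[OF sets_upper_variation refl] measurable_cong_sets[OF sets_lower_variation refl])
qed

lemma signed_integrable_vanishing:
  assumes "q \<in> signed_measures" "vanishing f"
  shows "signed_integrable q f"
proof -
  obtain B where "\<And>x. \<bar>f x\<bar> \<le> B" using vanishing_bounded[OF assms(2)] by metis
  then show ?thesis
    using assms by (intro signed_integrable_bounded) (auto intro: vanishing_measurable)
qed

lemma signed_integral_diff:
  "signed_integrable q f \<Longrightarrow> signed_integrable q g \<Longrightarrow>
    signed_integral q (\<lambda>x. f x - g x) = signed_integral q f - signed_integral q g"
  by (simp add: signed_integrable_def signed_integral_def)

lemma signed_integral_add:
  "signed_integrable q f \<Longrightarrow> signed_integrable q g \<Longrightarrow>
    signed_integral q (\<lambda>x. f x + g x) = signed_integral q f + signed_integral q g"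
  by (simp add: signed_integrable_def signed_integral_def)

lemma signed_integral_scale:
  fixes f :: "'a::euclidean_space \<Rightarrow> real"
  shows "signed_integral q (\<lambda>x. c * f x) = c * signed_integral q f"
  by (simp add: signed_integral_def right_diff_distrib)

lemma signed_integral_inner:
  fixes f :: "'a::euclidean_space \<Rightarrow> 'b::euclidean_space"
  assumes "signed_integrable q f"
  shows "signed_integral q f \<bullet> c = signed_integral q (\<lambda>x. f x \<bullet> c)"
  using assms by (simp add: signed_integral_def signed_integrable_def inner_diff_left)

lemma signed_integral_bound:
  fixes f :: "'a::euclidean_space \<Rightarrow> real"
  assumes q: "q \<in> signed_measures" and f: "f \<in> borel_measurable borel" and B: "\<And>x. \<bar>f x\<bar> \<le> B"
  shows "\<bar>signed_integral q f\<bar> \<le> (measure (upper_variation q) UNIV + measure (lower_variation q) UNIV) * B"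
proof -
  interpret u: finite_measure "upper_variation q" by (rule finite_upper_variation[OF q])
  interpret l: finite_measure "lower_variation q" by (rule finite_lower_variation[OF q])
  have int: "integrable (upper_variation q) f" "integrable (lower_variation q) f"
    using signed_integrable_bounded[OF q f, of B] B by (auto simp: signed_integrable_def)
  have "\<bar>\<integral>x. f x \<partial>upper_variation q\<bar> \<le> (\<integral>x. B \<partial>upper_variation q)"
    by (rule order_trans[OF integral_abs_bound integral_mono]) (use int B in auto)
  moreover have "\<bar>\<integral>x. f x \<partial>lower_variation q\<bar> \<le> (\<integral>x. B \<partial>lower_variation q)"
    by (rule order_trans[OF integral_abs_bound integral_mono]) (use int B in auto)
  ultimately show ?thesis by (simp add: signed_integral_def algebra_simps)
qed

text \<open>The uniform boundedness principle, proved by Baire's theorem on C_0 regarded as a closed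
  subspace \<open>X\<close> of the bounded continuous functions: some level set \<open>E n\<close>
  of the pointwise bounds has interior, and a ball inside it controls all functionals at
  once.\<close>

lemma signed_integral_uniform_bound:
  fixes q :: "'i \<Rightarrow> 'a::euclidean_space set \<Rightarrow> real"
  assumes q: "\<And>t. t \<in> I \<Longrightarrow> q t \<in> signed_measures"
    and pointwise: "\<And>f. vanishing f \<Longrightarrow> \<exists>B. \<forall>t\<in>I. \<bar>signed_integral (q t) f\<bar> \<le> B"
  obtains C where "C \<ge> 0"
    "\<And>t f B. t \<in> I \<Longrightarrow> vanishing f \<Longrightarrow> (\<And>x. \<bar>f x\<bar> \<le> B) \<Longrightarrow> \<bar>signed_integral (q t) f\<bar> \<le> C * B"
proof -
  define X where "X = {g :: 'a \<Rightarrow>\<^sub>C real. vanishing (apply_bcontfun g)}"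
  define E where "E n = {g \<in> X. \<forall>t\<in>I. \<bar>signed_integral (q t) (apply_bcontfun g)\<bar> \<le> real n}" for n
  have zero: "vanishing (\<lambda>x::'a. 0)" by (simp add: vanishing_def)
  \<comment> \<open>Closedness makes \<open>X\<close> completely metrizable, as Baire's theorem
    requires.\<close>
  have closed_X: "closed X"
    unfolding closed_sequential_limits
  proof (intro allI impI, elim conjE)
    fix g :: "nat \<Rightarrow> 'a \<Rightarrow>\<^sub>C real" and l assume g: "\<forall>n. g n \<in> X" and lim: "g \<longlonglongrightarrow> l"
    have "\<forall>\<^sub>F x in at_infinity. dist (l x) 0 < e" if "e > 0" for e
    proof -
      obtain n where n: "dist (g n) l < e / 2"
        using metric_LIMSEQ_D[OF lim half_gt_zero[OF \<open>e > 0\<close>]] by blast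
      have "(apply_bcontfun (g n) \<longlongrightarrow> 0) at_infinity"
        using g by (simp add: X_def vanishing_def)
      then have "\<forall>\<^sub>F x in at_infinity. dist (g n x) 0 < e / 2"
        by (rule tendstoD) (use that in simp)
      then show ?thesis
      proof (rule eventually_mono)
        fix x assume "dist (g n x) 0 < e / 2"
        moreover have "dist (g n x) (l x) < e / 2"
          by (rule dist_fun_lt_imp_dist_val_lt[OF n])
        ultimately show "dist (l x) 0 < e" unfolding dist_real_def by linarith
      qed
    qed
    then show "l \<in> X" by (auto simp: X_def vanishing_def tendsto_iff)
  qed
  have closed_E: "closedin (top_of_set X) (E n)" for n
  proof -
    \<comment> \<open>The outer \<open>X\<close> gives the right set also for empty
      \<open>I\<close>; the inner one is there because the pairing is shown continuous on
      \<open>X\<close> only.\<close>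
    have E: "E n = X \<inter> (\<Inter>t\<in>I. X \<inter> (\<lambda>g. signed_integral (q t) (apply_bcontfun g)) -` {- real n..real n})"
      unfolding E_def atLeastAtMost_iff abs_le_iff minus_le_iff[of _ "real n"] vimage_def
      by (auto simp: minus_le_iff)
    have cont: "continuous_on X (\<lambda>g. signed_integral (q t) (apply_bcontfun g))" if t: "t \<in> I" for t
    proof -
      let ?V = "measure (upper_variation (q t)) UNIV + measure (lower_variation (q t)) UNIV"
      have "?V-lipschitz_on X (\<lambda>g. signed_integral (q t) (apply_bcontfun g))"
      proof (rule lipschitz_onI)
        fix g h assume "g \<in> X" "h \<in> X"
        then have v: "vanishing (apply_bcontfun g)" "vanishing (apply_bcontfun h)" by (auto simp: X_def)
        have "\<bar>signed_integral (q t) (\<lambda>x. g x - h x)\<bar> \<le> ?V * dist g h"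
          by (rule signed_integral_bound[OF q[OF t] vanishing_measurable[OF vanishing_diff[OF v]]])
            (metis dist_bounded dist_real_def)
        then show "dist (signed_integral (q t) g) (signed_integral (q t) h) \<le> ?V * dist g h"
          using v t by (simp add: signed_integral_diff signed_integrable_vanishing q dist_real_def)
      qed auto
      then show ?thesis by (rule lipschitz_on_continuous_on)
    qed
    show ?thesis
    proof (cases "I = {}")
      case False
      then show ?thesis
        unfolding E by (intro closedin_Int closedin_INT continuous_closedin_preimage cont) auto
    qed (simp add: E)
  qed
  have union: "(\<Union>n. E n) = X"
  proof (intro equalityI subsetI)
    fix g assume g: "g \<in> X"
    then obtain B where "\<forall>t\<in>I. \<bar>signed_integral (q t) (apply_bcontfun g)\<bar> \<le> B"
      using pointwise by (auto simp: X_def)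
    moreover obtain n where "B \<le> real n" using real_arch_simple by blast
    ultimately have "g \<in> E n" using g by (auto simp: E_def intro: order_trans)
    then show "g \<in> (\<Union>n. E n)" by blast
  qed (auto simp: E_def)
  have "\<exists>n. top_of_set X interior_of E n \<noteq> {}"
  proof (rule ccontr)
    assume "\<nexists>n. top_of_set X interior_of E n \<noteq> {}"
    then have "top_of_set X interior_of \<Union>(range E) = {}"
      using closed_E closed_X
      by (intro Baire_category_alt disjI1 completely_metrizable_space_closedin
          completely_metrizable_space_euclidean) auto
    moreover have "top_of_set X interior_of X = X"
      using interior_of_topspace[of "top_of_set X"] by simp
    ultimately have "X = {}" using union by simp
    moreover have "(0 :: 'a \<Rightarrow>\<^sub>C real) \<in> X" using zero by (simp add: X_def)
    ultimately show False by auto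
  qed
  then obtain n g\<^sub>0 where "g\<^sub>0 \<in> top_of_set X interior_of E n" by auto
  then obtain U where "openin (top_of_set X) U" "g\<^sub>0 \<in> U" "U \<subseteq> E n"
    unfolding interior_of_def by auto
  then obtain r where r: "r > 0" "ball g\<^sub>0 r \<inter> X \<subseteq> E n" "g\<^sub>0 \<in> X"
    unfolding openin_contains_ball by blast
  have g\<^sub>0: "g\<^sub>0 \<in> E n" using r by auto
  show ?thesis
  proof (rule that[of "4 * real n / r"])
    fix t B and f :: "'a \<Rightarrow> real" assume t: "t \<in> I" and f: "vanishing f" and B: "\<And>x. \<bar>f x\<bar> \<le> B"
    show "\<bar>signed_integral (q t) f\<bar> \<le> 4 * real n / r * B"
    proof (cases "B = 0")
      case True
      then have "f = (\<lambda>x. 0)" using B by (auto simp: fun_eq_iff)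
      then show ?thesis using True by (simp add: signed_integral_def)
    next
      case False
      moreover have "B \<ge> 0" using B[of 0] by simp
      ultimately have pos: "B > 0" by simp
      \<comment> \<open>With this scaling c f has norm at most r / 2, so the shifted centre stays in
        the open ball. Subtracting the pairing with the centre bounds c times the pairing with
        \<open>f\<close> by 2 n, whence the constant 4 n / r.\<close>
      define c where "c = r / (2 * B)"
      have c: "c > 0" using r pos by (simp add: c_def)
      have "f \<in> bcontfun" using f B by (intro bcontfun_normI[where b = B]) (auto simp: vanishing_def)
      then obtain h where h: "f = apply_bcontfun h" by (rule bcontfunE)
      have "norm h \<le> B" by (rule norm_bound) (use B h in auto)
      then have "norm (c *\<^sub>R h) < r" using pos r by (simp add: c_def field_simps)
      moreover have eq: "apply_bcontfun (g\<^sub>0 + c *\<^sub>R h) = (\<lambda>x. g\<^sub>0 x + c * f x)"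
        by (auto simp: h plus_bcontfun.rep_eq scaleR_bcontfun.rep_eq)
      have vg: "vanishing (apply_bcontfun g\<^sub>0)" using r by (auto simp: X_def)
      have "g\<^sub>0 + c *\<^sub>R h \<in> X" unfolding X_def mem_Collect_eq eq by (intro vanishing_add vg vanishing_scale f)
      ultimately have "g\<^sub>0 + c *\<^sub>R h \<in> E n" using r by (auto simp: dist_norm)
      then have "\<bar>signed_integral (q t) (\<lambda>x. g\<^sub>0 x + c * f x)\<bar> \<le> real n" using t by (auto simp: E_def eq simp flip: h)
      moreover have "\<bar>signed_integral (q t) g\<^sub>0\<bar> \<le> real n" using t g\<^sub>0 by (auto simp: E_def)
      ultimately have "\<bar>c * signed_integral (q t) f\<bar> \<le> 2 * real n"
        by (simp add: signed_integral_add signed_integrable_vanishing q t vg vanishing_scale f signed_integral_scale)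
      then show ?thesis using c pos r by (simp add: abs_mult c_def field_simps)
    qed
  qed (use r in auto)
qed

section \<open>Weakly continuous curves of measures\<close>

lemma measure_curve_signed: "measure_curve q \<Longrightarrow> q t \<in> signed_measures"
  by (simp add: measure_curve_def)

lemma measure_curve_integrable: "measure_curve q \<Longrightarrow> vanishing f \<Longrightarrow> signed_integrable (q t) f"
  by (intro signed_integrable_vanishing measure_curve_signed)

lemma measure_curve_continuous:
  "measure_curve q \<Longrightarrow> vanishing f \<Longrightarrow> continuous_on UNIV (\<lambda>t. signed_integral (q t) f)"
  by (simp add: measure_curve_def vanishing_def)

text \<open>Weak continuity bounds each single pairing on the compact interval
  \<open>{-T..T}\<close>; uniform boundedness makes the bound simultaneous in the test function. In
  this form it plays the part of a local bound on the total variation.\<close>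

lemma measure_curve_uniform_bound:
  assumes q: "measure_curve q"
  obtains C where "C \<ge> 0"
    "\<And>t f B. \<bar>t\<bar> \<le> T \<Longrightarrow> vanishing f \<Longrightarrow> (\<And>x. \<bar>f x\<bar> \<le> B) \<Longrightarrow> \<bar>signed_integral (q t) f\<bar> \<le> C * B"
proof -
  have "\<exists>B. \<forall>t\<in>{-T..T}. \<bar>signed_integral (q t) f\<bar> \<le> B" if "vanishing f" for f
  proof -
    have "compact ((\<lambda>t. signed_integral (q t) f) ` {-T..T})"
      using measure_curve_continuous[OF q that]
      by (intro compact_continuous_image) (auto intro: continuous_on_subset)
    then have "bounded ((\<lambda>t. signed_integral (q t) f) ` {-T..T})" by (rule compact_imp_bounded)
    then show ?thesis unfolding bounded_iff real_norm_def by (meson image_eqI)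
  qed
  then show ?thesis
    using signed_integral_uniform_bound[of "{-T..T}" q] measure_curve_signed[OF q] that
    by (metis abs_le_iff atLeastAtMost_iff minus_le_iff)
qed

text \<open>A strong-weak pairing: the measures converge only weakly, so the test functions have to
  converge uniformly, and the difference is absorbed by the bound on the functionals near
  \<open>t\<close>.\<close>

lemma measure_curve_tendsto:
  assumes q: "measure_curve q" and f: "\<And>s. vanishing (f s)" and lim: "uniform_limit UNIV f g (at t)"
    and g: "vanishing g"
  shows "((\<lambda>s. signed_integral (q s) (f s)) \<longlongrightarrow> signed_integral (q t) g) (at t)"
proof -
  obtain C where C: "C \<ge> 0" "\<And>s f B. \<bar>s\<bar> \<le> \<bar>t\<bar> + 1 \<Longrightarrow> vanishing f \<Longrightarrow> (\<And>x. \<bar>f x\<bar> \<le> B)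
      \<Longrightarrow> \<bar>signed_integral (q s) f\<bar> \<le> C * B"
    using measure_curve_uniform_bound[OF q] by metis
  have near: "\<forall>\<^sub>F s in at t. \<bar>s\<bar> \<le> \<bar>t\<bar> + 1"
    unfolding eventually_at by (intro exI[of _ 1]) (auto simp: dist_real_def)
  have "((\<lambda>s. signed_integral (q s) (\<lambda>x. f s x - g x)) \<longlongrightarrow> 0) (at t)"
  proof (rule tendstoI)
    fix e :: real assume e: "e > 0"
    \<comment> \<open>The summand 1 covers the case \<open>C = 0\<close>.\<close>
    define d where "d = e / (2 * (C + 1))"
    have d: "d > 0" "C * d < e" using e C(1) by (auto simp: d_def field_simps intro: add_nonneg_pos)
    have "\<forall>\<^sub>F s in at t. \<forall>x\<in>UNIV. dist (f s x) (g x) < d"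
      using lim d by (auto simp: uniform_limit_iff)
    with near show "\<forall>\<^sub>F s in at t. dist (signed_integral (q s) (\<lambda>x. f s x - g x)) 0 < e"
    proof eventually_elim
      case (elim s)
      then have "\<bar>signed_integral (q s) (\<lambda>x. f s x - g x)\<bar> \<le> C * d"
        by (intro C vanishing_diff f g) (auto simp: dist_real_def intro: less_imp_le)
      then show ?case using d by simp
    qed
  qed
  moreover have "((\<lambda>s. signed_integral (q s) g) \<longlongrightarrow> signed_integral (q t) g) (at t)"
    using measure_curve_continuous[OF q g] by (simp add: continuous_on_def)
  ultimately have "((\<lambda>s. signed_integral (q s) (\<lambda>x. f s x - g x) + signed_integral (q s) g)
      \<longlongrightarrow> 0 + signed_integral (q t) g) (at t)"
    by (rule tendsto_add)
  then show ?thesis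
    by (simp add: signed_integral_diff measure_curve_integrable[OF q] f g)
qed

section \<open>The weak co-adjoint action\<close>

lemma C0_div_curve_jointly_continuous:
  assumes u: "C0_div_curve u"
  shows "continuous_on UNIV (\<lambda>(t, x). u t x)"
  unfolding continuous_on_iff
proof (intro ballI allI impI)
  fix p :: "real \<times> (real^2)" and e :: real assume e: "e > 0"
  obtain t x where p: "p = (t, x)" by fastforce
  have cont: "continuous_on UNIV (u t)" using u by (simp add: C0_div_curve_def C0_div_def)
  obtain d where d: "d > 0" "\<And>y. dist y x < d \<Longrightarrow> dist (u t y) (u t x) < e / 2"
    using cont[unfolded continuous_on_iff, rule_format, of x "e / 2"] e by auto
  have "\<forall>\<^sub>F s in at t. \<forall>y\<in>UNIV. dist (u s y) (u t y) < e / 2"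
    using u half_gt_zero[OF e] unfolding C0_div_curve_def uniform_limit_iff by blast
  then obtain d' where d': "d' > 0"
      "\<And>s y. s \<noteq> t \<Longrightarrow> dist s t < d' \<Longrightarrow> dist (u s y) (u t y) < e / 2"
    unfolding eventually_at by auto
  have "dist (u s y) (u t x) < e" if "dist (s, y) (t, x) < min d d'" for s y
  proof -
    have "dist s t < d'" "dist y x < d"
      using that dist_fst_le[of "(s, y)" "(t, x)"] dist_snd_le[of "(s, y)" "(t, x)"] by auto
    then have "dist (u s y) (u t y) < e / 2" "dist (u t y) (u t x) < e / 2"
      using d d' e by (cases "s = t"; auto)+
    then show ?thesis using dist_triangle[of "u s y" "u t x" "u t y"] by linarith
  qed
  then show "\<exists>d>0. \<forall>p'\<in>UNIV. dist p' p < d \<longrightarrow> dist (case p' of (t, x) \<Rightarrow> u t x) (case p of (t, x) \<Rightarrow> u t x) < e"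
    using d d' unfolding p by (intro exI[of _ "min d d'"]) auto
qed

lemma uniform_limit_of_zero_outside:
  fixes H :: "real \<times> 'a::euclidean_space \<Rightarrow> real"
  assumes H: "continuous_on UNIV H" and R: "\<And>p. norm p > R \<Longrightarrow> H p = 0"
  shows "uniform_limit UNIV (\<lambda>s x. H (s, x)) (\<lambda>x. H (t, x)) (at t)"
  unfolding uniform_limit_iff
proof (intro allI impI)
  fix e :: real assume e: "e > 0"
  \<comment> \<open>Radius R + 1: if two points are less than 1 apart and one of them lies in the
    ball of radius R, both lie in this one; otherwise both values are 0.\<close>
  have "uniformly_continuous_on (cball 0 (R + 1)) H"
    by (intro compact_uniformly_continuous continuous_on_subset[OF H]) auto
  then obtain d where d: "d > 0" "\<And>p p'. p \<in> cball 0 (R + 1) \<Longrightarrow> p' \<in> cball 0 (R + 1) \<Longrightarrow>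
      dist p' p < d \<Longrightarrow> dist (H p') (H p) < e"
    using e unfolding uniformly_continuous_on_def by metis
  have "dist (H (s, x)) (H (t, x)) < e" if st: "dist s t < min d 1" for s x
  proof -
    have dd: "dist (s, x) (t, x) < min d 1" using st by (simp add: dist_Pair_Pair)
    then have near: "norm (s, x) \<le> norm (t, x) + 1" "norm (t, x) \<le> norm (s, x) + 1"
      using norm_triangle_sub[of "(s, x)" "(t, x)"] norm_triangle_sub[of "(t, x)" "(s, x)"]
      unfolding dist_norm by (simp_all only: norm_minus_commute[of "(t, x)"])
    show ?thesis
    proof (cases "norm (s, x) > R \<and> norm (t, x) > R")
      case True
      then show ?thesis using R e by simp
    next
      case False
      then have "(s, x) \<in> cball 0 (R + 1)" "(t, x) \<in> cball 0 (R + 1)" using near by auto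
      then show ?thesis using d(2) dd by simp
    qed
  qed
  then show "\<forall>\<^sub>F s in at t. \<forall>x\<in>UNIV. dist (H (s, x)) (H (t, x)) < e"
    unfolding eventually_at using d by (intro exI[of _ "min d 1"]) auto
qed

text \<open>The integrand is a single directional derivative of \<phi> in space-time, along (1, u).
  Linearity in \<phi>, continuity and the support property are then read off from the Frechet
  derivative.\<close>

lemma transport_integrand_eq:
  assumes "smooth \<phi>"
  shows "transport_integrand u \<phi> t x = frechet_derivative \<phi> (at (t, x)) (1, u t x)"
proof -
  note D = smooth_has_derivative[OF assms, of "(t, x)"]
  interpret bounded_linear "frechet_derivative \<phi> (at (t, x))"
    using D by (rule has_derivative_bounded_linear)
  have "((\<lambda>s. \<phi> (s, x)) has_derivative (\<lambda>h. frechet_derivative \<phi> (at (t, x)) (h, 0))) (at t)"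
    by (rule has_derivative_compose[of "\<lambda>s. (s, x)", OF has_derivative_Pair[OF has_derivative_ident has_derivative_const] D])
  moreover have "(\<lambda>h. frechet_derivative \<phi> (at (t, x)) (h, 0)) = (*) (frechet_derivative \<phi> (at (t, x)) (1, 0))"
  proof
    fix h
    show "frechet_derivative \<phi> (at (t, x)) (h, 0) = frechet_derivative \<phi> (at (t, x)) (1, 0) * h"
      using scale[of h "(1, 0)"] by (simp add: mult.commute)
  qed
  ultimately have time: "deriv (\<lambda>s. \<phi> (s, x)) t = frechet_derivative \<phi> (at (t, x)) (1, 0)"
    by (intro DERIV_imp_deriv) (simp only: has_field_derivative_def)
  have "((\<lambda>y. \<phi> (t, y)) has_derivative (\<lambda>h. frechet_derivative \<phi> (at (t, x)) (0, h))) (at x)"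
    by (rule has_derivative_compose[of "\<lambda>y. (t, y)", OF has_derivative_Pair[OF has_derivative_const has_derivative_ident] D])
  then have "grad (\<lambda>y. \<phi> (t, y)) x = (\<chi> i. frechet_derivative \<phi> (at (t, x)) (0, axis i 1))"
    by (simp add: grad_def frechet_derivative_at[symmetric])
  then have "u t x \<bullet> grad (\<lambda>y. \<phi> (t, y)) x = (\<Sum>i\<in>UNIV. frechet_derivative \<phi> (at (t, x)) (u t x $ i *\<^sub>R (0, axis i 1)))"
    by (simp only: scaleR inner_vec_def vec_lambda_beta inner_real_def real_scaleR_def)
  also have "\<dots> = frechet_derivative \<phi> (at (t, x)) (\<Sum>i\<in>UNIV. u t x $ i *\<^sub>R (0, axis i 1))"
    by (simp only: sum)
  also have "(\<Sum>i\<in>UNIV. u t x $ i *\<^sub>R (0, axis i 1)) = (0 :: real, u t x)"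
    by (simp add: prod_eq_iff fst_sum snd_sum vec_eq_iff axis_def if_distrib[of "\<lambda>c. _ * c"] cong: if_cong)
  finally have space: "u t x \<bullet> grad (\<lambda>y. \<phi> (t, y)) x = frechet_derivative \<phi> (at (t, x)) (0, u t x)" .
  have "frechet_derivative \<phi> (at (t, x)) ((1, 0) + (0, u t x))
      = frechet_derivative \<phi> (at (t, x)) (1, 0) + frechet_derivative \<phi> (at (t, x)) (0, u t x)"
    by (rule add)
  then show ?thesis by (simp add: transport_integrand_def time space)
qed

lemma transport_integrand_expansion:
  assumes "smooth \<phi>"
  shows "transport_integrand u \<phi> t x = (\<Sum>b\<in>Basis. ((1, u t x) \<bullet> b) * partial b \<phi> (t, x))"
  unfolding transport_integrand_eq[OF assms]
  by (rule derivative_basis_expansion[OF smooth_differentiable[OF assms]])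

lemma norm_Pair_ge: "norm x \<le> norm (t, x)" "norm t \<le> norm (t, x)"
  by (simp_all add: norm_Pair)

locale transport_curves =
  fixes u q
  assumes u: "C0_div_curve u" and q: "measure_curve q"
begin

lemma transport_integrand_jointly_continuous:
  assumes "\<phi> \<in> test_functions"
  shows "continuous_on UNIV (\<lambda>p. transport_integrand u \<phi> (fst p) (snd p))"
proof -
  have cu: "continuous_on UNIV (\<lambda>p. u (fst p) (snd p))"
    using C0_div_curve_jointly_continuous[OF u] by (simp add: case_prod_beta)
  have cp: "continuous_on UNIV (partial b \<phi>)" if "b \<in> Basis" for b
    by (rule test_function_continuous[OF test_function_partial[OF assms that]])
  show ?thesis
    unfolding transport_integrand_expansion[OF test_function_smooth[OF assms]] prod.collapse
    by (intro continuous_on_sum continuous_on_mult continuous_on_inner continuous_on_Pair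
        continuous_on_const cu cp)
qed

lemma transport_integrand_zero_outside:
  assumes "\<phi> \<in> test_functions" "(t, x) \<notin> supp \<phi>"
  shows "transport_integrand u \<phi> t x = 0"
  unfolding transport_integrand_expansion[OF test_function_smooth[OF assms(1)]]
  using partial_outside_supp[OF assms(2)] by simp

lemma transport_integrand_zero_outside_cball:
  assumes "\<phi> \<in> test_functions"
  obtains R where "\<And>t x. norm (t, x) > R \<Longrightarrow> transport_integrand u \<phi> t x = 0"
proof -
  have "bounded (supp \<phi>)" using assms by (simp add: test_functions_def compact_imp_bounded)
  then obtain R where "\<And>p. p \<in> supp \<phi> \<Longrightarrow> norm p \<le> R"
    by (auto simp: bounded_pos)
  then show ?thesis
    using that[of R] transport_integrand_zero_outside[OF assms] by (meson not_le)
qed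

lemma vanishing_transport_integrand:
  assumes "\<phi> \<in> test_functions"
  shows "vanishing (transport_integrand u \<phi> t)"
proof -
  obtain R where R: "\<And>t x. norm (t, x) > R \<Longrightarrow> transport_integrand u \<phi> t x = 0"
    using transport_integrand_zero_outside_cball[OF assms] by metis
  show ?thesis
  proof (rule vanishing_zero_outside)
    show "continuous_on UNIV (transport_integrand u \<phi> t)"
      using continuous_on_compose2[OF transport_integrand_jointly_continuous[OF assms],
          OF continuous_on_Pair[OF continuous_on_const[of UNIV t] continuous_on_id]] by simp
    show "transport_integrand u \<phi> t x = 0" if "norm x > R" for x
      by (rule R) (use that norm_Pair_ge(1)[of x t] in linarith)
  qed
qed

lemma transport_integral_integrable:
  assumes "\<phi> \<in> test_functions"
  shows "integrable lborel (\<lambda>t. signed_integral (q t) (transport_integrand u \<phi> t))"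
proof -
  obtain R where R: "\<And>t x. norm (t, x) > R \<Longrightarrow> transport_integrand u \<phi> t x = 0"
    using transport_integrand_zero_outside_cball[OF assms] by metis
  show ?thesis
  proof (rule integrable_zero_outside)
    have "uniform_limit UNIV (transport_integrand u \<phi>) (transport_integrand u \<phi> t) (at t)" for t
      using uniform_limit_of_zero_outside[OF transport_integrand_jointly_continuous[OF assms], of R t] R
      by simp
    then show "continuous_on UNIV (\<lambda>t. signed_integral (q t) (transport_integrand u \<phi> t))"
      unfolding continuous_on_def
      using measure_curve_tendsto[OF q vanishing_transport_integrand[OF assms] _ vanishing_transport_integrand[OF assms]]
      by simp
    show "signed_integral (q t) (transport_integrand u \<phi> t) = 0" if "norm t > R" for t
    proof -
      have "transport_integrand u \<phi> t = (\<lambda>x. 0)"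
        by (rule ext, rule R) (use that norm_Pair_ge(2)[of t] in \<open>meson less_le_trans\<close>)
      then show ?thesis by (simp add: signed_integral_def)
    qed
  qed
qed

lemma w_ad_integrable_test_function: "\<phi> \<in> test_functions \<Longrightarrow> w_ad_integrable u q \<phi>"
  unfolding w_ad_integrable_def
  by (intro conjI allI transport_integral_integrable measure_curve_integrable[OF q]
      vanishing_transport_integrand)

lemma transport_integrand_add:
  assumes "\<phi> \<in> test_functions" "\<psi> \<in> test_functions"
  shows "transport_integrand u (\<lambda>z. \<phi> z + \<psi> z) t = (\<lambda>x. transport_integrand u \<phi> t x + transport_integrand u \<psi> t x)"
proof -
  note s = assms[THEN test_function_smooth]
  have "((\<lambda>z. \<phi> z + \<psi> z) has_derivative
      (\<lambda>h. frechet_derivative \<phi> (at z) h + frechet_derivative \<psi> (at z) h)) (at z)" for z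
    by (intro has_derivative_add smooth_has_derivative s)
  note D = frechet_derivative_at[OF this, symmetric]
  show ?thesis by (simp add: fun_eq_iff transport_integrand_eq s smooth_add D)
qed

lemma transport_integrand_scale:
  assumes "\<phi> \<in> test_functions"
  shows "transport_integrand u (\<lambda>z. c * \<phi> z) t = (\<lambda>x. c * transport_integrand u \<phi> t x)"
proof -
  note s = assms[THEN test_function_smooth]
  have "((\<lambda>z. c * \<phi> z) has_derivative (\<lambda>h. c * frechet_derivative \<phi> (at z) h)) (at z)" for z
    by (intro has_derivative_mult_right smooth_has_derivative s)
  note D = frechet_derivative_at[OF this, symmetric]
  show ?thesis by (simp add: fun_eq_iff transport_integrand_eq s smooth_scale D)
qed

lemma w_ad_add:
  assumes "\<phi> \<in> test_functions" "\<psi> \<in> test_functions"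
  shows "w_ad u q (\<lambda>z. \<phi> z + \<psi> z) = w_ad u q \<phi> + w_ad u q \<psi>"
  unfolding w_ad_def
  by (simp add: transport_integrand_add signed_integral_add measure_curve_integrable[OF q]
      vanishing_transport_integrand transport_integral_integrable assms)

lemma w_ad_scale:
  assumes "\<phi> \<in> test_functions"
  shows "w_ad u q (\<lambda>z. c * \<phi> z) = c * w_ad u q \<phi>"
  unfolding w_ad_def by (simp add: transport_integrand_scale signed_integral_scale assms)

text \<open>The functional has order one: the lists of length at most 1 are the empty one and the
  single directions. In the constant, 2 T is the length of the time window that contains
  \<open>C\<close>, \<open>K\<close> bounds the functionals on it, and \<open>U\<close> bounds (1,
  u) on \<open>C\<close>.\<close>

lemma w_ad_bound:
  assumes "compact C"
  shows "\<exists>B N. \<forall>\<phi>\<in>test_functions. supp \<phi> \<subseteq> C \<longrightarrow>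
    \<bar>w_ad u q \<phi>\<bar> \<le> B * (\<Sum>bs | set bs \<subseteq> Basis \<and> length bs \<le> N. SUP z. \<bar>iterated_partial bs \<phi> z\<bar>)"
proof -
  obtain T where T: "T > 0" "\<And>p. p \<in> C \<Longrightarrow> norm p \<le> T"
    using compact_imp_bounded[OF assms] by (auto simp: bounded_pos)
  obtain K where K: "K \<ge> 0" "\<And>t f B. \<bar>t\<bar> \<le> T \<Longrightarrow> vanishing f \<Longrightarrow> (\<And>x. \<bar>f x\<bar> \<le> B) \<Longrightarrow> \<bar>signed_integral (q t) f\<bar> \<le> K * B"
    using measure_curve_uniform_bound[OF q] by metis
  have "continuous_on C (\<lambda>p. (1::real, u (fst p) (snd p)))"
    using C0_div_curve_jointly_continuous[OF u]
    by (intro continuous_on_Pair continuous_on_const) (auto simp: case_prod_beta intro: continuous_on_subset)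
  then have "bounded ((\<lambda>p. (1::real, u (fst p) (snd p))) ` C)"
    using assms by (intro compact_imp_bounded compact_continuous_image)
  then obtain U where "U > 0" and "\<forall>v \<in> (\<lambda>p. (1::real, u (fst p) (snd p))) ` C. norm v \<le> U"
    unfolding bounded_pos by blast
  then have U: "U > 0" "\<And>t x. (t, x) \<in> C \<Longrightarrow> norm (1::real, u t x) \<le> U"
    by force+
  let ?I = "{bs :: (real \<times> (real^2)) list. set bs \<subseteq> Basis \<and> length bs \<le> 1}"
  define S where "S \<phi> = (\<Sum>bs\<in>?I. SUP z. \<bar>iterated_partial bs \<phi> z\<bar>)" for \<phi>
  have "\<bar>w_ad u q \<phi>\<bar> \<le> (2 * T * (K * U)) * S \<phi>" if \<phi>: "\<phi> \<in> test_functions" and sub: "supp \<phi> \<subseteq> C" for \<phi>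
  proof -
    have finI: "finite ?I" by (rule finite_lists_length_le) simp
    have tf: "iterated_partial bs \<phi> \<in> test_functions" if "set bs \<subseteq> Basis" for bs
      using that by (induction bs) (auto intro: \<phi> test_function_partial)
    have upper: "\<bar>iterated_partial bs \<phi> z\<bar> \<le> (SUP z. \<bar>iterated_partial bs \<phi> z\<bar>)" if bs: "set bs \<subseteq> Basis" for bs z
    proof (rule cSUP_upper)
      obtain B where "\<And>z. \<bar>iterated_partial bs \<phi> z\<bar> \<le> B"
        using test_function_bounded[OF tf[OF bs]] by metis
      then show "bdd_above (range (\<lambda>z. \<bar>iterated_partial bs \<phi> z\<bar>))"
        by (intro bdd_aboveI2)
    qed simp
    have nn: "0 \<le> (SUP z. \<bar>iterated_partial bs \<phi> z\<bar>)" if "set bs \<subseteq> Basis" for bs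
      using upper[OF that, of 0] by linarith
    have S0: "S \<phi> \<ge> 0" unfolding S_def using nn by (intro sum_nonneg) auto
    have sumS: "(\<Sum>b\<in>Basis. SUP z. \<bar>partial b \<phi> z\<bar>) \<le> S \<phi>"
    proof -
      have "(\<Sum>b\<in>Basis. SUP z. \<bar>partial b \<phi> z\<bar>)
          = (\<Sum>bs\<in>(\<lambda>b. [b]) ` Basis. SUP z. \<bar>iterated_partial bs \<phi> z\<bar>)"
        by (subst sum.reindex) (auto simp: inj_on_def)
      also have "\<dots> \<le> S \<phi>"
        unfolding S_def using nn finI by (intro sum_mono2) auto
      finally show ?thesis .
    qed
    have bound: "\<bar>transport_integrand u \<phi> t x\<bar> \<le> U * S \<phi>" for t x
    \<comment> \<open>\<open>U\<close> controls the velocity on \<open>C\<close> only; off the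
      support the integrand is 0 whatever the velocity.\<close>
    proof (cases "(t, x) \<in> supp \<phi>")
      case True
      then have un: "norm (1::real, u t x) \<le> U" using U sub by auto
      have "\<bar>transport_integrand u \<phi> t x\<bar> \<le> (\<Sum>b\<in>Basis. \<bar>(1, u t x) \<bullet> b\<bar> * \<bar>partial b \<phi> (t, x)\<bar>)"
        unfolding transport_integrand_expansion[OF test_function_smooth[OF \<phi>]]
        by (rule order_trans[OF sum_abs]) (simp add: abs_mult)
      also have "\<dots> \<le> (\<Sum>b\<in>Basis. U * (SUP z. \<bar>partial b \<phi> z\<bar>))"
      proof (intro sum_mono mult_mono)
        fix b :: "real \<times> (real^2)" assume b: "b \<in> Basis"
        show "\<bar>(1, u t x) \<bullet> b\<bar> \<le> U" using Basis_le_norm[OF b, of "(1, u t x)"] un by linarith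
        show "\<bar>partial b \<phi> (t, x)\<bar> \<le> (SUP z. \<bar>partial b \<phi> z\<bar>)" using upper[of "[b]"] b by simp
      qed (use U in auto)
      also have "\<dots> \<le> U * S \<phi>"
        unfolding sum_distrib_left[symmetric] using sumS U by (intro mult_left_mono) auto
      finally show ?thesis .
    next
      case False
      then show ?thesis using transport_integrand_zero_outside[OF \<phi>] S0 U by simp
    qed
    have "\<bar>w_ad u q \<phi>\<bar> \<le> (\<integral>t. indicator {-T..T} t *\<^sub>R (K * (U * S \<phi>)) \<partial>lborel)"
      unfolding w_ad_def
    proof (rule order_trans[OF integral_abs_bound], rule integral_mono)
      show "integrable lborel (\<lambda>t. \<bar>signed_integral (q t) (transport_integrand u \<phi> t)\<bar>)"
        by (intro integrable_abs transport_integral_integrable \<phi>)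
      show "integrable lborel (\<lambda>t. indicator {-T..T} t *\<^sub>R (K * (U * S \<phi>)))"
        using T(1) by (intro integrable_real_indicator integrable_scaleR_left) (auto simp: emeasure_lborel_Icc)
      fix t
      show "\<bar>signed_integral (q t) (transport_integrand u \<phi> t)\<bar> \<le> indicator {-T..T} t *\<^sub>R (K * (U * S \<phi>))"
      proof (cases "t \<in> {-T..T}")
        case True
        then show ?thesis
          using K(2)[of t "transport_integrand u \<phi> t" "U * S \<phi>"] vanishing_transport_integrand[OF \<phi>] bound
          by auto
      next
        case False
        then have "(t, x) \<notin> supp \<phi>" for x
          using sub T(2)[of "(t, x)"] norm_Pair_ge(2)[of t x] by auto
        then have "transport_integrand u \<phi> t = (\<lambda>x. 0)"
          using transport_integrand_zero_outside[OF \<phi>] by auto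
        then show ?thesis using False by (simp add: signed_integral_def)
      qed
    qed
    also have "\<dots> = (2 * T * (K * U)) * S \<phi>"
      using T by (simp add: mult_ac)
    finally show ?thesis .
  qed
  then show ?thesis unfolding S_def by blast
qed

lemma distribution_w_ad: "distribution (w_ad u q)"
  unfolding distribution_def using w_ad_add w_ad_scale w_ad_bound by simp

end

section \<open>The vortex blob kernel\<close>

lemma FTC_atLeast_nonneg:
  fixes f :: "real \<Rightarrow> real"
  assumes f: "continuous_on UNIV f" "\<And>x. a \<le> x \<Longrightarrow> 0 \<le> f x"
    and F: "\<And>x. a \<le> x \<Longrightarrow> (F has_real_derivative f x) (at x)" and lim: "(F \<longlongrightarrow> T) at_top"
  shows "set_integrable lborel {a..} f" "(LINT x:{a..}|lborel. f x) = T - F a"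
proof -
  have "F a \<le> T"
  proof (rule tendsto_lowerbound[OF lim])
    show "\<forall>\<^sub>F x in at_top. F a \<le> F x"
      using eventually_ge_at_top[of a]
    proof eventually_elim
      case (elim x)
      show ?case
        by (rule DERIV_nonneg_imp_nondecreasing[OF elim]) (use F f in auto)
    qed
  qed simp
  moreover have mble: "f \<in> borel_measurable borel"
    using f by (intro borel_measurable_continuous_onI)
  then have "(\<integral>\<^sup>+x. ennreal (f x) * indicator {a..} x \<partial>lborel) = ennreal (T - F a)"
    by (rule nn_integral_FTC_atLeast) (use F f lim in auto)
  moreover have "(\<integral>\<^sup>+x. ennreal (f x) * indicator {a..} x \<partial>lborel) = (\<integral>\<^sup>+x. ennreal (indicator {a..} x *\<^sub>R f x) \<partial>lborel)"
    by (rule nn_integral_cong) (auto simp: indicator_def)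
  ultimately have "has_bochner_integral lborel (\<lambda>x. indicator {a..} x *\<^sub>R f x) (T - F a)"
    using mble f by (intro has_bochner_integral_nn_integral) (auto simp: indicator_def)
  then show "set_integrable lborel {a..} f" "(LINT x:{a..}|lborel. f x) = T - F a"
    unfolding set_integrable_def set_lebesgue_integral_def by (auto simp: has_bochner_integral_iff)
qed

lemma exp_minus_atLeast:
  "set_integrable lborel {a..} (\<lambda>s::real. exp (- s))" "(LINT s:{a..}|lborel. exp (- s)) = exp (- a)"
proof -
  have lim: "((\<lambda>s::real. - exp (- s)) \<longlongrightarrow> - 0) at_top"
    by (intro tendsto_minus filterlim_compose[OF exp_at_bot] filterlim_uminus_at_bot_at_top)
  have D: "((\<lambda>s::real. - exp (- s)) has_real_derivative exp (- x)) (at x)" for x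
    by (auto intro!: derivative_eq_intros)
  have cont: "continuous_on UNIV (\<lambda>s::real. exp (- s))" by (intro continuous_intros)
  show "set_integrable lborel {a..} (\<lambda>s::real. exp (- s))" "(LINT s:{a..}|lborel. exp (- s)) = exp (- a)"
    using FTC_atLeast_nonneg[OF cont _ D lim, of a] by simp_all
qed

lemma set_integrable_exp_bound:
  fixes f :: "real \<Rightarrow> 'a::euclidean_space"
  assumes f: "continuous_on UNIV f" and B: "\<And>s. s \<ge> 0 \<Longrightarrow> norm (f s) \<le> M * exp (- s)"
  shows "set_integrable lborel {0..} f"
proof (rule set_integrable_bound)
  show "set_integrable lborel {0..} (\<lambda>s::real. M * exp (- s))"
    using exp_minus_atLeast by auto
  show "set_borel_measurable lborel {0..} f"
    unfolding set_borel_measurable_def using borel_measurable_continuous_onI[OF f] by auto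
  show "AE s in lborel. s \<in> {0..} \<longrightarrow> norm (f s) \<le> norm (M * exp (- s))"
    using B by (auto intro: order_trans[OF _ abs_ge_self])
qed

text \<open>The function exp (- s) has integral 1 over the half line, so the constant of the
  pointwise bound passes to the integral unchanged.\<close>

lemma set_integral_exp_bound:
  fixes f :: "real \<Rightarrow> 'a::euclidean_space"
  assumes f: "continuous_on UNIV f" and B: "\<And>s. s \<ge> 0 \<Longrightarrow> norm (f s) \<le> M * exp (- s)"
  shows "norm (LINT s:{0..}|lborel. f s) \<le> M"
proof -
  have "norm (LINT s:{0..}|lborel. f s) \<le> (LINT s:{0..}|lborel. norm (f s))"
    by (rule set_integral_norm_bound[OF set_integrable_exp_bound[OF assms]])
  also have "\<dots> \<le> (LINT s:{0..}|lborel. M * exp (- s))"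
  proof (rule set_integral_mono)
    show "set_integrable lborel {0..} (\<lambda>s. norm (f s))"
      using B by (intro set_integrable_exp_bound continuous_on_norm f) auto
    show "set_integrable lborel {0..} (\<lambda>s::real. M * exp (- s))"
      using exp_minus_atLeast by auto
  qed (use B in auto)
  also have "\<dots> = M" using exp_minus_atLeast(2)[of 0] by simp
  finally show ?thesis .
qed

lemma cosh_mult_exp_minus_le: "s \<ge> 0 \<Longrightarrow> cosh s * exp (- s) \<le> 1" for s :: real
proof -
  assume "s \<ge> 0"
  then have "exp (- s) * exp (- s) \<le> 1" by (simp add: mult_le_one)
  then show ?thesis by (simp add: cosh_def exp_minus field_simps)
qed

lemma mult_exp_minus_le: "x * exp (- x) \<le> 1" for x :: real
proof -
  have "x \<le> exp x" using exp_ge_add_one_self[of x] by linarith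
  then show ?thesis by (simp add: exp_minus field_simps)
qed

lemma one_minus_exp_le: "1 - exp (- x) \<le> x" for x :: real
  using exp_ge_add_one_self[of "- x"] by linarith

text \<open>Since \<open>1 / r = \<integral> cosh s exp (- r sinh s) ds\<close> and \<open>K\<^sub>0' r = - \<integral> cosh s exp (- r cosh s) ds\<close>,
  the radial derivative of \<^const>\<open>G_kernel\<close> is an integral over \<open>s\<close> of the following functions, in
  which the singularities at 0 cancel.\<close>

definition blob_profile :: "real \<Rightarrow> real \<Rightarrow> real" where
  "blob_profile s p = cosh s * (exp (- p * sinh s) - exp (- p * cosh s))"

text \<open>From cosh s = sinh s + exp (- s). The last factor is at most p exp (- s), which is the
  cancellation of the two singular terms made visible.\<close>

lemma blob_profile_eq: "blob_profile s p = cosh s * (exp (- p * sinh s) * (1 - exp (- p * exp (- s))))"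
proof -
  have "exp (- p * cosh s) = exp (- p * sinh s) * exp (- p * exp (- s))"
    unfolding exp_add[symmetric] by (simp add: cosh_minus_sinh[symmetric] algebra_simps)
  then show ?thesis by (simp add: blob_profile_def algebra_simps)
qed

lemma blob_profile_nonneg: "p \<ge> 0 \<Longrightarrow> blob_profile s p \<ge> 0"
  unfolding blob_profile_eq by (intro mult_nonneg_nonneg) (auto intro: less_imp_le cosh_real_pos)

lemma blob_profile_le_exp:
  assumes "s \<ge> 0" "p \<ge> 0"
  shows "blob_profile s p \<le> p * exp (- p * sinh s)"
proof -
  have "blob_profile s p \<le> cosh s * (exp (- p * sinh s) * (p * exp (- s)))"
    unfolding blob_profile_eq using one_minus_exp_le[of "p * exp (- s)"]
    by (intro mult_left_mono) (auto intro: less_imp_le cosh_real_pos)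
  also have "\<dots> = (cosh s * exp (- s)) * (p * exp (- p * sinh s))" by simp
  also have "\<dots> \<le> 1 * (p * exp (- p * sinh s))"
    using assms cosh_mult_exp_minus_le by (intro mult_right_mono) auto
  finally show ?thesis by simp
qed

lemma blob_profile_le:
  assumes "s \<ge> 0" "p \<ge> 0"
  shows "blob_profile s p \<le> p"
proof -
  have "p * exp (- p * sinh s) \<le> p * 1"
    using assms by (intro mult_left_mono) auto
  then show ?thesis using blob_profile_le_exp[OF assms] by simp
qed

text \<open>Uniform in \<open>p\<close>: both sinh s and exp (- s) times the profile are at most 1,
  so cosh s times it is at most 2, and exp s \<le> 2 cosh s gives the constant 4.\<close>

lemma blob_profile_decay:
  assumes "s \<ge> 0" "p \<ge> 0"
  shows "blob_profile s p \<le> 4 * exp (- s)"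
proof -
  have "sinh s * blob_profile s p \<le> sinh s * (p * exp (- p * sinh s))"
    using assms blob_profile_le_exp by (intro mult_left_mono) auto
  also have "\<dots> \<le> 1" using mult_exp_minus_le[of "p * sinh s"] by (simp add: mult_ac)
  finally have 1: "sinh s * blob_profile s p \<le> 1" .
  have "blob_profile s p \<le> cosh s * (1 * 1)"
    unfolding blob_profile_eq using assms
    by (intro mult_left_mono mult_mono) (auto intro: less_imp_le cosh_real_pos)
  then have "exp (- s) * blob_profile s p \<le> exp (- s) * cosh s"
    by (intro mult_left_mono) auto
  also have "\<dots> \<le> 1" using cosh_mult_exp_minus_le[OF assms(1)] by (simp add: mult.commute)
  finally have 2: "exp (- s) * blob_profile s p \<le> 1" .
  have "exp s / 2 * blob_profile s p \<le> cosh s * blob_profile s p"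
    using assms by (intro mult_right_mono blob_profile_nonneg) (auto simp: cosh_def)
  also have "\<dots> = sinh s * blob_profile s p + exp (- s) * blob_profile s p"
    by (simp add: cosh_minus_sinh[symmetric] algebra_simps)
  finally have "exp s * blob_profile s p \<le> 4" using 1 2 by simp
  then show ?thesis by (simp add: exp_minus field_simps)
qed

text \<open>The derivative in \<open>p\<close> is the difference of cosh s exp (- s) exp (- p cosh
  s) and sinh s times the profile, both between 0 and 1. The bound is uniform in \<open>s\<close>
  but not integrable over \<open>s\<close>, which is why the integrated field is estimated only
  log-Lipschitz.\<close>

lemma blob_profile_Lipschitz:
  assumes s: "s \<ge> 0" and "p \<ge> 0" "p' \<ge> 0"
  shows "\<bar>blob_profile s p - blob_profile s p'\<bar> \<le> 2 * \<bar>p - p'\<bar>"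
proof -
  let ?D = "\<lambda>p. cosh s * (cosh s * exp (- p * cosh s) - sinh s * exp (- p * sinh s))"
  have "norm (blob_profile s p - blob_profile s p') \<le> 2 * norm (p - p')"
  proof (rule field_differentiable_bound[where S = "{0..}"])
    fix z :: real
    show "(blob_profile s has_field_derivative ?D z) (at z within {0..})"
      unfolding blob_profile_def by (auto intro!: derivative_eq_intros simp: algebra_simps)
    assume "z \<in> {0..}"
    then have z: "z \<ge> 0" by simp
    have "?D z = (cosh s * exp (- s)) * exp (- z * cosh s) - sinh s * blob_profile s z"
      by (simp add: blob_profile_def cosh_minus_sinh[symmetric] algebra_simps)
    moreover have "0 \<le> (cosh s * exp (- s)) * exp (- z * cosh s)"
      by (auto intro: less_imp_le cosh_real_pos)
    moreover have "(cosh s * exp (- s)) * exp (- z * cosh s) \<le> 1"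
      using z by (intro mult_le_one[OF cosh_mult_exp_minus_le[OF s]])
        (auto intro!: mult_nonneg_nonneg intro: less_imp_le cosh_real_pos)
    moreover have "0 \<le> sinh s * blob_profile s z" using s z by (intro mult_nonneg_nonneg blob_profile_nonneg) auto
    moreover have "sinh s * blob_profile s z \<le> 1"
    proof -
      have "sinh s * blob_profile s z \<le> sinh s * (z * exp (- z * sinh s))"
        using s z blob_profile_le_exp by (intro mult_left_mono) auto
      also have "\<dots> \<le> 1" using mult_exp_minus_le[of "z * sinh s"] by (simp add: mult_ac)
      finally show ?thesis .
    qed
    ultimately show "norm (?D z) \<le> 2" unfolding real_norm_def by linarith
  qed (use assms in auto)
  then show ?thesis by simp
qed

lemma continuous_blob_profile: "continuous_on UNIV (\<lambda>s. blob_profile s p)"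
  unfolding blob_profile_def by (intro continuous_intros)

text \<open>For p > 0 this is 1 / p - K_1(p), with K_1 the modified Bessel function of order one.
  The integral form also makes sense at p = 0, where it is 0.\<close>

definition blob_radial :: "real \<Rightarrow> real" where
  "blob_radial p = (LINT s:{0..}|lborel. blob_profile s p)"

section \<open>The Bessel integral, its derivative, and the radial derivative of the kernel\<close>

lemma cosh_exp_sinh_integral:
  fixes p :: real
  assumes p: "p > 0"
  shows "set_integrable lborel {0..} (\<lambda>s. cosh s * exp (- p * sinh s))"
    "(LINT s:{0..}|lborel. cosh s * exp (- p * sinh s)) = 1 / p"
proof -
  have cont: "continuous_on UNIV (\<lambda>s. cosh s * exp (- p * sinh s))"
    by (intro continuous_intros)
  have D: "((\<lambda>s. - exp (- p * sinh s) / p) has_real_derivative cosh x * exp (- p * sinh x)) (at x)" for x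
    using p by (auto intro!: derivative_eq_intros)
  have "filterlim (\<lambda>s. p * sinh s) at_top at_top"
    by (intro filterlim_tendsto_pos_mult_at_top[OF tendsto_const p] sinh_real_at_top)
  then have "filterlim (\<lambda>s. - (p * sinh s)) at_bot at_top"
    by (simp add: filterlim_uminus_at_bot)
  then have lim: "((\<lambda>s. - exp (- p * sinh s) / p) \<longlongrightarrow> - 0 / p) at_top"
    using p by (intro tendsto_divide tendsto_minus tendsto_const filterlim_compose[OF exp_at_bot]) auto
  show "set_integrable lborel {0..} (\<lambda>s. cosh s * exp (- p * sinh s))"
    "(LINT s:{0..}|lborel. cosh s * exp (- p * sinh s)) = 1 / p"
    using FTC_atLeast_nonneg[OF cont _ D lim, of 0] by (simp_all add: less_imp_le)
qed

text \<open>The inequality y \<le> exp y at y = r c / 3, cubed, bounds c^3 exp (- r c) by 27 / r^3;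
  one factor \<open>c\<close> is then traded for exp s / 2, which doubles the constant. Two powers
  of \<open>c\<close> are kept because the quadratic remainder in \<open>r\<close> produces
  them.\<close>

lemma cosh_powers_exp_bound:
  fixes c r :: real
  assumes "c = cosh s" "s \<ge> 0" "r > 0"
  shows "c\<^sup>2 * exp (- r * c) \<le> 54 / r ^ 3 * exp (- s)"
proof -
  have c: "c \<ge> 1" "exp s \<le> 2 * c"
    unfolding assms(1) by (rule cosh_real_ge_1) (simp add: cosh_def)
  have "r * c / 3 \<le> exp (r * c / 3)" using exp_ge_add_one_self[of "r * c / 3"] by linarith
  then have "(r * c / 3) ^ 3 \<le> exp (r * c / 3) ^ 3" using c assms by (intro power_mono) auto
  also have "exp (r * c / 3) ^ 3 = exp (r * c)" by (subst exp_of_nat_mult[symmetric]) simp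
  finally have "c\<^sup>2 * exp (- r * c) * c \<le> 27 / r ^ 3"
    using assms by (simp add: exp_minus field_simps power3_eq_cube power2_eq_square)
  then have "c\<^sup>2 * exp (- r * c) * exp s \<le> 54 / r ^ 3"
    using mult_left_mono[OF c(2), of "c\<^sup>2 * exp (- r * c)"] by simp
  from mult_right_mono[OF this, of "exp (- s)"] show ?thesis
    by (simp add: mult.assoc exp_add[symmetric])
qed

lemma exp_remainder_le: "\<bar>exp y - 1 - y\<bar> \<le> y\<^sup>2 * exp \<bar>y\<bar>" for y :: real
proof -
  have lower: "exp y - 1 - y \<ge> 0" using exp_ge_add_one_self[of y] by linarith
  have "(1 - y) * exp y \<le> exp (- y) * exp y"
    using exp_ge_add_one_self[of "- y"] by (intro mult_right_mono) auto
  then have key: "exp y - 1 \<le> y * exp y" by (simp add: exp_minus algebra_simps)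
  show ?thesis
  proof (cases "y \<ge> 0")
    case True
    then have "y * (exp y - 1) \<le> y * (y * exp y)" using key by (intro mult_left_mono)
    then show ?thesis using True lower key by (simp add: power2_eq_square algebra_simps)
  next
    case False
    then have "- y * (1 - exp y) \<le> - y * (- y)"
      using exp_ge_add_one_self[of y] by (intro mult_left_mono; linarith)
    moreover have "y\<^sup>2 * 1 \<le> y\<^sup>2 * exp \<bar>y\<bar>" by (intro mult_left_mono) auto
    ultimately show ?thesis using key lower by (simp add: power2_eq_square algebra_simps)
  qed
qed

text \<open>The integral is K_1, so this is K_0' = - K_1, obtained by integrating the quadratic
  remainder of the exponential.\<close>

lemma bessel_K0_DERIV:
  assumes r: "r > 0"
  shows "set_integrable lborel {0..} (\<lambda>s. cosh s * exp (- r * cosh s))"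
    "(bessel_K0 has_real_derivative - (LINT s:{0..}|lborel. cosh s * exp (- r * cosh s))) (at r)"
proof -
  have cosh1: "1 \<le> cosh s" "cosh s \<le> (cosh s)\<^sup>2" for s :: real
    using cosh_real_ge_1[of s] by (auto simp: power2_eq_square)
  have cont: "continuous_on UNIV (\<lambda>s. f (cosh s))" if "continuous_on UNIV f" for f :: "real \<Rightarrow> real"
    by (rule continuous_on_compose2[OF that]) (auto intro!: continuous_intros)
  have int: "set_integrable lborel {0..} (\<lambda>s. exp (- r * cosh s))"
       "set_integrable lborel {0..} (\<lambda>s. cosh s * exp (- r * cosh s))" if r: "r > 0" for r :: real
  proof -
    have b: "cosh s * exp (- r * cosh s) \<le> 54 / r ^ 3 * exp (- s)"
      "exp (- r * cosh s) \<le> 54 / r ^ 3 * exp (- s)" if "s \<ge> 0" for s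
    proof -
      have "cosh s * exp (- r * cosh s) \<le> (cosh s)\<^sup>2 * exp (- r * cosh s)"
        using cosh1 by (intro mult_right_mono) auto
      then show "cosh s * exp (- r * cosh s) \<le> 54 / r ^ 3 * exp (- s)"
        using cosh_powers_exp_bound[OF refl that r] by linarith
      moreover have "1 * exp (- r * cosh s) \<le> cosh s * exp (- r * cosh s)"
        using cosh1 by (intro mult_right_mono) auto
      ultimately show "exp (- r * cosh s) \<le> 54 / r ^ 3 * exp (- s)" by linarith
    qed
    have nn: "0 \<le> cosh s" for s :: real using cosh1[of s] by linarith
    show "set_integrable lborel {0..} (\<lambda>s. exp (- r * cosh s))"
      by (rule set_integrable_exp_bound[where M = "54 / r ^ 3"]) (use b in \<open>auto intro!: cont continuous_intros\<close>)
    show "set_integrable lborel {0..} (\<lambda>s. cosh s * exp (- r * cosh s))"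
      by (rule set_integrable_exp_bound[where M = "54 / r ^ 3"]) (use b nn in \<open>auto intro!: cont continuous_intros simp: abs_mult\<close>)
  qed
  show "set_integrable lborel {0..} (\<lambda>s. cosh s * exp (- r * cosh s))" by (rule int(2)[OF r])
  let ?K1 = "LINT s:{0..}|lborel. cosh s * exp (- r * cosh s)"
  have "(bessel_K0 has_derivative (\<lambda>v. - ?K1 * v)) (at r)"
  \<comment> \<open>For |v| < r / 2 the factor exp (|v| cosh s) in the remainder still leaves exp (-
    (r / 2) cosh s) for integrability.\<close>
  proof (rule has_derivative_of_quadratic_remainder[where d = "r / 2"])
    show "bounded_linear (\<lambda>v. - ?K1 * v)" by (rule bounded_linear_mult_right)
    fix v :: real assume v: "norm v < r / 2"
    let ?R = "\<lambda>s. exp (- (r + v) * cosh s) - exp (- r * cosh s) - (- v) * (cosh s * exp (- r * cosh s))"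
    have rv: "r + v > 0" using v by auto
    have "bessel_K0 (r + v) - bessel_K0 r - (- ?K1 * v) = (LINT s:{0..}|lborel. ?R s)"
      unfolding bessel_K0_def using int[OF r] int[OF rv]
      by (simp add: set_integral_diff set_integral_mult_right del: minus_add_distrib)
    also have "norm \<dots> \<le> v\<^sup>2 * (54 / (r / 2) ^ 3)"
    proof (rule set_integral_exp_bound)
      show "continuous_on UNIV ?R"
        by (rule cont[of "\<lambda>c. exp (- (r + v) * c) - exp (- r * c) - (- v) * (c * exp (- r * c))"])
          (intro continuous_intros)
      fix s :: real assume s: "s \<ge> 0"
      let ?c = "cosh s"
      have "exp (- (r + v) * ?c) = exp (- r * ?c) * exp (- v * ?c)"
        unfolding exp_add[symmetric] by (simp add: algebra_simps)
      then have "?R s = exp (- r * ?c) * (exp (- v * ?c) - 1 - (- v * ?c))"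
        by (simp add: algebra_simps)
      then have "norm (?R s) = exp (- r * ?c) * \<bar>exp (- v * ?c) - 1 - (- v * ?c)\<bar>"
        by (simp only: real_norm_def abs_mult abs_exp_cancel)
      also have "\<dots> \<le> exp (- r * ?c) * ((- v * ?c)\<^sup>2 * exp \<bar>- v * ?c\<bar>)"
        by (intro mult_left_mono exp_remainder_le) simp
      also have "\<dots> = v\<^sup>2 * (?c\<^sup>2 * exp (- (r - \<bar>v\<bar>) * ?c))"
        using cosh1(1)[of s] by (simp add: abs_mult power_mult_distrib exp_add[symmetric] algebra_simps)
      also have "\<dots> \<le> v\<^sup>2 * (?c\<^sup>2 * exp (- (r / 2) * ?c))"
      proof -
        have "(r / 2) * ?c \<le> (r - \<bar>v\<bar>) * ?c" using v cosh1(1)[of s] by (intro mult_right_mono) auto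
        then have "- (r - \<bar>v\<bar>) * ?c \<le> - (r / 2) * ?c" by (simp only: mult_minus_left neg_le_iff_le)
        then show ?thesis by (intro mult_left_mono exp_le_cancel_iff[THEN iffD2]) auto
      qed
      also have "\<dots> \<le> v\<^sup>2 * (54 / (r / 2) ^ 3 * exp (- s))"
        using cosh_powers_exp_bound[OF refl s, of "r / 2"] r by (intro mult_left_mono) auto
      finally show "norm (?R s) \<le> v\<^sup>2 * (54 / (r / 2) ^ 3) * exp (- s)" by (simp add: mult_ac)
    qed
    finally show "\<bar>bessel_K0 (r + v) - bessel_K0 r - - ?K1 * v\<bar> \<le> 54 / (r / 2) ^ 3 * (norm v)\<^sup>2"
      by (simp add: mult_ac)
  qed (use r in simp)
  then show "(bessel_K0 has_real_derivative - ?K1) (at r)"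
    unfolding has_field_derivative_def .
qed

lemma blob_radial_eq:
  assumes p: "p > 0"
  shows "blob_radial p = 1 / p - (LINT s:{0..}|lborel. cosh s * exp (- p * cosh s))"
  unfolding blob_radial_def blob_profile_def right_diff_distrib
  using cosh_exp_sinh_integral[OF p] bessel_K0_DERIV(1)[OF p] by (subst set_integral_diff) auto

lemma G_kernel_DERIV:
  assumes "\<alpha> > 0" "r > 0"
  shows "(G_kernel \<alpha> has_real_derivative blob_radial (r / \<alpha>) / (2 * pi * \<alpha>)) (at r)"
proof -
  have ra: "r / \<alpha> > 0" using assms by simp
  have "((\<lambda>r. bessel_K0 (r / \<alpha>) / (2 * pi) + ln r / (2 * pi)) has_real_derivative
      - (LINT s:{0..}|lborel. cosh s * exp (- (r / \<alpha>) * cosh s)) * (1 / \<alpha>) / (2 * pi) + (1 / r) / (2 * pi)) (at r)"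
    using assms
    by (intro DERIV_add DERIV_cdivide DERIV_chain2[where f = bessel_K0 and g = "\<lambda>r. r / \<alpha>", OF bessel_K0_DERIV(2)[OF ra]] DERIV_ln_divide)
      (auto intro!: derivative_eq_intros)
  then show ?thesis
    unfolding G_kernel_def[abs_def] blob_radial_eq[OF ra]
    by (rule DERIV_cong) (use assms in \<open>simp add: field_simps\<close>)
qed

section \<open>The radial vector field and its logarithmic modulus of continuity\<close>

definition blob_integrand :: "real \<Rightarrow> real^2 \<Rightarrow> real^2" where
  "blob_integrand s w = (blob_profile s (norm w) / norm w) *\<^sub>R w"

text \<open>At the origin the value is 0, matching the value of \<open>K_kernel\<close> on the
  diagonal.\<close>

definition blob_field :: "real^2 \<Rightarrow> real^2" where
  "blob_field w = (blob_radial (norm w) / norm w) *\<^sub>R w"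

lemma norm_blob_integrand: "norm (blob_integrand s w) = (if w = 0 then 0 else \<bar>blob_profile s (norm w)\<bar>)"
  by (simp add: blob_integrand_def)

lemma blob_integrand_decay: "s \<ge> 0 \<Longrightarrow> norm (blob_integrand s w) \<le> 4 * exp (- s)"
  using blob_profile_decay[of s "norm w"] blob_profile_nonneg[of "norm w" s]
  by (simp add: norm_blob_integrand)

text \<open>Directions and radii are compared separately. With \<open>w\<close> the shorter vector,
  \<open>w = 0\<close> is the only degenerate case, and there the linear bound on the profile
  suffices.\<close>

lemma blob_integrand_Lipschitz:
  assumes s: "s \<ge> 0"
  shows "norm (blob_integrand s w - blob_integrand s w') \<le> 4 * norm (w - w')"
proof -
  have main: "norm (blob_integrand s w - blob_integrand s w') \<le> 4 * norm (w - w')"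
    if le: "norm w \<le> norm w'" for w w'
  proof (cases "w = 0")
    case True
    then show ?thesis
      using blob_profile_le[OF s, of "norm w'"] blob_profile_nonneg[of "norm w'" s]
      by (auto simp: norm_blob_integrand blob_integrand_def)
  next
    case False
    define \<rho> \<rho>' h h' where defs: "\<rho> = norm w" "\<rho>' = norm w'"
      "h = blob_profile s (norm w)" "h' = blob_profile s (norm w')"
    have pos: "\<rho> > 0" "\<rho>' > 0" using False le by (auto simp: defs)
    have h: "0 \<le> h" "h \<le> \<rho>" "\<bar>h - h'\<bar> \<le> 2 * \<bar>\<rho> - \<rho>'\<bar>"
      unfolding defs using s by (auto intro: blob_profile_nonneg blob_profile_le blob_profile_Lipschitz)
    have rd: "\<bar>\<rho> - \<rho>'\<bar> \<le> norm (w - w')" unfolding defs by (rule norm_triangle_ineq3)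
    have int: "blob_integrand s w = (h / \<rho>) *\<^sub>R w" "blob_integrand s w' = (h' / \<rho>') *\<^sub>R w'"
      by (simp_all only: blob_integrand_def defs)
    \<comment> \<open>The first term compares directions and, as h \<le> \<rho>, costs at most |w -
      w'| + |\<rho> - \<rho>'|. The second compares profiles and costs at most 2 |\<rho> - \<rho>'|.
      Together this is 4 |w - w'|.\<close>
    have "blob_integrand s w - blob_integrand s w'
        = (h / \<rho>) *\<^sub>R (w - (\<rho> / \<rho>') *\<^sub>R w') + ((h - h') / \<rho>') *\<^sub>R w'"
      unfolding int using pos by (simp add: algebra_simps diff_divide_distrib)
    also have "norm \<dots> \<le> norm ((h / \<rho>) *\<^sub>R (w - (\<rho> / \<rho>') *\<^sub>R w')) + norm (((h - h') / \<rho>') *\<^sub>R w')"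
      by (rule norm_triangle_ineq)
    also have "norm (((h - h') / \<rho>') *\<^sub>R w') = \<bar>h - h'\<bar>"
      using pos by (simp add: defs(2))
    also have "norm ((h / \<rho>) *\<^sub>R (w - (\<rho> / \<rho>') *\<^sub>R w')) \<le> 1 * norm (w - (\<rho> / \<rho>') *\<^sub>R w')"
      unfolding norm_scaleR using h pos by (intro mult_right_mono) auto
    also have "norm (w - (\<rho> / \<rho>') *\<^sub>R w') = norm ((w - w') + ((\<rho>' - \<rho>) / \<rho>') *\<^sub>R w')"
      using pos by (simp add: algebra_simps diff_divide_distrib)
    also have "\<dots> \<le> norm (w - w') + norm (((\<rho>' - \<rho>) / \<rho>') *\<^sub>R w')"
      by (rule norm_triangle_ineq)
    also have "norm (((\<rho>' - \<rho>) / \<rho>') *\<^sub>R w') = \<bar>\<rho>' - \<rho>\<bar>"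
      using pos by (simp add: defs(2))
    finally show ?thesis using h rd by (simp add: abs_minus_commute)
  qed
  show ?thesis
    using main[of w w'] main[of w' w] by (cases "norm w \<le> norm w'") (auto simp: norm_minus_commute)
qed

lemma continuous_blob_integrand: "continuous_on UNIV (\<lambda>s. blob_integrand s w)"
  unfolding blob_integrand_def divide_inverse
  by (intro continuous_on_scaleR continuous_on_mult continuous_blob_profile continuous_on_const)

lemma blob_field_eq_integral: "blob_field w = (LINT s:{0..}|lborel. blob_integrand s w)"
proof -
  have "set_integrable lborel {0..} (\<lambda>s. blob_profile s (norm w))"
    using blob_profile_decay[of _ "norm w"] blob_profile_nonneg[of "norm w"]
    by (intro set_integrable_exp_bound[OF continuous_blob_profile, of _ 4]) simp
  then have "(\<integral>s. (indicator {0..} s *\<^sub>R blob_profile s (norm w)) *\<^sub>R ((1 / norm w) *\<^sub>R w) \<partial>lborel)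
      = blob_radial (norm w) *\<^sub>R ((1 / norm w) *\<^sub>R w)"
    unfolding blob_radial_def set_lebesgue_integral_def set_integrable_def
    by (rule integral_scaleR_left)
  then show ?thesis
    by (simp add: blob_field_def blob_integrand_def set_lebesgue_integral_def)
qed

lemma norm_blob_field_le: "norm (blob_field w) \<le> 4"
  unfolding blob_field_eq_integral
  by (rule set_integral_exp_bound[OF continuous_blob_integrand blob_integrand_decay])

text \<open>The Lipschitz bound is used for s \<le> S and the decay of both terms beyond. The cut
  \<open>S\<close> remains free; choosing it logarithmic in the distance balances the two
  contributions.\<close>

lemma blob_field_log_Lipschitz:
  assumes S: "S \<ge> 0"
  shows "norm (blob_field w - blob_field w') \<le> 4 * norm (w - w') * S + 8 * exp (- S)"
proof -
  let ?f = "\<lambda>s. norm (blob_integrand s w - blob_integrand s w')"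
  have int: "set_integrable lborel {0..} (\<lambda>s. blob_integrand s w)" for w
    by (rule set_integrable_exp_bound[OF continuous_blob_integrand blob_integrand_decay])
  have "norm (blob_field w - blob_field w') = norm (LINT s:{0..}|lborel. blob_integrand s w - blob_integrand s w')"
    unfolding blob_field_eq_integral using int by simp
  also have "\<dots> \<le> (LINT s:{0..}|lborel. ?f s)"
    using int by (intro set_integral_norm_bound) auto
  also have "\<dots> \<le> (\<integral>s. indicator {0..S} s *\<^sub>R (4 * norm (w - w')) + 8 * (indicator {S..} s *\<^sub>R exp (- s)) \<partial>lborel)"
    unfolding set_lebesgue_integral_def
  proof (rule integral_mono)
    show "integrable lborel (\<lambda>s. indicator {0..} s *\<^sub>R ?f s)"
      using int set_integrable_norm[OF set_integral_diff(1)[OF int int]] by (auto simp: set_integrable_def)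
    show "integrable lborel (\<lambda>s. indicator {0..S} s *\<^sub>R (4 * norm (w - w')) + 8 * (indicator {S..} s *\<^sub>R exp (- s)))"
      using S exp_minus_atLeast(1)[of S]
      by (intro Bochner_Integration.integrable_add integrable_scaleR_left integrable_real_indicator integrable_mult_right)
        (auto simp: set_integrable_def emeasure_lborel_Icc)
    fix s :: real
    have "?f s \<le> 8 * exp (- s)" if "s \<ge> 0"
      using norm_triangle_ineq4[of "blob_integrand s w" "blob_integrand s w'"] blob_integrand_decay[OF that, of w]
        blob_integrand_decay[OF that, of w'] by linarith
    then show "indicator {0..} s *\<^sub>R ?f s
        \<le> indicator {0..S} s *\<^sub>R (4 * norm (w - w')) + 8 * (indicator {S..} s *\<^sub>R exp (- s))"
      using blob_integrand_Lipschitz[of s w w'] S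
      by (auto simp: indicator_def intro: add_increasing2)
  qed
  also have "\<dots> = 4 * norm (w - w') * S + 8 * exp (- S)"
    using S exp_minus_atLeast[of S]
    by (subst Bochner_Integration.integral_add)
      (auto simp: set_integrable_def set_lebesgue_integral_def emeasure_lborel_Icc)
  finally show ?thesis .
qed

text \<open>As K_1 is nonnegative, 1 / p - K_1(p) is at most 1 / p. This is what places the kernel
  in C_0, so that it can be paired with a weakly continuous curve.\<close>

lemma norm_blob_field_decay:
  assumes "w \<noteq> 0"
  shows "norm (blob_field w) \<le> 1 / norm w"
proof -
  have p: "norm w > 0" using assms by simp
  have "0 \<le> (LINT s:{0..}|lborel. cosh s * exp (- norm w * cosh s))"
    unfolding set_lebesgue_integral_def
    by (intro integral_nonneg_AE always_eventually) (auto simp: indicator_def intro: less_imp_le cosh_real_pos)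
  moreover have "0 \<le> blob_radial (norm w)"
    unfolding blob_radial_def set_lebesgue_integral_def
    by (intro integral_nonneg_AE always_eventually) (auto simp: indicator_def intro: blob_profile_nonneg)
  ultimately show ?thesis
    using blob_radial_eq[OF p] p by (simp add: blob_field_def)
qed

section \<open>From the radial field to the blob kernel\<close>

lemma perp_components: "perp v $ 1 = - v $ 2" "perp v $ 2 = v $ 1"
  by (simp_all add: perp_def)

lemma perp_diff: "perp (v - w) = perp v - perp w"
  by (simp add: vec_eq_iff forall_2 perp_components)

lemma perp_scaleR: "perp (c *\<^sub>R v) = c *\<^sub>R perp v"
  by (simp add: vec_eq_iff forall_2 perp_components)

lemma norm_perp: "norm (perp v) = norm v"
  by (simp add: norm_vec_def L2_set_def UNIV_2 perp_components)

lemma grad_radial: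
  assumes g: "(g has_real_derivative g') (at (norm (x - y)))" and "x \<noteq> y"
  shows "grad (\<lambda>z. g (norm (z - y))) x = (g' / norm (x - y)) *\<^sub>R (x - y)"
proof -
  have "((\<lambda>z. z - y) has_derivative (\<lambda>h. h)) (at x)"
    by (auto intro!: derivative_eq_intros)
  then have "((\<lambda>z. norm (z - y)) has_derivative (\<lambda>h. h \<bullet> sgn (x - y))) (at x)"
    by (rule has_derivative_compose) (use assms(2) in \<open>auto intro!: has_derivative_norm\<close>)
  then have "((\<lambda>z. norm (z - y)) has_derivative (\<lambda>h. ((x - y) \<bullet> h) / norm (x - y))) (at x)"
    by (simp add: sgn_div_norm divide_inverse_commute inner_commute)
  then have "((\<lambda>z. g (norm (z - y))) has_derivative (\<lambda>h. g' * (((x - y) \<bullet> h) / norm (x - y)))) (at x)"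
    by (rule has_derivative_compose) (use g in \<open>simp add: has_field_derivative_def\<close>)
  then show ?thesis
    by (simp add: grad_def frechet_derivative_at[symmetric] vec_eq_iff inner_axis)
qed

lemma K_kernel_eq:
  assumes a: "\<alpha> > 0"
  shows "K_kernel \<alpha> x y = (1 / (2 * pi * \<alpha>)) *\<^sub>R perp (blob_field ((x - y) /\<^sub>R \<alpha>))"
proof (cases "x = y")
  case False
  then have n: "norm (x - y) > 0" by simp
  have "K_kernel \<alpha> x y = perp ((blob_radial (norm (x - y) / \<alpha>) / (2 * pi * \<alpha>) / norm (x - y)) *\<^sub>R (x - y))"
    unfolding K_kernel_def using False by (simp add: grad_radial[OF G_kernel_DERIV[OF a n]])
  moreover have "blob_field ((x - y) /\<^sub>R \<alpha>) = (blob_radial (norm (x - y) / \<alpha>) / norm (x - y)) *\<^sub>R (x - y)"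
    using a n by (simp add: blob_field_def divide_inverse_commute)
  ultimately show ?thesis by (simp add: perp_scaleR)
qed (simp add: K_kernel_def blob_field_def perp_def vec_eq_iff forall_2)

lemma K_kernel_bounded:
  assumes "\<alpha> > 0"
  shows "norm (K_kernel \<alpha> x y) \<le> 4 / (2 * pi * \<alpha>)"
proof -
  have "1 / (2 * pi * \<alpha>) * norm (blob_field ((x - y) /\<^sub>R \<alpha>)) \<le> 1 / (2 * pi * \<alpha>) * 4"
    using assms by (intro mult_left_mono norm_blob_field_le) simp
  then show ?thesis using assms by (simp add: K_kernel_eq norm_perp)
qed

lemma K_kernel_diff:
  assumes a: "\<alpha> > 0" and S: "S \<ge> 0"
  shows "norm (K_kernel \<alpha> x y - K_kernel \<alpha> x' y')
    \<le> (1 / (2 * pi * \<alpha>)) * (4 / \<alpha> * norm ((x - y) - (x' - y')) * S + 8 * exp (- S))"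
proof -
  have "norm (blob_field ((x - y) /\<^sub>R \<alpha>) - blob_field ((x' - y') /\<^sub>R \<alpha>))
      \<le> 4 * norm ((x - y) /\<^sub>R \<alpha> - (x' - y') /\<^sub>R \<alpha>) * S + 8 * exp (- S)"
    by (rule blob_field_log_Lipschitz[OF S])
  also have "(x - y) /\<^sub>R \<alpha> - (x' - y') /\<^sub>R \<alpha> = ((x - y) - (x' - y')) /\<^sub>R \<alpha>"
    by (simp add: scaleR_diff_right)
  finally have "norm (blob_field ((x - y) /\<^sub>R \<alpha>) - blob_field ((x' - y') /\<^sub>R \<alpha>))
      \<le> 4 / \<alpha> * norm ((x - y) - (x' - y')) * S + 8 * exp (- S)"
    using a by (simp add: divide_inverse mult_ac)
  moreover have "norm (K_kernel \<alpha> x y - K_kernel \<alpha> x' y')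
      = (1 / (2 * pi * \<alpha>)) * norm (blob_field ((x - y) /\<^sub>R \<alpha>) - blob_field ((x' - y') /\<^sub>R \<alpha>))"
    using a by (simp add: K_kernel_eq scaleR_diff_right[symmetric] perp_diff[symmetric] norm_perp)
  ultimately show ?thesis
    using a by (metis mult_left_mono less_imp_le zero_less_divide_1_iff mult_pos_pos pi_gt_zero zero_less_numeral)
qed

lemma K_kernel_log_Lipschitz:
  assumes a: "\<alpha> > 0"
  obtains C where "C \<ge> 0"
    "\<And>x x' y. x \<noteq> x' \<Longrightarrow> norm (K_kernel \<alpha> x y - K_kernel \<alpha> x' y)
      \<le> C * (norm (x - x') * (1 + ln (1 + 1 / (norm (x - x'))\<^sup>2)))"
proof (rule that)
  let ?c = "1 / (2 * pi * \<alpha>)"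
  show "?c * (4 / \<alpha> + 8) \<ge> 0" using a by simp
  fix x x' y :: "real^2" assume "x \<noteq> x'"
  define d where "d = norm (x - x')"
  have d: "d > 0" using \<open>x \<noteq> x'\<close> by (simp add: d_def)
  \<comment> \<open>This cut is nonnegative and satisfies exp (- S) \<le> d for every d > 0, so near
    and far points need no separate treatment. The square makes the modulus a smooth function of the
    inner product, as Osgood's argument wants it.\<close>
  define S where "S = ln (1 + 1 / d\<^sup>2)"
  have S: "S \<ge> 0" unfolding S_def using d by (intro ln_ge_zero) auto
  have "exp (- S) = d\<^sup>2 / (1 + d\<^sup>2)"
    unfolding S_def exp_minus using d by (subst exp_ln) (auto simp: add_pos_nonneg field_simps)
  also have "\<dots> \<le> d"
  proof -
    have "0 \<le> (d - 1)\<^sup>2" by simp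
    then have "d \<le> 1 + d\<^sup>2" using d by (simp add: power2_eq_square algebra_simps)
    then have "d * d \<le> d * (1 + d\<^sup>2)" using d by (intro mult_left_mono) auto
    then show ?thesis by (simp add: power2_eq_square divide_le_eq add_pos_nonneg)
  qed
  finally have eS: "exp (- S) \<le> d" .
  have "norm (K_kernel \<alpha> x y - K_kernel \<alpha> x' y) \<le> ?c * (4 / \<alpha> * d * S + 8 * exp (- S))"
    using K_kernel_diff[OF a S, of x y x' y] by (simp add: d_def)
  also have "\<dots> \<le> ?c * ((4 / \<alpha> + 8) * (d * (1 + S)))"
  proof (intro mult_left_mono)
    have *: "k * d * S + 8 * exp (- S) \<le> (k + 8) * (d * (1 + S))" if "k \<ge> 0" for k
    proof -
      have "0 \<le> k * d" "0 \<le> d * S" using that d S by auto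
      moreover have "(k + 8) * (d * (1 + S)) = k * d * S + 8 * d + (k * d + 8 * (d * S))"
        by (simp add: algebra_simps)
      ultimately show ?thesis using eS by linarith
    qed
    show "4 / \<alpha> * d * S + 8 * exp (- S) \<le> (4 / \<alpha> + 8) * (d * (1 + S))"
      by (rule *) (use a in simp)
  qed (use a in simp)
  finally show "norm (K_kernel \<alpha> x y - K_kernel \<alpha> x' y)
      \<le> ?c * (4 / \<alpha> + 8) * (norm (x - x') * (1 + ln (1 + 1 / (norm (x - x'))\<^sup>2)))"
    by (simp add: S_def d_def)
qed

lemma vanishing_K_kernel:
  assumes a: "\<alpha> > 0"
  shows "vanishing (\<lambda>y. K_kernel \<alpha> x y \<bullet> c)"
  unfolding vanishing_def
proof
  let ?k = "1 / (2 * pi * \<alpha>)"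
  have "continuous_on UNIV (\<lambda>y. K_kernel \<alpha> x y)"
    unfolding continuous_on_iff
  proof (intro ballI allI impI)
    fix y and e :: real assume e: "e > 0"
    let ?e = "e / ?k"
    have e': "?e > 0" using e a by simp
    have "((\<lambda>S::real. 8 * exp (- S)) \<longlongrightarrow> 8 * 0) at_top"
      by (intro tendsto_mult tendsto_const filterlim_compose[OF exp_at_bot] filterlim_uminus_at_bot_at_top)
    then have "\<forall>\<^sub>F S in at_top. 8 * exp (- S) < ?e / 2"
      using half_gt_zero[OF e'] by (intro order_tendstoD(2)) (simp_all only: mult_zero_right)
    then obtain S where S: "S \<ge> 0" "8 * exp (- S) < ?e / 2"
      using eventually_conj[OF eventually_ge_at_top[of 0]] eventually_happens
      by (metis (no_types, lifting) trivial_limit_at_top_linorder)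
    \<comment> \<open>\<open>S\<close> is fixed beforehand so that the tail is small; the distance
      comes second because it has to compensate the factor \<open>S\<close>. The summand 1 keeps the
      denominator positive when \<open>S = 0\<close>.\<close>
    define d where "d = ?e / 2 / (4 / \<alpha> * S + 1)"
    have pos: "4 / \<alpha> * S + 1 > 0" using a S by (intro add_nonneg_pos) auto
    have "dist (K_kernel \<alpha> x y') (K_kernel \<alpha> x y) < e" if "dist y' y < d" for y'
    proof -
      have n: "norm ((x - y') - (x - y)) = dist y' y" by (simp add: dist_norm norm_minus_commute)
      have "dist y' y * (4 / \<alpha> * S + 1) < ?e / 2"
        using that pos by (simp add: d_def pos_less_divide_eq)
      moreover have "dist y' y * (4 / \<alpha> * S + 1) = 4 / \<alpha> * dist y' y * S + dist y' y"
        by (simp add: algebra_simps)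
      ultimately have "4 / \<alpha> * dist y' y * S \<le> ?e / 2"
        using zero_le_dist[of y' y] by linarith
      then have "4 / \<alpha> * dist y' y * S + 8 * exp (- S) < ?e"
        using S by linarith
      then have "?k * (4 / \<alpha> * dist y' y * S + 8 * exp (- S)) < ?k * ?e"
        using a by (intro mult_strict_left_mono) auto
      also have "?k * ?e = e" using a by simp
      finally show ?thesis
        using K_kernel_diff[OF a S(1), of x y' x y] unfolding n dist_norm by linarith
    qed
    moreover have "d > 0" unfolding d_def by (intro divide_pos_pos half_gt_zero e' pos)
    ultimately show "\<exists>d>0. \<forall>y'\<in>UNIV. dist y' y < d \<longrightarrow> dist (K_kernel \<alpha> x y') (K_kernel \<alpha> x y) < e"
      by blast
  qed
  then show "continuous_on UNIV (\<lambda>y. K_kernel \<alpha> x y \<bullet> c)" by (intro continuous_on_inner continuous_on_const)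
  show "((\<lambda>y. K_kernel \<alpha> x y \<bullet> c) \<longlongrightarrow> 0) at_infinity"
  proof (rule Lim_null_comparison)
    have "norm (K_kernel \<alpha> x y \<bullet> c) \<le> ?k * \<alpha> / norm (y - x) * norm c" if "y \<noteq> x" for y
    proof -
      have "(x - y) /\<^sub>R \<alpha> \<noteq> 0" using that a by simp
      from norm_blob_field_decay[OF this] have "norm (blob_field ((x - y) /\<^sub>R \<alpha>)) \<le> \<alpha> / norm (y - x)"
        using a by (simp add: divide_inverse norm_minus_commute mult_ac)
      then have "norm (K_kernel \<alpha> x y) \<le> ?k * (\<alpha> / norm (y - x))"
        using a unfolding K_kernel_eq[OF a] norm_scaleR norm_perp by (intro mult_mono) auto
      then have "norm (K_kernel \<alpha> x y) * norm c \<le> ?k * (\<alpha> / norm (y - x)) * norm c"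
        by (intro mult_right_mono) auto
      then show ?thesis using Cauchy_Schwarz_ineq2[of "K_kernel \<alpha> x y" c] by simp
    qed
    moreover have "\<forall>\<^sub>F y in at_infinity. y \<noteq> x"
      unfolding eventually_at_infinity by (intro exI[of _ "norm x + 1"]) auto
    ultimately show "\<forall>\<^sub>F y in at_infinity. norm (K_kernel \<alpha> x y \<bullet> c) \<le> ?k * \<alpha> / norm (y - x) * norm c"
      by (auto elim: eventually_mono)
    have "filterlim (\<lambda>y::real^2. - x + y) at_infinity at_infinity"
      by (intro tendsto_add_filterlim_at_infinity[OF tendsto_const] filterlim_ident)
    then have "filterlim (\<lambda>y::real^2. norm (y - x)) at_top at_infinity"
      by (intro filterlim_compose[OF filterlim_norm_at_top]) simp
    then have "((\<lambda>y. ?k * \<alpha> / norm (y - x) * norm c) \<longlongrightarrow> 0 * norm c) at_infinity"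
      by (intro tendsto_mult tendsto_const tendsto_divide_0[OF tendsto_const] filterlim_at_top_imp_at_infinity)
    then show "((\<lambda>y. ?k * \<alpha> / norm (y - x) * norm c) \<longlongrightarrow> 0) at_infinity" by simp
  qed
qed

lemma powr_log_modulus_tendsto:
  fixes \<kappa> :: real
  assumes "\<kappa> > 0"
  shows "((\<lambda>d. d powr \<kappa> * (1 + ln (1 + 1 / d\<^sup>2))) \<longlongrightarrow> 0) (at_right 0)"
    "((\<lambda>d. d powr \<kappa>) \<longlongrightarrow> 0) (at_right 0)"
  using assms by real_asymp+

section \<open>Log-Lipschitz velocities and their flows\<close>

lemma has_vector_derivative_of_difference_quotient:
  fixes f :: "real \<Rightarrow> 'a::euclidean_space"
  assumes "((\<lambda>h. (f (t + h) - f t) /\<^sub>R h) \<longlongrightarrow> D) (at 0)"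
  shows "(f has_vector_derivative D) (at t)"
  unfolding has_vector_derivative_def
proof (subst has_derivative_componentwise_within, intro ballI)
  fix b :: 'a assume "b \<in> Basis"
  have "((\<lambda>h. ((f (t + h) - f t) /\<^sub>R h) \<bullet> b) \<longlongrightarrow> D \<bullet> b) (at 0)"
    by (intro tendsto_inner assms tendsto_const)
  then have "((\<lambda>s. f s \<bullet> b) has_real_derivative D \<bullet> b) (at t)"
    by (simp add: DERIV_def inner_diff_left divide_inverse_commute)
  moreover have "(*) (D \<bullet> b) = (\<lambda>h. (h *\<^sub>R D) \<bullet> b)"
    by (simp add: fun_eq_iff)
  ultimately show "((\<lambda>s. f s \<bullet> b) has_derivative (\<lambda>h. (h *\<^sub>R D) \<bullet> b)) (at t)"
    by (simp only: has_field_derivative_def)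
qed

text \<open>Osgood's argument: for a logarithmic modulus of continuity, the iterated logarithm of the
  distance of two trajectories is Lipschitz in time.\<close>

lemma Osgood_separation:
  fixes w :: "real \<Rightarrow> 'a::real_inner"
  assumes w: "\<And>s. \<bar>s\<bar> \<le> T \<Longrightarrow> (w has_vector_derivative w' s) (at s)"
    and nz: "\<And>s. \<bar>s\<bar> \<le> T \<Longrightarrow> w s \<noteq> 0"
    and bound: "\<And>s. \<bar>s\<bar> \<le> T \<Longrightarrow> norm (w' s) \<le> C * (norm (w s) * (1 + ln (1 + 1 / (norm (w s))\<^sup>2)))"
    and t: "\<bar>t\<bar> \<le> T"
  shows "exp (- (2 * C * T)) * (1 + ln (1 + 1 / (norm (w t))\<^sup>2)) \<le> 1 + ln (1 + 1 / (norm (w 0))\<^sup>2)"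
proof -
  \<comment> \<open>The squared distance is differentiable without reference to the norm;
    \<open>M\<close> is the logarithmic factor of the velocity bound and \<open>N'\<close> the
    derivative of its logarithm.\<close>
  define E where "E s = w s \<bullet> w s" for s
  define M where "M s = 1 + ln (1 + 1 / E s)" for s
  define N' where "N' s = - (2 * (w s \<bullet> w' s)) / (E s * (E s + 1)) / M s" for s
  have E: "E s > 0" if "\<bar>s\<bar> \<le> T" for s using nz[OF that] by (simp add: E_def)
  have M: "M s \<ge> 1" if "\<bar>s\<bar> \<le> T" for s
    unfolding M_def using E[OF that] by (simp add: ln_ge_zero)
  have "norm (ln (M t) - ln (M 0)) \<le> 2 * C * norm (t - 0)"
  proof (rule field_differentiable_bound[of "{- T..T}" "\<lambda>s. ln (M s)" N'])
    fix s assume "s \<in> {- T..T}"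
    then have s: "\<bar>s\<bar> \<le> T" by auto
    have D: "(w has_derivative (\<lambda>h. h *\<^sub>R w' s)) (at s)"
      using w[OF s] by (simp add: has_vector_derivative_def)
    have "(E has_derivative (\<lambda>h. w s \<bullet> (h *\<^sub>R w' s) + (h *\<^sub>R w' s) \<bullet> w s)) (at s)"
      unfolding E_def by (rule has_derivative_inner[OF D D])
    then have ED: "(E has_real_derivative 2 * (w s \<bullet> w' s)) (at s)"
      by (rule has_derivative_imp_has_field_derivative) (simp add: inner_commute algebra_simps)
    have "((\<lambda>s. 1 / E s) has_real_derivative - (2 * (w s \<bullet> w' s)) / (E s * E s)) (at s)"
      by (rule DERIV_cong[OF DERIV_divide[OF DERIV_const ED]]) (use E[OF s] in auto)
    then have "((\<lambda>s. 1 + 1 / E s) has_real_derivative - (2 * (w s \<bullet> w' s)) / (E s * E s)) (at s)"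
      by (rule DERIV_cong[OF DERIV_add[OF DERIV_const]]) simp
    from DERIV_chain2[OF DERIV_ln_divide this]
    have "((\<lambda>s. ln (1 + 1 / E s)) has_real_derivative
        1 / (1 + 1 / E s) * (- (2 * (w s \<bullet> w' s)) / (E s * E s))) (at s)"
      using E[OF s] by (simp add: add_pos_pos)
    then have "(M has_real_derivative 1 / (1 + 1 / E s) * (- (2 * (w s \<bullet> w' s)) / (E s * E s))) (at s)"
      unfolding M_def by (rule DERIV_cong[OF DERIV_add[OF DERIV_const]]) simp
    from DERIV_chain2[OF DERIV_ln_divide this]
    have D2: "((\<lambda>s. ln (M s)) has_real_derivative
        1 / M s * (1 / (1 + 1 / E s) * (- (2 * (w s \<bullet> w' s)) / (E s * E s)))) (at s)"
      using M[OF s] by simp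
    have *: "1 / (1 + 1 / E s) * (- (2 * (w s \<bullet> w' s)) / (E s * E s)) = - (2 * (w s \<bullet> w' s)) / (E s * (E s + 1))"
      using E[OF s] by (simp add: divide_simps)
    have "((\<lambda>s. ln (M s)) has_real_derivative N' s) (at s)"
      by (rule DERIV_cong[OF D2]) (simp only: * N'_def, simp)
    then show "((\<lambda>s. ln (M s)) has_real_derivative N' s) (at s within {- T..T})"
      by (rule DERIV_subset) simp
    have "\<bar>w s \<bullet> w' s\<bar> \<le> norm (w s) * norm (w' s)" by (rule Cauchy_Schwarz_ineq2)
    also have "\<dots> \<le> norm (w s) * (C * (norm (w s) * M s))"
      using bound[OF s] by (intro mult_left_mono) (auto simp: M_def E_def power2_norm_eq_inner)
    also have "\<dots> = C * (E s * M s)" by (simp add: E_def power2_norm_eq_inner[symmetric] power2_eq_square)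
    finally have 1: "\<bar>w s \<bullet> w' s\<bar> \<le> C * (E s * M s)" .
    have "0 < E s * M s" using E[OF s] M[OF s] by simp
    then have C: "C \<ge> 0" using 1 by (metis abs_ge_zero order_trans zero_le_mult_iff not_less order_less_imp_le)
    \<comment> \<open>The denominator \<open>M s\<close> cancels the logarithm in the velocity
      bound, and E s + 1 \<ge> 1, so only the constant 2 C is left.\<close>
    have "\<bar>N' s\<bar> = 2 * \<bar>w s \<bullet> w' s\<bar> / (E s * M s) / (E s + 1)"
      unfolding N'_def using E[OF s] M[OF s] by (simp add: abs_mult field_simps)
    also have "\<dots> \<le> 2 * C / (E s + 1)"
      using 1 \<open>0 < E s * M s\<close> E[OF s] by (intro divide_right_mono) (auto simp: divide_le_eq)
    also have "\<dots> \<le> 2 * C"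
      using C E[OF s] by (simp add: divide_le_eq) (simp add: algebra_simps)
    finally show "norm (N' s) \<le> 2 * C" by simp
  qed (use t in auto)
  moreover have "0 \<le> \<bar>t\<bar>" by simp
  moreover have C: "C \<ge> 0"
  proof -
    have T: "\<bar>0\<bar> \<le> T" using t by simp
    have "0 < norm (w 0) * M 0" using nz[OF T] M[OF T] by simp
    moreover have "0 \<le> C * (norm (w 0) * M 0)"
      using order_trans[OF norm_ge_zero bound[OF T]] by (simp add: M_def E_def power2_norm_eq_inner)
    ultimately show ?thesis by (simp add: zero_le_mult_iff)
  qed
  moreover have "2 * C * \<bar>t\<bar> \<le> 2 * C * T" using t C by (intro mult_left_mono) auto
  \<comment> \<open>Of the two-sided estimate this half is kept: trajectories close at time
    \<open>t\<close> were close at time 0, a modulus of continuity for the inverse flow.\<close>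
  ultimately have "ln (M t) \<le> ln (M 0) + 2 * C * T" by simp
  moreover have M0: "M 0 \<ge> 1" using M[of 0] t by simp
  ultimately have "exp (ln (M t) - 2 * C * T) \<le> exp (ln (M 0))"
    unfolding exp_le_cancel_iff by linarith
  then have "exp (- (2 * C * T)) * M t \<le> M 0"
    using M[OF t] M0 by (simp add: exp_diff exp_minus divide_inverse mult.commute)
  then show ?thesis by (simp add: M_def E_def power2_norm_eq_inner)
qed

text \<open>With E the squared distance of \<open>a\<close> and \<open>b\<close>, the squared
  increment of \<psi> is at most a multiple of E / (1 + E) = exp (- ln (1 + 1 / E)): by the
  Lipschitz bound for E \<le> 1, by boundedness otherwise. The separation hypothesis then converts
  the logarithm into a power of \<open>d\<close>.\<close>

lemma Lipschitz_bounded_composition_Hoelder: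
  fixes \<psi> :: "'a::real_normed_vector \<Rightarrow> real"
  assumes L: "\<And>a b. \<bar>\<psi> a - \<psi> b\<bar> \<le> L * norm (a - b)" and B: "\<And>a. \<bar>\<psi> a\<bar> \<le> B"
    and ab: "a \<noteq> b" and d: "d > 0" and k: "0 < \<kappa>"
    and sep: "\<kappa> * (1 + ln (1 + 1 / d\<^sup>2)) \<le> 1 + ln (1 + 1 / (norm (a - b))\<^sup>2)"
  shows "\<bar>\<psi> a - \<psi> b\<bar> \<le> sqrt (exp 1 * (2 * L\<^sup>2 + 8 * B\<^sup>2)) * d powr \<kappa>"
proof -
  let ?E = "(norm (a - b))\<^sup>2" and ?M = "2 * L\<^sup>2 + 8 * B\<^sup>2"
  have E: "?E > 0" using ab by simp
  have small: "r \<le> 2 * (r / (1 + r))" if "0 < r" "r \<le> 1" for r :: real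
    using that mult_left_mono[of r 1 r] by (simp add: field_simps)
  have "(\<psi> a - \<psi> b)\<^sup>2 \<le> ?M * (?E / (1 + ?E))"
  proof (cases "?E \<le> 1")
    case True
    have "(\<psi> a - \<psi> b)\<^sup>2 \<le> (L * norm (a - b))\<^sup>2"
      using L[of a b] by (rule abs_le_square_iff[THEN iffD1, OF order_trans[OF _ abs_ge_self]])
    also have "\<dots> = L\<^sup>2 * ?E" by (simp add: power_mult_distrib)
    also have "\<dots> \<le> L\<^sup>2 * (2 * (?E / (1 + ?E)))"
      using E True by (intro mult_left_mono small) auto
    also have "\<dots> \<le> ?M * (?E / (1 + ?E))"
      using E by (simp add: algebra_simps)
    finally show ?thesis .
  next
    case False
    have "\<bar>\<psi> a - \<psi> b\<bar> \<le> 2 * B" using B[of a] B[of b] by linarith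
    then have "(\<psi> a - \<psi> b)\<^sup>2 \<le> (2 * B)\<^sup>2"
      by (rule abs_le_square_iff[THEN iffD1, OF order_trans[OF _ abs_ge_self]])
    also have "\<dots> = 4 * B\<^sup>2 * 1" by (simp add: power_mult_distrib)
    also have "\<dots> \<le> 4 * B\<^sup>2 * (2 * (?E / (1 + ?E)))"
      using E False by (intro mult_left_mono) (auto simp: field_simps)
    also have "\<dots> \<le> ?M * (?E / (1 + ?E))"
      using E by (simp add: algebra_simps)
    finally show ?thesis .
  qed
  also have "?E / (1 + ?E) = exp (- ln (1 + 1 / ?E))"
    unfolding exp_minus using E by (subst exp_ln) (auto simp: field_simps add_pos_pos)
  \<comment> \<open>The additive 1 in the modulus survives as the factor exp 1 in the final
    constant.\<close>
  also have "\<dots> \<le> exp (1 - \<kappa> * ln (1 + 1 / d\<^sup>2))"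
    using sep k by (simp add: algebra_simps)
  also have "\<dots> = exp 1 * (1 + 1 / d\<^sup>2) powr (- \<kappa>)"
  proof -
    have "1 + 1 / d\<^sup>2 \<noteq> 0" using d by (intro less_imp_neq[THEN not_sym] add_pos_pos) auto
    then show ?thesis by (simp add: powr_def exp_diff exp_minus divide_inverse)
  qed
  also have "\<dots> \<le> exp 1 * (1 / d\<^sup>2) powr (- \<kappa>)"
    using d k by (intro mult_left_mono powr_mono2') auto
  also have "(1 / d\<^sup>2) powr (- \<kappa>) = (d powr \<kappa>)\<^sup>2"
    using d by (simp add: powr_minus powr_divide power2_eq_square powr_mult)
  finally have "(\<psi> a - \<psi> b)\<^sup>2 \<le> ?M * (exp 1 * (d powr \<kappa>)\<^sup>2)"
    by (simp add: mult_left_mono)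
  then have "sqrt ((\<psi> a - \<psi> b)\<^sup>2) \<le> sqrt (exp 1 * ?M * (d powr \<kappa>)\<^sup>2)"
    by (intro real_sqrt_le_mono) (simp add: mult_ac)
  then show ?thesis by (simp add: real_sqrt_mult)
qed

section \<open>Velocity and flow of a weak solution\<close>

locale blob_solution =
  fixes \<alpha> q\<^sub>0 \<eta> u q
  assumes alpha: "\<alpha> > 0" and sol: "weak_solution \<alpha> q\<^sub>0 \<eta> u q"
begin

lemma measure_curve_q: "measure_curve q"
  and C0_div_curve_u: "C0_div_curve u"
  and q_zero: "q 0 = q\<^sub>0"
  and u_eq: "u t = K_conv \<alpha> (q t)"
  and flow_zero: "\<eta> 0 = id"
  and flow_homeomorphism: "homeomorphism UNIV UNIV (\<eta> t) (inv (\<eta> t))"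
  and flow_preserving: "distr lborel borel (\<eta> t) = lborel"
  and w_ad_zero: "\<phi> \<in> test_functions \<Longrightarrow> w_ad u q \<phi> = 0"
  using sol by (auto simp: weak_solution_def measure_preserving_homeos_def)

lemma flow_difference_quotient:
  "uniform_limit UNIV (\<lambda>h x. (\<eta> (t + h) x - \<eta> t x) /\<^sub>R h) (u t \<circ> \<eta> t) (at 0)"
  using sol unfolding weak_solution_def C1_curve_with_deriv_def by blast

lemma flow_inverse: "inv (\<eta> t) (\<eta> t x) = x" "\<eta> t (inv (\<eta> t) x) = x"
  using flow_homeomorphism[of t] unfolding homeomorphism_def by blast+

lemma flow_continuous: "continuous_on S (\<eta> t)" "continuous_on S (inv (\<eta> t))"
  using flow_homeomorphism[of t] unfolding homeomorphism_def by (blast intro: continuous_on_subset)+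

lemma flow_injective: "\<eta> t x = \<eta> t y \<longleftrightarrow> x = y"
  by (metis flow_inverse(1))

lemma flow_derivative: "((\<lambda>s. \<eta> s x) has_vector_derivative u t (\<eta> t x)) (at t)"
  by (rule has_vector_derivative_of_difference_quotient)
    (use tendsto_uniform_limitI[OF flow_difference_quotient, of x t] in simp)

lemma u_component: "u t x \<bullet> c = signed_integral (q t) (\<lambda>y. K_kernel \<alpha> x y \<bullet> c)"
proof -
  have "signed_integrable (q t) (K_kernel \<alpha> x)"
  proof (rule signed_integrable_bounded)
    show "q t \<in> signed_measures" by (rule measure_curve_signed[OF measure_curve_q])
    show "K_kernel \<alpha> x \<in> borel_measurable borel"
      using vanishing_measurable[OF vanishing_K_kernel[OF alpha]]
      by (subst borel_measurable_euclidean_space) blast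
  qed (rule K_kernel_bounded[OF alpha])
  then show ?thesis unfolding u_eq K_conv_def by (rule signed_integral_inner)
qed

text \<open>The measures enter only through the uniform bound on the functionals, applied to the
  components of \<open>K_kernel \<alpha> x\<close> and of differences of two such kernels, which lie
  in C_0. The factor 2 is the dimension, from bounding the norm by the sum of the
  components.\<close>

lemma velocity_bounds:
  obtains C where "C \<ge> 0" "\<And>t x. \<bar>t\<bar> \<le> T \<Longrightarrow> norm (u t x) \<le> C"
    "\<And>t x y. \<bar>t\<bar> \<le> T \<Longrightarrow> x \<noteq> y \<Longrightarrow>
      norm (u t x - u t y) \<le> C * (norm (x - y) * (1 + ln (1 + 1 / (norm (x - y))\<^sup>2)))"
proof -
  obtain A where A: "A \<ge> 0" "\<And>t f B. \<bar>t\<bar> \<le> T \<Longrightarrow> vanishing f \<Longrightarrow> (\<And>x. \<bar>f x\<bar> \<le> B) \<Longrightarrow> \<bar>signed_integral (q t) f\<bar> \<le> A * B"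
    using measure_curve_uniform_bound[OF measure_curve_q] by metis
  obtain L where L: "L \<ge> 0" "\<And>x x' y. x \<noteq> x' \<Longrightarrow> norm (K_kernel \<alpha> x y - K_kernel \<alpha> x' y)
      \<le> L * (norm (x - x') * (1 + ln (1 + 1 / (norm (x - x'))\<^sup>2)))"
    using K_kernel_log_Lipschitz[OF alpha] by metis
  let ?k = "4 / (2 * pi * \<alpha>)"
  have int: "signed_integrable (q t) (\<lambda>y. K_kernel \<alpha> x y \<bullet> c)" for t x c
    by (intro measure_curve_integrable[OF measure_curve_q] vanishing_K_kernel alpha)
  show ?thesis
  proof (rule that[of "2 * A * ?k + 2 * A * L"])
    show "2 * A * ?k + 2 * A * L \<ge> 0" using A L alpha by simp
    fix t x assume t: "\<bar>t\<bar> \<le> T"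
    have "\<bar>u t x \<bullet> b\<bar> \<le> A * ?k" if b: "b \<in> Basis" for b
      unfolding u_component
    proof (rule A(2)[OF t vanishing_K_kernel[OF alpha]])
      fix y show "\<bar>K_kernel \<alpha> x y \<bullet> b\<bar> \<le> ?k"
        using Basis_le_norm[OF b, of "K_kernel \<alpha> x y"] K_kernel_bounded[OF alpha, of x y] by linarith
    qed
    then have "norm (u t x) \<le> (\<Sum>b\<in>(Basis :: (real^2) set). A * ?k)"
      by (intro order_trans[OF norm_le_l1] sum_mono)
    then have "norm (u t x) \<le> 2 * A * ?k" by simp
    moreover have "0 \<le> 2 * A * L" using A L by simp
    ultimately show "norm (u t x) \<le> 2 * A * ?k + 2 * A * L" by linarith
    fix y assume xy: "x \<noteq> y"
    let ?m = "norm (x - y) * (1 + ln (1 + 1 / (norm (x - y))\<^sup>2))"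
    have m: "?m \<ge> 0" by (intro mult_nonneg_nonneg add_nonneg_nonneg ln_ge_zero) auto
    have "\<bar>(u t x - u t y) \<bullet> b\<bar> \<le> A * (L * ?m)" if b: "b \<in> Basis" for b
    proof -
      have "(u t x - u t y) \<bullet> b = signed_integral (q t) (\<lambda>z. K_kernel \<alpha> x z \<bullet> b - K_kernel \<alpha> y z \<bullet> b)"
        by (simp add: inner_diff_left u_component signed_integral_diff int)
      also have "\<bar>\<dots>\<bar> \<le> A * (L * ?m)"
      proof (rule A(2)[OF t vanishing_diff[OF vanishing_K_kernel[OF alpha] vanishing_K_kernel[OF alpha]]])
        fix z show "\<bar>K_kernel \<alpha> x z \<bullet> b - K_kernel \<alpha> y z \<bullet> b\<bar> \<le> L * ?m"
          using Basis_le_norm[OF b, of "K_kernel \<alpha> x z - K_kernel \<alpha> y z"] L(2)[OF xy, of z]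
          by (simp add: inner_diff_left)
      qed
      finally show ?thesis .
    qed
    then have "norm (u t x - u t y) \<le> (\<Sum>b\<in>(Basis :: (real^2) set). A * (L * ?m))"
      by (intro order_trans[OF norm_le_l1] sum_mono)
    also have "\<dots> = 2 * A * L * ?m" by simp
    also have "\<dots> \<le> (2 * A * ?k + 2 * A * L) * ?m"
      using A alpha m by (intro mult_right_mono) auto
    finally show "norm (u t x - u t y) \<le> (2 * A * ?k + 2 * A * L) * ?m" .
  qed
qed

text \<open>With d = |x - y|, the velocity increment is of order d (1 + ln (1 + 1 / d^2)) and the
  transported function contributes d powr \<kappa>. A whole factor d is left over on the right to
  pay for the gradient of the mollifier; the rest tends to 0.\<close>

lemma commutator_modulus:
  fixes \<psi> :: "real^2 \<Rightarrow> real"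
  assumes L: "\<And>a b. \<bar>\<psi> a - \<psi> b\<bar> \<le> L * norm (a - b)" and B: "\<And>a. \<bar>\<psi> a\<bar> \<le> B" and e: "e > 0"
  obtains \<epsilon> where "\<epsilon> > 0"
    "\<And>t x y. \<bar>t\<bar> \<le> T \<Longrightarrow> norm (x - y) \<le> \<epsilon> \<Longrightarrow> \<bar>\<psi> (inv (\<eta> t) x) - \<psi> (inv (\<eta> t) y)\<bar> \<le> e"
    "\<And>t x y. \<bar>t\<bar> \<le> T \<Longrightarrow> norm (x - y) \<le> \<epsilon> \<Longrightarrow>
      norm (u t x - u t y) * \<bar>\<psi> (inv (\<eta> t) x) - \<psi> (inv (\<eta> t) y)\<bar> \<le> e * norm (x - y)"
proof -
  obtain C where C: "C \<ge> 0"
    "\<And>t x y. \<bar>t\<bar> \<le> T \<Longrightarrow> x \<noteq> y \<Longrightarrow>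
      norm (u t x - u t y) \<le> C * (norm (x - y) * (1 + ln (1 + 1 / (norm (x - y))\<^sup>2)))"
    using velocity_bounds by metis
  define \<kappa> where "\<kappa> = exp (- (2 * C * T))"
  define M where "M = sqrt (exp 1 * (2 * L\<^sup>2 + 8 * B\<^sup>2))"
  have kappa: "\<kappa> > 0" by (simp add: \<kappa>_def)
  have M: "M \<ge> 0" by (simp add: M_def)
  have hoelder: "\<bar>\<psi> (inv (\<eta> t) x) - \<psi> (inv (\<eta> t) y)\<bar> \<le> M * norm (x - y) powr \<kappa>"
    if t: "\<bar>t\<bar> \<le> T" and xy: "x \<noteq> y" for t x y
  proof -
    let ?a = "inv (\<eta> t) x" and ?b = "inv (\<eta> t) y"
    have ab: "?a \<noteq> ?b" using xy flow_inverse(2) by metis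
    \<comment> \<open>The two trajectories start at \<open>?a\<close> and \<open>?b\<close> and
      arrive at \<open>x\<close> and \<open>y\<close> at time \<open>t\<close>.\<close>
    have "exp (- (2 * C * T)) * (1 + ln (1 + 1 / (norm (\<eta> t ?a - \<eta> t ?b))\<^sup>2))
        \<le> 1 + ln (1 + 1 / (norm (\<eta> 0 ?a - \<eta> 0 ?b))\<^sup>2)"
    proof (rule Osgood_separation[OF _ _ _ t])
      fix s assume s: "\<bar>s\<bar> \<le> T"
      show "((\<lambda>s. \<eta> s ?a - \<eta> s ?b) has_vector_derivative u s (\<eta> s ?a) - u s (\<eta> s ?b)) (at s)"
        by (intro has_vector_derivative_diff flow_derivative)
      show "\<eta> s ?a - \<eta> s ?b \<noteq> 0" using ab flow_injective by simp
      then show "norm (u s (\<eta> s ?a) - u s (\<eta> s ?b)) \<le> C * (norm (\<eta> s ?a - \<eta> s ?b)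
          * (1 + ln (1 + 1 / (norm (\<eta> s ?a - \<eta> s ?b))\<^sup>2)))"
        by (intro C(2) s) simp
    qed
    then have "\<kappa> * (1 + ln (1 + 1 / (norm (x - y))\<^sup>2)) \<le> 1 + ln (1 + 1 / (norm (?a - ?b))\<^sup>2)"
      by (simp add: \<kappa>_def flow_inverse flow_zero)
    then show ?thesis
      unfolding M_def using xy by (intro Lipschitz_bounded_composition_Hoelder[OF L B ab _ kappa]) auto
  qed
  have "((\<lambda>d. M * d powr \<kappa>) \<longlongrightarrow> M * 0) (at_right 0)"
    "((\<lambda>d. C * M * (d powr \<kappa> * (1 + ln (1 + 1 / d\<^sup>2)))) \<longlongrightarrow> C * M * 0) (at_right 0)"
    by (intro tendsto_mult tendsto_const powr_log_modulus_tendsto kappa)+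
  then have "\<forall>\<^sub>F d in at_right 0. M * d powr \<kappa> < e"
    "\<forall>\<^sub>F d in at_right 0. C * M * (d powr \<kappa> * (1 + ln (1 + 1 / d\<^sup>2))) < e"
    using e by (auto dest: order_tendstoD(2))
  then have "\<forall>\<^sub>F d in at_right 0. M * d powr \<kappa> < e \<and> C * M * (d powr \<kappa> * (1 + ln (1 + 1 / d\<^sup>2))) < e"
    by (rule eventually_conj)
  then obtain b where b: "b > 0"
    "\<And>d. 0 < d \<Longrightarrow> d < b \<Longrightarrow> M * d powr \<kappa> < e \<and> C * M * (d powr \<kappa> * (1 + ln (1 + 1 / d\<^sup>2))) < e"
    by (auto simp: eventually_at_right_field)
  show ?thesis
  proof (rule that[of "b / 2"])
    show "b / 2 > 0" using b by simp
    fix t and x y :: "real^2" assume t: "\<bar>t\<bar> \<le> T" and n: "norm (x - y) \<le> b / 2"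
    have *: "\<bar>\<psi> (inv (\<eta> t) x) - \<psi> (inv (\<eta> t) y)\<bar> \<le> e \<and>
       norm (u t x - u t y) * \<bar>\<psi> (inv (\<eta> t) x) - \<psi> (inv (\<eta> t) y)\<bar> \<le> e * norm (x - y)"
    proof (cases "x = y")
      case False
      let ?d = "norm (x - y)"
      have d: "0 < ?d" "?d < b" using False n b by auto
      have "norm (u t x - u t y) * \<bar>\<psi> (inv (\<eta> t) x) - \<psi> (inv (\<eta> t) y)\<bar>
          \<le> (C * (?d * (1 + ln (1 + 1 / ?d\<^sup>2)))) * (M * ?d powr \<kappa>)"
        using C(1) by (intro mult_mono C(2) hoelder t False mult_nonneg_nonneg add_nonneg_nonneg ln_ge_zero) auto
      also have "\<dots> = (C * M * (?d powr \<kappa> * (1 + ln (1 + 1 / ?d\<^sup>2)))) * ?d" by simp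
      also have "\<dots> \<le> e * ?d" using b(2)[OF d] by (intro mult_right_mono) auto
      finally show ?thesis using hoelder[OF t False] b(2)[OF d] by auto
    qed (use e in simp)
    then show "\<bar>\<psi> (inv (\<eta> t) x) - \<psi> (inv (\<eta> t) y)\<bar> \<le> e"
       "norm (u t x - u t y) * \<bar>\<psi> (inv (\<eta> t) x) - \<psi> (inv (\<eta> t) y)\<bar> \<le> e * norm (x - y)"
      by auto
  qed
qed

end

section \<open>Mollifiers\<close>

lemma lborel_integral_affine:
  fixes g :: "'a::euclidean_space \<Rightarrow> real"
  assumes "g \<in> borel_measurable borel" "c \<noteq> 0"
  shows "(\<integral>x. g x \<partial>lborel) = \<bar>c\<bar> ^ DIM('a) * (\<integral>x. g (t + c *\<^sub>R x) \<partial>lborel)"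
proof -
  have "(\<integral>x. g x \<partial>lborel) = (\<integral>x. g x \<partial>density (distr lborel borel (\<lambda>x. t + c *\<^sub>R x)) (\<lambda>_. \<bar>c\<bar> ^ DIM('a)))"
    by (subst lborel_affine[OF assms(2), of t]) simp
  also have "\<dots> = (\<integral>x. \<bar>c\<bar> ^ DIM('a) *\<^sub>R g x \<partial>distr lborel borel (\<lambda>x. t + c *\<^sub>R x))"
    using assms by (intro integral_density) auto
  also have "\<dots> = (\<integral>x. \<bar>c\<bar> ^ DIM('a) *\<^sub>R g (t + c *\<^sub>R x) \<partial>lborel)"
    using assms by (intro integral_distr) auto
  finally show ?thesis by simp
qed

lemma test_function_integrable: "f \<in> test_functions \<Longrightarrow> integrable lborel f"
  using test_function_zero_outside integrable_zero_outside test_function_continuous by metis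

lemma test_function_measurable: "f \<in> test_functions \<Longrightarrow> f \<in> borel_measurable borel"
  by (intro borel_measurable_continuous_onI test_function_continuous)

lemma integrable_indicator_cball:
  fixes a :: "'a::euclidean_space" and c :: real
  shows "integrable lborel (\<lambda>x. indicator (cball a r) x *\<^sub>R c)"
  using emeasure_bounded_finite[OF bounded_cball[of a r]]
  by (intro integrable_scaleR_left integrable_real_indicator) auto

text \<open>Translation invariance of Lebesgue measure replaces integration by parts: the integral
  of f (x + h b) - f x is 0, and its Taylor remainder is of order h^2 on a fixed ball, so dividing
  by \<open>h\<close> and letting it tend to 0 gives the claim.\<close>

lemma integral_partial_test_function:
  fixes f :: "'a::euclidean_space \<Rightarrow> real"
  assumes f: "f \<in> test_functions" and b: "b \<in> Basis"
  shows "(\<integral>x. partial b f x \<partial>lborel) = 0"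
proof -
  obtain L where L: "L \<ge> 0" "\<And>x v. \<bar>f (x + v) - f x - frechet_derivative f (at x) v\<bar> \<le> L * (norm v)\<^sup>2"
    using test_function_Taylor[OF f] by metis
  obtain R where R: "R > 0" "\<And>x. norm x > R \<Longrightarrow> f x = 0" using test_function_zero_outside[OF f] by metis
  have pb: "partial b f \<in> test_functions" by (rule test_function_partial[OF f b])
  have lin: "frechet_derivative f (at x) (h *\<^sub>R b) = h * partial b f x" for x h
    using linear_frechet_derivative[OF test_function_differentiable[OF f]]
    by (simp add: linear_scale)
  have out: "f x = 0" "partial b f x = 0" if "norm x > R + 1" for x
  proof -
    show "f x = 0" using R that by auto
    have "x \<notin> supp f"
    proof
      assume "x \<in> supp f"
      moreover have "closure {x. f x \<noteq> 0} \<subseteq> cball 0 R"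
        using R(2) by (intro closure_minimal) (auto simp: not_less[symmetric])
      ultimately show False using that by (auto simp: supp_def)
    qed
    then show "partial b f x = 0" by (rule partial_outside_supp)
  qed
  \<comment> \<open>A shift by less than 1 of a point outside radius R + 2 stays outside R + 1,
    where \<open>f\<close> and its derivative vanish.\<close>
  let ?V = "measure lborel (cball (0::'a) (R + 2))"
  have bound: "\<bar>\<integral>x. partial b f x \<partial>lborel\<bar> \<le> (L * ?V) * h" if h: "0 < h" "h < 1" for h
  proof -
    let ?r = "\<lambda>x. f (x + h *\<^sub>R b) - f x - h * partial b f x"
    have intf: "integrable lborel f" "integrable lborel (partial b f)"
      by (intro test_function_integrable f pb)+
    have inth: "integrable lborel (\<lambda>x. f (x + h *\<^sub>R b))"
    proof (rule integrable_zero_outside)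
      show "continuous_on UNIV (\<lambda>x. f (x + h *\<^sub>R b))"
        by (intro continuous_on_compose2[OF test_function_continuous[OF f, of UNIV]] continuous_intros) auto
      show "f (x + h *\<^sub>R b) = 0" if "norm x > R + 1" for x
        using that h b norm_triangle_sub[of x "- (h *\<^sub>R b)"] by (intro R(2)) simp
    qed
    have shift: "(\<integral>x. f (x + h *\<^sub>R b) \<partial>lborel) = (\<integral>x. f x \<partial>lborel)"
      using lborel_integral_affine[OF test_function_measurable[OF f], of 1 "h *\<^sub>R b"]
      by (simp add: add.commute)
    have "- h * (\<integral>x. partial b f x \<partial>lborel) = (\<integral>x. ?r x \<partial>lborel)"
      using intf inth shift by simp
    then have "h * \<bar>\<integral>x. partial b f x \<partial>lborel\<bar> = \<bar>\<integral>x. ?r x \<partial>lborel\<bar>"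
      using h by (metis abs_minus_cancel abs_mult abs_of_pos mult_minus_left)
    also have "\<dots> \<le> (\<integral>x. indicator (cball 0 (R + 2)) x *\<^sub>R (L * h\<^sup>2) \<partial>(lborel :: 'a measure))"
    proof (rule order_trans[OF integral_abs_bound integral_mono])
      show "integrable lborel (\<lambda>x. \<bar>?r x\<bar>)" using intf inth by auto
      show "integrable lborel (\<lambda>x::'a. indicator (cball 0 (R + 2)) x *\<^sub>R (L * h\<^sup>2))"
        by (rule integrable_indicator_cball)
      fix x :: 'a
      show "\<bar>?r x\<bar> \<le> indicator (cball 0 (R + 2)) x *\<^sub>R (L * h\<^sup>2)"
      proof (cases "norm x \<le> R + 2")
        case True
        then show ?thesis using L(2)[of x "h *\<^sub>R b"] b by (simp add: lin)
      next
        case False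
        then have "norm (x + h *\<^sub>R b) > R + 1"
          using h b norm_triangle_sub[of x "- (h *\<^sub>R b)"] by simp
        then show ?thesis using False out[of "x + h *\<^sub>R b"] out[of x] by simp
      qed
    qed
    also have "\<dots> = h * ((L * ?V) * h)" by (simp add: power2_eq_square mult_ac)
    finally show ?thesis using h by simp
  qed
  have "((\<lambda>h. (L * ?V) * h) \<longlongrightarrow> (L * ?V) * 0) (at_right 0)" by (intro tendsto_intros)
  moreover have "\<forall>\<^sub>F h in at_right 0. \<bar>\<integral>x. partial b f x \<partial>lborel\<bar> \<le> (L * ?V) * h"
    using bound by (auto simp: eventually_at_right_field intro!: exI[of _ 1])
  ultimately have "\<bar>\<integral>x. partial b f x \<partial>lborel\<bar> \<le> (L * ?V) * 0"
    by (rule tendsto_lowerbound) simp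
  then show ?thesis by simp
qed

text \<open>On the ball of radius 1 / 2 one has 1 - |x|^2 \<ge> 3 / 4, so the bump is at least exp
  (- 4 / 3) there.\<close>

lemma integral_bump_pos: "0 < (\<integral>x. bump x \<partial>(lborel :: 'a::euclidean_space measure))"
proof -
  let ?B = "cball (0::'a) (1 / 2)"
  have "0 < exp (- 4 / 3) * measure lborel ?B"
    using content_cball_pos[of "1/2" "0::'a"] by simp
  also have "\<dots> = (\<integral>x. indicator ?B x *\<^sub>R exp (- 4 / 3) \<partial>lborel)" by simp
  also have "\<dots> \<le> (\<integral>x. bump x \<partial>(lborel :: 'a measure))"
  proof (rule integral_mono)
    show "integrable lborel (\<lambda>x. indicator ?B x *\<^sub>R exp (- 4 / 3 :: real))"
      by (rule integrable_indicator_cball)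
    show "integrable lborel (bump :: 'a \<Rightarrow> real)" by (rule test_function_integrable[OF test_function_bump])
    fix x :: 'a
    have "exp (- 4 / 3) \<le> bump x" if "norm x \<le> 1 / 2"
    proof -
      have "x \<bullet> x \<le> (1 / 2)\<^sup>2"
        using that unfolding power2_norm_eq_inner[symmetric] by (intro power_mono) auto
      then have "3 / 4 \<le> 1 - x \<bullet> x" by (simp add: power2_eq_square)
      then have "- 4 / 3 \<le> - 1 / (1 - x \<bullet> x)" by (simp add: field_simps)
      then show ?thesis using \<open>3 / 4 \<le> 1 - x \<bullet> x\<close> by (simp add: bump_def exp_cutoff_def)
    qed
    then show "indicator ?B x *\<^sub>R exp (- 4 / 3) \<le> bump x"
      using bump_nonneg by (auto simp: indicator_def)
  qed
  finally show ?thesis .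
qed

definition mollifier :: "real \<Rightarrow> 'a::euclidean_space \<Rightarrow> real" where
  "mollifier \<epsilon> x = bump (x /\<^sub>R \<epsilon>) / (\<epsilon> ^ DIM('a) * (\<integral>y. bump y \<partial>(lborel :: 'a measure)))"

lemma mollifier_nonneg: "\<epsilon> > 0 \<Longrightarrow> mollifier \<epsilon> x \<ge> 0"
  using integral_bump_pos[where 'a = 'a] by (simp add: mollifier_def bump_nonneg less_imp_le)

lemma mollifier_zero_outside: "\<epsilon> > 0 \<Longrightarrow> norm x \<ge> \<epsilon> \<Longrightarrow> mollifier \<epsilon> x = 0"
  by (simp add: mollifier_def bump_eq_0 field_simps)

lemma scaleR_has_derivative: "((\<lambda>x. x /\<^sub>R \<epsilon>) has_derivative (\<lambda>v. v /\<^sub>R \<epsilon>)) (at x)"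
  by (rule bounded_linear_imp_has_derivative[OF bounded_linear_scaleR_right])

lemma mollifier_eq: "(mollifier \<epsilon> :: 'a::euclidean_space \<Rightarrow> real) =
    (\<lambda>x. 1 / (\<epsilon> ^ DIM('a) * (\<integral>y. bump y \<partial>(lborel :: 'a measure))) * bump (x /\<^sub>R \<epsilon>))"
  by (simp add: fun_eq_iff mollifier_def)

lemma test_function_mollifier:
  assumes "\<epsilon> > 0"
  shows "(mollifier \<epsilon> :: 'a::euclidean_space \<Rightarrow> real) \<in> test_functions"
proof (rule test_functionsI[where R = \<epsilon>])
  show "smooth (mollifier \<epsilon> :: 'a \<Rightarrow> real)"
    unfolding mollifier_eq
    by (rule smooth_scale[OF smooth_compose_affine[OF smooth_bump scaleR_has_derivative]])
qed (intro mollifier_zero_outside assms less_imp_le)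

lemma integral_scale_argument:
  fixes g :: "'a::euclidean_space \<Rightarrow> real"
  assumes "g \<in> borel_measurable borel" "\<epsilon> > 0"
  shows "(\<integral>x. g (x /\<^sub>R \<epsilon>) \<partial>lborel) = \<epsilon> ^ DIM('a) * (\<integral>x. g x \<partial>lborel)"
  using lborel_integral_affine[OF assms(1), of "inverse \<epsilon>" 0] assms(2)
  by (simp add: power_inverse field_simps)

lemma integral_mollifier:
  assumes "\<epsilon> > 0"
  shows "(\<integral>x. mollifier \<epsilon> x \<partial>(lborel :: 'a::euclidean_space measure)) = 1"
  unfolding mollifier_eq
  using integral_scale_argument[OF test_function_measurable[OF test_function_bump] assms, where 'a = 'a]
    integral_bump_pos[where 'a = 'a] assms
  by simp

text \<open>The exact power of \<epsilon> matters: one factor 1 / \<epsilon> is what the commutator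
  estimate can afford.\<close>

lemma integral_abs_partial_mollifier:
  fixes b :: "'a::euclidean_space"
  assumes e: "\<epsilon> > 0" and b: "b \<in> Basis"
  shows "(\<integral>x. \<bar>partial b (mollifier \<epsilon>) x\<bar> \<partial>lborel)
    = (\<integral>x. \<bar>partial b bump x\<bar> \<partial>lborel) / (\<integral>x. bump x \<partial>(lborel :: 'a measure)) / \<epsilon>"
proof -
  let ?J = "\<integral>x. bump x \<partial>(lborel :: 'a measure)"
  let ?n = "\<epsilon> ^ DIM('a)"
  have "((\<lambda>x. 1 / (?n * ?J) * bump (x /\<^sub>R \<epsilon>)) has_derivative
      (\<lambda>v. 1 / (?n * ?J) * frechet_derivative bump (at (x /\<^sub>R \<epsilon>)) (v /\<^sub>R \<epsilon>))) (at x)" for x :: 'a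
    by (intro has_derivative_mult_right has_derivative_compose[OF scaleR_has_derivative] smooth_has_derivative smooth_bump)
  note D = partial_eq[OF this, of b]
  have "frechet_derivative bump (at y) (b /\<^sub>R \<epsilon>) = inverse \<epsilon> * partial b bump y" for y :: 'a
    by (rule linear_scale[OF linear_frechet_derivative[OF smooth_differentiable[OF smooth_bump]], unfolded real_scaleR_def])
  with fun_cong[OF D] have "partial b (mollifier \<epsilon>) x = 1 / (?n * ?J) * (partial b bump (x /\<^sub>R \<epsilon>) / \<epsilon>)" for x
    unfolding mollifier_eq by (simp add: divide_inverse_commute)
  then have "(\<integral>x. \<bar>partial b (mollifier \<epsilon>) x\<bar> \<partial>lborel) = (\<integral>x. 1 / (?n * ?J * \<epsilon>) * \<bar>partial b bump (x /\<^sub>R \<epsilon>)\<bar> \<partial>lborel)"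
    using e integral_bump_pos[where 'a = 'a] by (simp add: abs_mult del: integral_divide_zero integral_mult_right_zero)
  also have "\<dots> = 1 / (?n * ?J * \<epsilon>) * (?n * (\<integral>x. \<bar>partial b bump x\<bar> \<partial>lborel))"
    using integral_scale_argument[OF borel_measurable_abs[OF test_function_measurable[OF test_function_partial[OF test_function_bump b]]] e]
    by simp
  finally show ?thesis using e by simp
qed

lemma mollifier_average:
  fixes d :: "'a::euclidean_space \<Rightarrow> real"
  assumes e: "\<epsilon> > 0" and d: "continuous_on UNIV d" and near: "\<And>x. norm x \<le> \<epsilon> \<Longrightarrow> \<bar>d x - D\<bar> \<le> r"
  shows "\<bar>(\<integral>x. mollifier \<epsilon> x * d x \<partial>lborel) - D\<bar> \<le> r"
proof -
  note m = test_function_mollifier[OF e, where 'a = 'a]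
  have int: "integrable lborel (\<lambda>x. mollifier \<epsilon> x * d x)"
    using e by (intro integrable_zero_outside[where R = \<epsilon>] continuous_on_mult test_function_continuous m d)
      (simp add: mollifier_zero_outside)
  have intm: "integrable lborel (mollifier \<epsilon> :: 'a \<Rightarrow> real)" by (rule test_function_integrable[OF m])
  have "(\<integral>x. mollifier \<epsilon> x * d x \<partial>lborel) - D = (\<integral>x. mollifier \<epsilon> x * d x - mollifier \<epsilon> x * D \<partial>lborel)"
    using int intm integral_mollifier[OF e, where 'a = 'a] by simp
  also have "\<bar>\<dots>\<bar> \<le> (\<integral>x. mollifier \<epsilon> x * r \<partial>(lborel :: 'a measure))"
  proof (rule order_trans[OF integral_abs_bound integral_mono])
    fix x :: 'a
    show "\<bar>mollifier \<epsilon> x * d x - mollifier \<epsilon> x * D\<bar> \<le> mollifier \<epsilon> x * r"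
    proof (cases "norm x \<le> \<epsilon>")
      case True
      then have "mollifier \<epsilon> x * \<bar>d x - D\<bar> \<le> mollifier \<epsilon> x * r"
        by (intro mult_left_mono near mollifier_nonneg e)
      then show ?thesis
        using mollifier_nonneg[OF e, of x] by (simp add: right_diff_distrib[symmetric] abs_mult)
    qed (simp add: mollifier_zero_outside e)
  qed (use int intm in auto)
  also have "\<dots> = r" using integral_mollifier[OF e, where 'a = 'a] by simp
  finally show ?thesis .
qed

text \<open>The difference of two translates of a bump is the derivative of a test function, since
  its primitive is compactly supported. Hence mollified averages of \<open>c\<close> around
  \<open>r\<close> and around \<open>s\<close> coincide, and continuity passes to the
  values.\<close>

lemma du_Bois_Reymond:
  fixes c :: "real \<Rightarrow> real"
  assumes c: "continuous_on UNIV c" and zero: "\<And>\<tau>. \<tau> \<in> test_functions \<Longrightarrow> (\<integral>t. partial 1 \<tau> t * c t \<partial>lborel) = 0"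
  shows "c r = c s"
proof -
  define d where "d t = c (r + t) - c (s + t)" for t
  have ct: "continuous_on UNIV (\<lambda>t. c (a + t))" for a
    by (intro continuous_on_compose2[OF c] continuous_intros) auto
  have cd: "continuous_on UNIV d"
    unfolding d_def by (intro continuous_on_diff ct)
  have avg: "(\<integral>t. mollifier \<epsilon> t * d t \<partial>lborel) = 0" if e: "\<epsilon> > 0" for \<epsilon>
  proof -
    note m = test_function_mollifier[OF e, where 'a = real]
    have "isCont (mollifier \<epsilon> :: real \<Rightarrow> real) x" for x
      using test_function_continuous[OF m, of UNIV] by (simp add: continuous_on_eq_continuous_at)
    then obtain P where P: "\<And>x. (P has_real_derivative mollifier \<epsilon> x) (at x)"
      using einterval_antiderivative[of "-\<infinity>" "\<infinity>" "mollifier \<epsilon>"]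
      by (auto simp: has_real_derivative_iff_has_vector_derivative)
    have partialP: "partial b P = (\<lambda>x. b * mollifier \<epsilon> x)" for b
      using partial_eq[OF P[unfolded has_field_derivative_def]] by (simp add: mult.commute)
    have smoothP: "smooth P"
    proof (rule smooth_fun_span[where G = "insert P {f. smooth f}"])
      fix g b assume "g \<in> insert P {f. smooth f}" and b: "(b :: real) \<in> Basis"
      then have "smooth (partial b g)"
        using smooth_scale[OF test_function_smooth[OF m], of b] smooth_partial[OF _ b] by (auto simp: partialP)
      then show "partial b g \<in> fun_span (insert P {f. smooth f})" by (auto intro: fun_span_base)
    next
      fix g x assume "g \<in> insert P {f. smooth f}"
      moreover have "P differentiable at x" using P by (auto simp: real_differentiable_def)
      ultimately show "g differentiable at x" by (auto intro: smooth_differentiable)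
    qed (auto intro: fun_span_base)
    have zero_deriv: "(P has_real_derivative 0) (at x)" if "\<bar>x\<bar> \<ge> \<epsilon>" for x
      using P[of x] mollifier_zero_outside[OF e, of x] that by simp
    have cont: "continuous_on {x..y} P" for x y
      using P by (intro DERIV_continuous_on) (auto intro: has_field_derivative_at_within)
    have right: "P x = P \<epsilon>" if "x > \<epsilon>" for x
      by (rule DERIV_isconst_end[OF that cont]) (use zero_deriv in auto)
    have left: "P x = P (- \<epsilon>)" if "x < - \<epsilon>" for x
      by (rule DERIV_isconst_end[OF that cont, symmetric]) (use zero_deriv in auto)
    \<comment> \<open>\<open>P\<close> is constant on either side of the mollifier's support but
      differs between the sides; subtracting a translate cancels both constants.\<close>
    define \<tau> where "\<tau> t = P (t - r) + (-1) * P (t - s)" for t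
    have id_diff: "((\<lambda>t. t - a) has_derivative (\<lambda>h. h)) (at t)" for a t :: real
      by (auto intro!: derivative_eq_intros)
    have "\<tau> \<in> test_functions"
    proof (rule test_functionsI[where R = "\<bar>r\<bar> + \<bar>s\<bar> + \<epsilon>"])
      show "smooth \<tau>" unfolding \<tau>_def
        by (intro smooth_add smooth_scale smooth_compose_affine[OF smoothP id_diff])
      fix t :: real assume "norm t > \<bar>r\<bar> + \<bar>s\<bar> + \<epsilon>"
      then consider "t - r > \<epsilon>" "t - s > \<epsilon>" | "t - r < - \<epsilon>" "t - s < - \<epsilon>" by fastforce
      then show "\<tau> t = 0" by cases (simp_all add: \<tau>_def left right)
    qed
    moreover have "partial 1 \<tau> = (\<lambda>t. mollifier \<epsilon> (t - r) - mollifier \<epsilon> (t - s))"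
    proof -
      have "(\<tau> has_real_derivative mollifier \<epsilon> (t - r) - mollifier \<epsilon> (t - s)) (at t)" for t
        unfolding \<tau>_def by (auto intro!: derivative_eq_intros DERIV_chain2[OF P])
      from partial_eq[OF this[unfolded has_field_derivative_def]] show ?thesis by simp
    qed
    ultimately have "(\<integral>t. (mollifier \<epsilon> (t - r) - mollifier \<epsilon> (t - s)) * c t \<partial>lborel) = 0"
      using zero[of \<tau>] by metis
    moreover have int: "integrable lborel (\<lambda>t. mollifier \<epsilon> (t - a) * c (b + t))" for a b :: real
    proof (rule integrable_zero_outside[where R = "\<bar>a\<bar> + \<epsilon>"])
      show "continuous_on UNIV (\<lambda>t. mollifier \<epsilon> (t - a) * c (b + t))"
        by (intro continuous_on_mult ct continuous_on_compose2[OF test_function_continuous[OF m, of UNIV]] continuous_intros) auto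
      show "mollifier \<epsilon> (t - a) * c (b + t) = 0" if "norm t > \<bar>a\<bar> + \<epsilon>" for t
        using that mollifier_zero_outside[OF e, of "t - a"] by auto
    qed
    moreover have "(\<integral>t. mollifier \<epsilon> (t - a) * c t \<partial>lborel) = (\<integral>t. mollifier \<epsilon> t * c (a + t) \<partial>lborel)" for a
      using lborel_integral_affine[of "\<lambda>t. mollifier \<epsilon> (t - a) * c t" 1 a] int[of a 0]
      by (simp add: borel_measurable_integrable)
    ultimately show ?thesis
      using int[of _ 0] int[of 0] by (simp add: left_diff_distrib d_def right_diff_distrib)
  qed
  have small: "\<bar>d 0\<bar> \<le> e" if e: "e > 0" for e
  proof -
    obtain \<delta> where \<delta>: "\<delta> > 0" "\<And>t. dist t 0 < \<delta> \<Longrightarrow> dist (d t) (d 0) < e"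
      using cd[unfolded continuous_on_iff, rule_format, OF UNIV_I e, of 0] by auto
    have "\<bar>(\<integral>t. mollifier (\<delta> / 2) t * d t \<partial>lborel) - d 0\<bar> \<le> e"
    proof (rule mollifier_average[OF _ cd])
      fix t :: real assume "norm t \<le> \<delta> / 2"
      then have "dist t 0 < \<delta>" using \<delta>(1) by simp
      then show "\<bar>d t - d 0\<bar> \<le> e" using \<delta>(2)[of t] by (simp add: dist_real_def)
    qed (use \<delta>(1) in simp)
    then show ?thesis using avg[of "\<delta> / 2"] \<delta>(1) by simp
  qed
  have "\<bar>d 0\<bar> \<le> 0" by (rule field_le_epsilon) (simp only: add_0_left small)
  then have "d 0 = 0" by simp
  then show ?thesis by (simp add: d_def)
qed

section \<open>Differentiating along a weak solution\<close>

text \<open>If \<open>B\<close> is a primitive of \<open>b\<close>, then a - B has weak derivative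
  zero and is therefore constant, so \<open>a\<close> is classically differentiable.\<close>

lemma antiderivative_of_weak_derivative:
  fixes a b :: "real \<Rightarrow> real"
  assumes a: "continuous_on UNIV a" and b: "continuous_on UNIV b"
    and weak: "\<And>\<tau>. \<tau> \<in> test_functions \<Longrightarrow> (\<integral>t. partial 1 \<tau> t * a t + \<tau> t * b t \<partial>lborel) = 0"
  shows "(a has_real_derivative b t) (at t)"
proof -
  have "isCont b x" for x using b by (simp add: continuous_on_eq_continuous_at)
  then obtain B where B: "\<And>x. (B has_real_derivative b x) (at x)"
    using einterval_antiderivative[of "-\<infinity>" "\<infinity>" b]
    by (auto simp: has_real_derivative_iff_has_vector_derivative)
  have contB: "continuous_on UNIV B"
    using B by (intro DERIV_continuous_on) (auto intro: has_field_derivative_at_within)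
  have zero: "(\<integral>t. partial 1 \<tau> t * (a t - B t) \<partial>lborel) = 0" if \<tau>: "\<tau> \<in> test_functions" for \<tau> :: "real \<Rightarrow> real"
  proof -
    have p: "partial 1 \<tau> \<in> test_functions" by (rule test_function_partial[OF \<tau>]) simp
    obtain R where R: "R > 0" "\<And>x. norm x > R \<Longrightarrow> \<tau> x = 0"
      using test_function_zero_outside[OF \<tau>] by metis
    obtain R' where R': "R' > 0" "\<And>x. norm x > R' \<Longrightarrow> partial 1 \<tau> x = 0"
      using test_function_zero_outside[OF p] by metis
    \<comment> \<open>The summand 1 makes \<tau> vanish at S and -S themselves, where the boundary
      terms are evaluated.\<close>
    define S where "S = max R R' + 1"
    have S: "S > 0" "\<And>x. norm x \<ge> S \<Longrightarrow> \<tau> x = 0" "\<And>x. norm x > S \<Longrightarrow> partial 1 \<tau> x = 0"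
      using R R' by (auto simp: S_def)
    have D\<tau>: "(\<tau> has_real_derivative partial 1 \<tau> x) (at x)" for x
    proof -
      have "frechet_derivative \<tau> (at x) v = partial 1 \<tau> x * v" for v
      proof -
        have "frechet_derivative \<tau> (at x) v = (\<Sum>i\<in>Basis. (v \<bullet> i) * partial i \<tau> x)"
          by (rule derivative_basis_expansion[OF test_function_differentiable[OF \<tau>]])
        also have "\<dots> = partial 1 \<tau> x * v" by simp
        finally show ?thesis .
      qed
      then have "frechet_derivative \<tau> (at x) = (*) (partial 1 \<tau> x)" by (rule ext)
      then show ?thesis
        using smooth_has_derivative[OF test_function_smooth[OF \<tau>], of x] by (simp only: has_field_derivative_def)
    qed
    have c1: "continuous_on UNIV (\<lambda>t. partial 1 \<tau> t * f t)" if "continuous_on UNIV f" for f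
      by (intro continuous_on_mult test_function_continuous[OF p] that)
    have c2: "continuous_on UNIV (\<lambda>t. \<tau> t * b t)"
      by (intro continuous_on_mult test_function_continuous[OF \<tau>] b)
    have i1: "integrable lborel (\<lambda>t. partial 1 \<tau> t * f t)" if "continuous_on UNIV f" for f
      by (rule integrable_zero_outside[OF c1[OF that], of S]) (use S in auto)
    have i2: "integrable lborel (\<lambda>t. \<tau> t * b t)"
      by (rule integrable_zero_outside[OF c2, of S]) (use S in auto)
    have "(\<integral>t. (partial 1 \<tau> t * B t + \<tau> t * b t) * indicator {- S..S} t \<partial>lborel) = \<tau> S * B S - \<tau> (- S) * B (- S)"
    proof (rule integral_FTC_Icc_real)
      show "- S \<le> S" using S by simp
      fix x
      show "((\<lambda>t. \<tau> t * B t) has_real_derivative partial 1 \<tau> x * B x + \<tau> x * b x) (at x)"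
        by (rule DERIV_cong[OF DERIV_mult[OF D\<tau> B]]) (simp add: mult.commute)
      show "isCont (\<lambda>t. partial 1 \<tau> t * B t + \<tau> t * b t) x"
        using continuous_on_add[OF c1[OF contB] c2] by (simp add: continuous_on_eq_continuous_at)
    qed
    also have "\<dots> = 0" using S by simp
    also have "(\<lambda>t. (partial 1 \<tau> t * B t + \<tau> t * b t) * indicator {- S..S} t) = (\<lambda>t. partial 1 \<tau> t * B t + \<tau> t * b t)"
    proof
      fix t :: real
      show "(partial 1 \<tau> t * B t + \<tau> t * b t) * indicator {- S..S} t = partial 1 \<tau> t * B t + \<tau> t * b t"
        using S by (cases "norm t \<le> S") (auto simp: indicator_def)
    qed
    finally have "(\<integral>t. partial 1 \<tau> t * B t + \<tau> t * b t \<partial>lborel) = 0" .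
    with weak[OF \<tau>] show ?thesis
      by (simp add: right_diff_distrib i1 i2 a contB)
  qed
  have const: "a x - B x = a y - B y" for x y
    using du_Bois_Reymond[OF continuous_on_diff[OF a contB] zero] .
  have "(\<lambda>x. B x + (a 0 - B 0)) = a"
  proof
    fix x show "B x + (a 0 - B 0) = a x" using const[of x 0] by linarith
  qed
  moreover have "((\<lambda>x. B x + (a 0 - B 0)) has_real_derivative b t) (at t)"
    by (rule DERIV_cong[OF DERIV_add[OF B DERIV_const]]) simp
  ultimately show ?thesis by (simp only:)
qed

lemma norm_Pair_le_sum: "norm (t, x) \<le> norm t + norm x"
  by (simp add: norm_Pair sqrt_sum_squares_le_sum)

lemma test_function_tensor:
  fixes \<tau> :: "real \<Rightarrow> real" and f :: "'a::euclidean_space \<Rightarrow> real"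
  assumes \<tau>: "\<tau> \<in> test_functions" and f: "f \<in> test_functions"
  shows "(\<lambda>p. \<tau> (fst p) * f (snd p)) \<in> test_functions"
proof -
  obtain R where R: "\<And>x. norm x > R \<Longrightarrow> \<tau> x = 0" using test_function_zero_outside[OF \<tau>] by metis
  obtain S where S: "\<And>x. norm x > S \<Longrightarrow> f x = 0" using test_function_zero_outside[OF f] by metis
  show ?thesis
  proof (rule test_functionsI[where R = "R + S"])
    show "smooth (\<lambda>p. \<tau> (fst p) * f (snd p))"
      by (intro smooth_mult smooth_compose_affine[OF test_function_smooth[OF \<tau>] bounded_linear_imp_has_derivative[OF bounded_linear_fst]]
          smooth_compose_affine[OF test_function_smooth[OF f] bounded_linear_imp_has_derivative[OF bounded_linear_snd]])
    fix p :: "real \<times> 'a" assume "norm p > R + S"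
    then have "norm (fst p) > R \<or> norm (snd p) > S"
      using norm_Pair_le_sum[of "fst p" "snd p"] by auto
    then show "\<tau> (fst p) * f (snd p) = 0" using R S by auto
  qed
qed

lemma inner_grad: "f differentiable at x \<Longrightarrow> v \<bullet> grad f x = frechet_derivative f (at x) v"
proof -
  assume "f differentiable at x"
  then interpret linear "frechet_derivative f (at x)" by (rule linear_frechet_derivative)
  have "v \<bullet> grad f x = (\<Sum>i\<in>UNIV. frechet_derivative f (at x) (v $ i *\<^sub>R axis i 1))"
    by (simp only: scale inner_vec_def grad_def vec_lambda_beta inner_real_def real_scaleR_def)
  also have "\<dots> = frechet_derivative f (at x) (\<Sum>i\<in>UNIV. v $ i *\<^sub>R axis i 1)"
    by (simp only: sum)
  also have "(\<Sum>i\<in>UNIV. v $ i *\<^sub>R axis i 1) = v"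
    using basis_expansion[of v] by (simp add: scalar_mult_eq_scaleR)
  finally show ?thesis .
qed

section \<open>Evolution of the pairing with a fixed spatial test function\<close>

context transport_curves
begin

definition advection :: "real \<Rightarrow> (real^2 \<Rightarrow> real) \<Rightarrow> real^2 \<Rightarrow> real" where
  "advection t f x = frechet_derivative f (at x) (u t x)"

lemma advection_expansion:
  "f \<in> test_functions \<Longrightarrow> advection t f x = (\<Sum>b\<in>Basis. (u t x \<bullet> b) * partial b f x)"
  unfolding advection_def
  by (intro derivative_basis_expansion smooth_differentiable test_function_smooth)

lemma continuous_u: "continuous_on S (u t)"
  using u unfolding C0_div_curve_def C0_div_def by (blast intro: continuous_on_subset)

lemma vanishing_advection:
  assumes f: "f \<in> test_functions"
  shows "vanishing (advection t f)"
proof -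
  have "vanishing (\<lambda>x. (u t x \<bullet> b) * partial b f x)" if b: "b \<in> Basis" for b
  proof -
    note p = test_function_partial[OF f b]
    obtain R where R: "\<And>x. norm x > R \<Longrightarrow> partial b f x = 0"
      using test_function_zero_outside[OF p] by blast
    show ?thesis
      by (rule vanishing_zero_outside[OF continuous_on_mult[OF
            continuous_on_inner[OF continuous_u continuous_on_const] test_function_continuous[OF p]], of R])
        (simp add: R)
  qed
  then have "vanishing (\<lambda>x. \<Sum>b\<in>Basis. (u t x \<bullet> b) * partial b f x)" by (rule vanishing_sum)
  then show ?thesis by (simp add: advection_expansion[OF f, abs_def])
qed

text \<open>The velocity converges uniformly in space and the gradient of \<open>f\<close> is
  bounded, so \<open>advection t f\<close> varies uniformly and the strong-weak pairing
  applies.\<close>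

lemma continuous_advection_integral:
  assumes f: "f \<in> test_functions"
  shows "continuous_on UNIV (\<lambda>t. signed_integral (q t) (advection t f))"
proof -
  have "((\<lambda>s. signed_integral (q s) (advection s f)) \<longlongrightarrow> signed_integral (q t) (advection t f)) (at t)" for t
  proof (rule measure_curve_tendsto[OF q vanishing_advection[OF f] _ vanishing_advection[OF f]])
    obtain B where B: "B \<ge> 0" "\<And>x v. \<bar>frechet_derivative f (at x) v\<bar> \<le> B * norm v"
      using test_function_derivative_bounded[OF f] by metis
    have diff: "advection s f x - advection t f x = frechet_derivative f (at x) (u s x - u t x)" for s x
      unfolding advection_def
      using linear_diff[OF linear_frechet_derivative[OF test_function_differentiable[OF f]]] by metis
    show "uniform_limit UNIV (\<lambda>s. advection s f) (advection t f) (at t)"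
      unfolding uniform_limit_iff
    proof (intro allI impI)
      fix e :: real assume e: "e > 0"
      have "\<forall>\<^sub>F s in at t. \<forall>x\<in>UNIV. dist (u s x) (u t x) < e / (B + 1)"
        using u e B unfolding C0_div_curve_def uniform_limit_iff by simp
      then show "\<forall>\<^sub>F s in at t. \<forall>x\<in>UNIV. dist (advection s f x) (advection t f x) < e"
      proof (rule eventually_mono, intro ballI)
        fix s x assume "\<forall>x\<in>UNIV. dist (u s x) (u t x) < e / (B + 1)"
        then have "norm (u s x - u t x) < e / (B + 1)" by (simp add: dist_norm)
        then have "norm (u s x - u t x) * (B + 1) < e" using B by (simp add: pos_less_divide_eq)
        moreover have "norm (u s x - u t x) * (B + 1) = B * norm (u s x - u t x) + norm (u s x - u t x)"
          by (simp add: algebra_simps)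
        ultimately have "B * norm (u s x - u t x) < e"
          using norm_ge_zero[of "u s x - u t x"] by linarith
        then show "dist (advection s f x) (advection t f x) < e"
          using B(2)[of x "u s x - u t x"] by (simp add: dist_real_def diff)
      qed
    qed
  qed
  then show ?thesis by (simp add: continuous_on_def)
qed

lemma transport_integrand_tensor:
  assumes \<tau>: "\<tau> \<in> test_functions" and f: "f \<in> test_functions"
  shows "transport_integrand u (\<lambda>p. \<tau> (fst p) * f (snd p)) t = (\<lambda>x. partial 1 \<tau> t * f x + \<tau> t * advection t f x)"
proof
  fix x :: "real^2"
  note s = smooth_has_derivative[OF test_function_smooth]
  have "((\<lambda>p. \<tau> (fst p)) has_derivative (\<lambda>v. frechet_derivative \<tau> (at t) (fst v))) (at (t, x))"
    by (rule has_derivative_compose[OF bounded_linear_imp_has_derivative[OF bounded_linear_fst]]) (simp add: s[OF \<tau>])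
  moreover have "((\<lambda>p. f (snd p)) has_derivative (\<lambda>v. frechet_derivative f (at x) (snd v))) (at (t, x))"
    by (rule has_derivative_compose[OF bounded_linear_imp_has_derivative[OF bounded_linear_snd]]) (simp add: s[OF f])
  ultimately have "((\<lambda>p. \<tau> (fst p) * f (snd p)) has_derivative
      (\<lambda>v. \<tau> t * frechet_derivative f (at x) (snd v) + frechet_derivative \<tau> (at t) (fst v) * f x)) (at (t, x))"
    using has_derivative_mult by fastforce
  from frechet_derivative_at[OF this, symmetric]
  show "transport_integrand u (\<lambda>p. \<tau> (fst p) * f (snd p)) t x = partial 1 \<tau> t * f x + \<tau> t * advection t f x"
    by (simp add: transport_integrand_eq test_function_smooth[OF test_function_tensor[OF \<tau> f]] advection_def)
qed

lemma test_function_vanishing: "f \<in> test_functions \<Longrightarrow> vanishing f"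
  using test_function_zero_outside vanishing_zero_outside test_function_continuous by metis

text \<open>Products of a time and a space test function reduce the space-time equation to a weak
  ordinary differential equation for the pairing; continuity of its right-hand side makes it
  classical.\<close>

lemma signed_integral_DERIV:
  assumes weak: "\<And>\<phi>. \<phi> \<in> test_functions \<Longrightarrow> w_ad u q \<phi> = 0" and f: "f \<in> test_functions"
  shows "((\<lambda>t. signed_integral (q t) f) has_real_derivative signed_integral (q t) (advection t f)) (at t)"
proof (rule antiderivative_of_weak_derivative)
  show "continuous_on UNIV (\<lambda>t. signed_integral (q t) f)"
    by (rule measure_curve_continuous[OF q test_function_vanishing[OF f]])
  show "continuous_on UNIV (\<lambda>t. signed_integral (q t) (advection t f))"
    by (rule continuous_advection_integral[OF f])
  fix \<tau> :: "real \<Rightarrow> real" assume \<tau>: "\<tau> \<in> test_functions"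
  have "partial 1 \<tau> t * signed_integral (q t) f + \<tau> t * signed_integral (q t) (advection t f)
      = signed_integral (q t) (transport_integrand u (\<lambda>p. \<tau> (fst p) * f (snd p)) t)" for t
    unfolding transport_integrand_tensor[OF \<tau> f]
    by (simp add: signed_integral_add signed_integral_scale measure_curve_integrable[OF q] vanishing_scale
        test_function_vanishing f vanishing_advection)
  then show "(\<integral>t. partial 1 \<tau> t * signed_integral (q t) f + \<tau> t * signed_integral (q t) (advection t f) \<partial>lborel) = 0"
    using weak[OF test_function_tensor[OF \<tau> f]] by (simp add: w_ad_def)
qed

end

section \<open>The commutator estimate\<close>

lemma continuous_derivative_along:
  fixes f :: "'a::euclidean_space \<Rightarrow> real"
  assumes f: "f \<in> test_functions" and "continuous_on UNIV g" "continuous_on UNIV v"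
  shows "continuous_on UNIV (\<lambda>z. frechet_derivative f (at (g z)) (v z))"
proof -
  have "continuous_on UNIV (\<lambda>z. partial b f (g z))" if "b \<in> Basis" for b
    by (intro continuous_on_compose2[OF test_function_continuous[OF test_function_partial[OF f that], of UNIV]] assms) auto
  then have "continuous_on UNIV (\<lambda>z. \<Sum>b\<in>Basis. (v z \<bullet> b) * partial b f (g z))"
    by (intro continuous_on_sum continuous_on_mult continuous_on_inner assms continuous_on_const)
  also have "(\<lambda>z. \<Sum>b\<in>Basis. (v z \<bullet> b) * partial b f (g z)) = (\<lambda>z. frechet_derivative f (at (g z)) (v z))"
    by (rule ext, rule derivative_basis_expansion[OF test_function_differentiable[OF f], symmetric])
  finally show ?thesis .
qed

lemma derivative_zero_outside:
  fixes f :: "'a::euclidean_space \<Rightarrow> real"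
  assumes "f \<in> test_functions"
  obtains R where "R > 0" "\<And>x v. norm x > R \<Longrightarrow> frechet_derivative f (at x) v = 0"
proof -
  have "bounded (supp f)" using assms by (simp add: test_functions_def compact_imp_bounded)
  then obtain R where R: "R > 0" "\<And>x. x \<in> supp f \<Longrightarrow> norm x \<le> R"
    by (auto simp: bounded_pos)
  show ?thesis
    by (rule that[OF R(1)]) (use R(2) partial_outside_supp in \<open>force simp: not_le[symmetric]\<close>)
qed

text \<open>In the product rule the increment of \<Phi> is tested against the moving measure
  \<open>q s\<close> and that of the measure against the fixed \<open>\<Phi> t\<close>. The first
  limit is a strong-weak pairing, hence the uniform convergence of the difference quotients.\<close>

lemma signed_integral_product_DERIV:
  assumes q: "measure_curve q" and \<Phi>: "\<And>s. vanishing (\<Phi> s)" and \<Phi>': "vanishing \<Phi>'"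
    and lim: "uniform_limit UNIV (\<lambda>s x. (\<Phi> s x - \<Phi> t x) / (s - t)) \<Phi>' (at t)"
    and D: "((\<lambda>s. signed_integral (q s) (\<Phi> t)) has_real_derivative D) (at t)"
  shows "((\<lambda>s. signed_integral (q s) (\<Phi> s)) has_real_derivative signed_integral (q t) \<Phi>' + D) (at t)"
  unfolding has_field_derivative_iff
proof -
  have "((\<lambda>s. signed_integral (q s) (\<lambda>x. (\<Phi> s x - \<Phi> t x) / (s - t))) \<longlongrightarrow> signed_integral (q t) \<Phi>') (at t)"
    using vanishing_scale[OF vanishing_diff[OF \<Phi> \<Phi>], of "inverse (_ - t)" _ t]
    by (intro measure_curve_tendsto[OF q _ lim \<Phi>']) (simp add: divide_inverse mult.commute)
  moreover have "signed_integral (q s) (\<lambda>x. (\<Phi> s x - \<Phi> t x) / (s - t))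
      = (signed_integral (q s) (\<Phi> s) - signed_integral (q s) (\<Phi> t)) / (s - t)" for s
    using signed_integral_scale[of "q s" "inverse (s - t)" "\<lambda>x. \<Phi> s x - \<Phi> t x"]
    by (simp add: signed_integral_diff measure_curve_integrable[OF q] \<Phi> divide_inverse mult.commute)
  ultimately have "((\<lambda>s. (signed_integral (q s) (\<Phi> s) - signed_integral (q s) (\<Phi> t)) / (s - t)
      + (signed_integral (q s) (\<Phi> t) - signed_integral (q t) (\<Phi> t)) / (s - t)) \<longlongrightarrow> signed_integral (q t) \<Phi>' + D) (at t)"
    using D by (intro tendsto_add) (simp_all add: has_field_derivative_iff)
  then show "((\<lambda>s. (signed_integral (q s) (\<Phi> s) - signed_integral (q t) (\<Phi> t)) / (s - t)) \<longlongrightarrow> signed_integral (q t) \<Phi>' + D) (at t)"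
    by (simp add: diff_divide_distrib)
qed

section \<open>The mollified transported function and its commutator\<close>

context blob_solution
begin

sublocale transport_curves u q
  by unfold_locales (rule C0_div_curve_u measure_curve_q)+

lemma flow_integral:
  fixes f :: "real^2 \<Rightarrow> real"
  assumes "f \<in> borel_measurable borel"
  shows "(\<integral>z. f (\<eta> t z) \<partial>lborel) = (\<integral>y. f y \<partial>lborel)"
proof -
  have "(\<integral>y. f y \<partial>distr lborel borel (\<eta> t)) = (\<integral>z. f (\<eta> t z) \<partial>lborel)"
    using homeomorphism_inv_facts(2)[OF flow_homeomorphism] assms by (intro integral_distr) auto
  then show ?thesis by (simp add: flow_preserving)
qed

definition mollified :: "(real^2 \<Rightarrow> real) \<Rightarrow> (real^2 \<Rightarrow> real) \<Rightarrow> real \<Rightarrow> real^2 \<Rightarrow> real" where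
  "mollified \<rho> \<psi> t = transported_mollification \<rho> (\<eta> t) \<psi>"

text \<open>The time derivative of \<open>mollified\<close> at fixed \<open>x\<close>, by the chain
  rule along trajectories; the sign comes from the argument x - \<eta> t z.\<close>

definition mollified_deriv :: "(real^2 \<Rightarrow> real) \<Rightarrow> (real^2 \<Rightarrow> real) \<Rightarrow> real \<Rightarrow> real^2 \<Rightarrow> real" where
  "mollified_deriv \<rho> \<psi> t x = - (\<integral>z. frechet_derivative \<rho> (at (x - \<eta> t z)) (u t (\<eta> t z)) * \<psi> z \<partial>lborel)"

lemma test_function_mollified:
  assumes "\<rho> \<in> test_functions" "continuous_on UNIV \<psi>" "\<And>z. norm z > R \<Longrightarrow> \<psi> z = 0"
  shows "mollified \<rho> \<psi> t \<in> test_functions"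
  unfolding mollified_def by (rule test_function_transported_mollification[OF assms(1) flow_continuous(1) assms(2,3)])

lemma continuous_u_flow: "continuous_on UNIV (\<lambda>z. u t (\<eta> t z))"
  by (rule continuous_on_compose2[OF continuous_u flow_continuous(1)]) auto

lemma integrable_derivative_flow:
  assumes \<rho>: "\<rho> \<in> test_functions" and \<psi>: "continuous_on UNIV \<psi>" "\<And>z. norm z > R \<Longrightarrow> \<psi> z = 0"
    and v: "continuous_on UNIV v"
  shows "integrable lborel (\<lambda>z. frechet_derivative \<rho> (at (x - \<eta> t z)) (v z) * \<psi> z)"
  by (rule integrable_zero_outside[of _ R])
    (auto intro!: continuous_on_mult continuous_derivative_along \<rho> v \<psi>(1) continuous_on_diff continuous_on_const
       flow_continuous simp: \<psi>(2))

text \<open>Expanded in coordinates it is a finite combination of transported mollifications, with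
  weights formed from the velocity along the flow and \<psi>, hence even a test function.\<close>

lemma vanishing_mollified_deriv:
  assumes \<rho>: "\<rho> \<in> test_functions" and \<psi>: "continuous_on UNIV \<psi>" "\<And>z. norm z > R \<Longrightarrow> \<psi> z = 0"
  shows "vanishing (mollified_deriv \<rho> \<psi> t)"
proof -
  let ?w = "\<lambda>b z. (u t (\<eta> t z) \<bullet> b) * \<psi> z"
  have cw: "continuous_on UNIV (?w b)" for b
    by (intro continuous_on_mult continuous_on_inner continuous_u_flow continuous_on_const \<psi>(1))
  have out: "?w b z = 0" if "norm z > R" for b z using \<psi>(2)[OF that] by simp
  note tf = test_function_partial[OF \<rho>]
  have "mollified_deriv \<rho> \<psi> t x = (-1) * (\<Sum>b\<in>Basis. transported_mollification (partial b \<rho>) (\<eta> t) (?w b) x)" for x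
  proof -
    have "(\<Sum>b\<in>Basis. transported_mollification (partial b \<rho>) (\<eta> t) (?w b) x)
        = (\<integral>z. (\<Sum>b\<in>Basis. partial b \<rho> (x - \<eta> t z) * ?w b z) \<partial>lborel)"
      unfolding transported_mollification_def
      by (rule Bochner_Integration.integral_sum[symmetric])
        (rule integrable_transported_mollification[OF test_function_continuous[OF tf] flow_continuous(1) cw out])
    also have "(\<lambda>z. \<Sum>b\<in>Basis. partial b \<rho> (x - \<eta> t z) * ?w b z)
        = (\<lambda>z. frechet_derivative \<rho> (at (x - \<eta> t z)) (u t (\<eta> t z)) * \<psi> z)"
    proof
      fix z
      show "(\<Sum>b\<in>Basis. partial b \<rho> (x - \<eta> t z) * ?w b z) = frechet_derivative \<rho> (at (x - \<eta> t z)) (u t (\<eta> t z)) * \<psi> z"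
        unfolding derivative_basis_expansion[OF test_function_differentiable[OF \<rho>], of _ "u t (\<eta> t z)"]
          sum_distrib_right
        by (intro sum.cong refl) (simp only: mult_ac)
    qed
    finally show ?thesis by (simp add: mollified_deriv_def)
  qed
  then have eq: "mollified_deriv \<rho> \<psi> t = (\<lambda>x. (-1) * (\<Sum>b\<in>Basis. transported_mollification (partial b \<rho>) (\<eta> t) (?w b) x))"
    by (rule ext)
  show ?thesis unfolding eq
    by (intro vanishing_scale vanishing_sum test_function_vanishing
        test_function_transported_mollification[OF tf flow_continuous(1) cw out])
qed

text \<open>Convergence must be uniform in \<open>x\<close> because the quotients are paired with
  measures. Both error sources allow it: the difference quotients of the flow converge uniformly in
  space, and the Taylor remainder of \<rho> does not depend on the base point.\<close>

lemma mollified_uniform_derivative: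
  assumes \<rho>: "\<rho> \<in> test_functions" and \<psi>: "continuous_on UNIV \<psi>" "\<And>z. norm z > R \<Longrightarrow> \<psi> z = 0"
  shows "uniform_limit UNIV (\<lambda>s x. (mollified \<rho> \<psi> s x - mollified \<rho> \<psi> t x) / (s - t)) (mollified_deriv \<rho> \<psi> t) (at t)"
  unfolding uniform_limit_iff
proof (intro allI impI)
  fix e :: real assume e: "e > 0"
  obtain L where L: "L \<ge> 0" "\<And>x v. \<bar>\<rho> (x + v) - \<rho> x - frechet_derivative \<rho> (at x) v\<bar> \<le> L * (norm v)\<^sup>2"
    using test_function_Taylor[OF \<rho>] by metis
  obtain B where B: "B \<ge> 0" "\<And>x v. \<bar>frechet_derivative \<rho> (at x) v\<bar> \<le> B * norm v"
    using test_function_derivative_bounded[OF \<rho>] by metis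
  obtain C where C: "C \<ge> 0" "\<And>x. norm (u t x) \<le> C"
    using velocity_bounds[of "\<bar>t\<bar>"] by (metis order_refl)
  define M where "M = (\<integral>z. \<bar>\<psi> z\<bar> \<partial>lborel)"
  have M: "M \<ge> 0" by (simp add: M_def)
  have int\<psi>: "integrable lborel (\<lambda>z. \<bar>\<psi> z\<bar>)"
    by (intro integrable_abs integrable_zero_outside[OF \<psi>])
  \<comment> \<open>\<open>e1\<close> is the tolerance for the flow quotients and \<open>d\<close>
    the one for the time step; each accounts for less than e / 2. The cap 1 keeps the quotients
    below C + 1.\<close>
  define e1 where "e1 = min 1 (e / (2 * (B * M + 1)))"
  define d where "d = e / (2 * (L * (C + 1)\<^sup>2 * M + 1))"
  have BM: "B * M + 1 > 0" "L * (C + 1)\<^sup>2 * M + 1 > 0"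
    using B L M by (auto intro!: add_nonneg_pos mult_nonneg_nonneg)
  have e1: "e1 > 0" "e1 \<le> 1" and d: "d > 0" using e BM by (auto simp: e1_def d_def)
  have small: "(B * e1) * M < e / 2" "L * (C + 1)\<^sup>2 * M * d < e / 2"
  proof -
    have "(B * M) * e1 \<le> (B * M) * (e / (2 * (B * M + 1)))"
      using B M by (intro mult_left_mono) (auto simp: e1_def)
    also have "\<dots> < e / 2" using e BM(1) by (simp add: field_simps)
    finally show "(B * e1) * M < e / 2" by (simp add: mult_ac)
    show "L * (C + 1)\<^sup>2 * M * d < e / 2" using e BM(2) by (simp add: d_def field_simps)
  qed
  have "\<forall>\<^sub>F h in at 0. \<forall>x\<in>UNIV. dist ((\<eta> (t + h) x - \<eta> t x) /\<^sub>R h) ((u t \<circ> \<eta> t) x) < e1"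
    using flow_difference_quotient[of t] e1 unfolding uniform_limit_iff by blast
  then obtain d' where d': "d' > 0" "\<And>h x. h \<noteq> 0 \<Longrightarrow> \<bar>h\<bar> < d' \<Longrightarrow>
      norm ((\<eta> (t + h) x - \<eta> t x) /\<^sub>R h - u t (\<eta> t x)) < e1"
    unfolding eventually_at by (auto simp: dist_norm)
  have main: "dist ((mollified \<rho> \<psi> s x - mollified \<rho> \<psi> t x) / (s - t)) (mollified_deriv \<rho> \<psi> t x) < e"
    if s: "s \<noteq> t" "\<bar>s - t\<bar> < min d d'" for s x
  proof -
    define h where "h = s - t"
    have h: "h \<noteq> 0" "\<bar>h\<bar> < d" "\<bar>h\<bar> < d'" "s = t + h" using s by (auto simp: h_def)
    let ?D = "\<lambda>z v. frechet_derivative \<rho> (at (x - \<eta> t z)) v"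
    let ?V = "\<lambda>z. u t (\<eta> t z)"
    let ?r = "\<lambda>z. (\<rho> (x - \<eta> s z) * \<psi> z - \<rho> (x - \<eta> t z) * \<psi> z) / h + ?D z (?V z) * \<psi> z"
    have i12: "integrable lborel (\<lambda>z. \<rho> (x - \<eta> r z) * \<psi> z)" for r
      by (rule integrable_transported_mollification[OF test_function_continuous[OF \<rho>] flow_continuous(1) \<psi>])
    have i3: "integrable lborel (\<lambda>z. ?D z (?V z) * \<psi> z)"
      by (rule integrable_derivative_flow[OF \<rho> \<psi> continuous_u_flow])
    have ir: "integrable lborel ?r"
      by (intro Bochner_Integration.integrable_add integrable_divide Bochner_Integration.integrable_diff i12 i3)
    have eq: "(mollified \<rho> \<psi> s x - mollified \<rho> \<psi> t x) / h - mollified_deriv \<rho> \<psi> t x = (\<integral>z. ?r z \<partial>lborel)"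
      unfolding mollified_def transported_mollification_def mollified_deriv_def using i12 i3 by simp
    have "\<bar>(mollified \<rho> \<psi> s x - mollified \<rho> \<psi> t x) / h - mollified_deriv \<rho> \<psi> t x\<bar>
        \<le> (\<integral>z. (B * e1 + L * \<bar>h\<bar> * (C + 1)\<^sup>2) * \<bar>\<psi> z\<bar> \<partial>lborel)"
      unfolding eq
    proof (rule order_trans[OF integral_abs_bound integral_mono])
      show "integrable lborel (\<lambda>z. \<bar>?r z\<bar>)" by (rule integrable_abs[OF ir])
      show "integrable lborel (\<lambda>z. (B * e1 + L * \<bar>h\<bar> * (C + 1)\<^sup>2) * \<bar>\<psi> z\<bar>)"
        by (intro integrable_mult_right int\<psi>)
      fix z
      \<comment> \<open>Increment of the argument of \<rho>: x - \<eta> s z = (x - \<eta> t z) + k.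
        As k / h is close to minus the velocity, its sum with the velocity is the small
        quantity.\<close>
      define k where "k = \<eta> t z - \<eta> s z"
      interpret D: linear "?D z"
        by (rule linear_frechet_derivative[OF test_function_differentiable[OF \<rho>]])
      have q1: "norm (k /\<^sub>R h + ?V z) \<le> e1"
        using d'(2)[OF h(1,3), of z] unfolding k_def h(4)
        by (metis (no_types, lifting) add_uminus_conv_diff add.commute less_imp_le minus_diff_eq norm_minus_cancel scaleR_minus_right uminus_add_conv_diff)
      have "norm (k /\<^sub>R h) \<le> norm (k /\<^sub>R h + ?V z) + norm (?V z)"
        by (metis add_diff_cancel norm_triangle_ineq4)
      also have "\<dots> \<le> C + 1" using q1 e1 C(2)[of "\<eta> t z"] by linarith
      finally have "norm k \<le> \<bar>h\<bar> * (C + 1)"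
        using h(1) by (simp add: field_simps)
      then have k2: "(norm k)\<^sup>2 \<le> (\<bar>h\<bar> * (C + 1))\<^sup>2" by (intro power_mono) auto
      have "\<bar>\<rho> ((x - \<eta> t z) + k) - \<rho> (x - \<eta> t z) - ?D z k\<bar> \<le> L * (norm k)\<^sup>2" by (rule L(2))
      also have "\<dots> \<le> L * (\<bar>h\<bar> * (C + 1))\<^sup>2" using L(1) k2 by (intro mult_left_mono)
      finally have "\<bar>(\<rho> (x - \<eta> s z) - \<rho> (x - \<eta> t z) - ?D z k) / h\<bar> \<le> L * (\<bar>h\<bar> * (C + 1))\<^sup>2 / \<bar>h\<bar>"
        unfolding abs_divide by (intro divide_right_mono) (simp_all add: k_def)
      also have "\<dots> = L * \<bar>h\<bar> * (C + 1)\<^sup>2" using h(1) by (simp add: power2_eq_square)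
      finally have b1: "\<bar>(\<rho> (x - \<eta> s z) - \<rho> (x - \<eta> t z) - ?D z k) / h\<bar> \<le> L * \<bar>h\<bar> * (C + 1)\<^sup>2" .
      have "\<bar>?D z (k /\<^sub>R h + ?V z)\<bar> \<le> B * norm (k /\<^sub>R h + ?V z)" by (rule B(2))
      also have "\<dots> \<le> B * e1" using q1 B(1) by (intro mult_left_mono)
      finally have b2: "\<bar>?D z (k /\<^sub>R h + ?V z)\<bar> \<le> B * e1" .
      have "?D z (k /\<^sub>R h + ?V z) = ?D z k / h + ?D z (?V z)"
        by (simp add: D.add D.scale divide_inverse mult.commute)
      then have "?r z = ((\<rho> (x - \<eta> s z) - \<rho> (x - \<eta> t z) - ?D z k) / h + ?D z (k /\<^sub>R h + ?V z)) * \<psi> z"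
        using h(1) by (simp add: field_simps)
      moreover have "\<bar>(\<rho> (x - \<eta> s z) - \<rho> (x - \<eta> t z) - ?D z k) / h + ?D z (k /\<^sub>R h + ?V z)\<bar>
          \<le> B * e1 + L * \<bar>h\<bar> * (C + 1)\<^sup>2"
        using b1 b2 by linarith
      ultimately show "\<bar>?r z\<bar> \<le> (B * e1 + L * \<bar>h\<bar> * (C + 1)\<^sup>2) * \<bar>\<psi> z\<bar>"
        by (simp only: abs_mult mult_right_mono abs_ge_zero)
    qed
    also have "\<dots> = (B * e1) * M + L * (C + 1)\<^sup>2 * M * \<bar>h\<bar>"
      by (subst integral_mult_right_zero) (simp add: M_def algebra_simps)
    also have "\<dots> \<le> (B * e1) * M + L * (C + 1)\<^sup>2 * M * d"
      using h L M by (intro add_left_mono mult_left_mono) auto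
    also have "\<dots> < e" using small by linarith
    finally show ?thesis by (simp add: dist_real_def h_def)
  qed
  show "\<forall>\<^sub>F s in at t. \<forall>x\<in>UNIV. dist ((mollified \<rho> \<psi> s x - mollified \<rho> \<psi> t x) / (s - t)) (mollified_deriv \<rho> \<psi> t x) < e"
    unfolding eventually_at using main d d'(1)
    by (intro exI[of _ "min d d'"]) (auto simp: dist_real_def)
qed

lemma mollified_DERIV:
  assumes \<rho>: "\<rho> \<in> test_functions" and \<psi>: "continuous_on UNIV \<psi>" "\<And>z. norm z > R \<Longrightarrow> \<psi> z = 0"
  shows "((\<lambda>t. signed_integral (q t) (mollified \<rho> \<psi> t)) has_real_derivative
    signed_integral (q t) (\<lambda>x. mollified_deriv \<rho> \<psi> t x + advection t (mollified \<rho> \<psi> t) x)) (at t)"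
proof -
  have m: "mollified \<rho> \<psi> t \<in> test_functions" for t
    by (rule test_function_mollified[OF \<rho> \<psi>])
  have "((\<lambda>s. signed_integral (q s) (mollified \<rho> \<psi> s)) has_real_derivative
      signed_integral (q t) (mollified_deriv \<rho> \<psi> t) + signed_integral (q t) (advection t (mollified \<rho> \<psi> t))) (at t)"
    by (rule signed_integral_product_DERIV[OF measure_curve_q test_function_vanishing[OF m]
          vanishing_mollified_deriv[OF \<rho> \<psi>] mollified_uniform_derivative[OF \<rho> \<psi>] signed_integral_DERIV[OF w_ad_zero m]])
  then show ?thesis
    by (simp add: signed_integral_add measure_curve_integrable[OF measure_curve_q]
        vanishing_mollified_deriv[OF \<rho> \<psi>] vanishing_advection[OF m])
qed

text \<open>Both terms are integrals over starting points against the same weight \<psi>, so the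
  velocities subtract under the derivative of \<rho>; the change of variables y = \<eta> t z has no
  Jacobian.\<close>

lemma commutator_eq:
  assumes \<rho>: "\<rho> \<in> test_functions" and \<psi>: "continuous_on UNIV \<psi>" "\<And>z. norm z > R \<Longrightarrow> \<psi> z = 0"
  shows "mollified_deriv \<rho> \<psi> t x + advection t (mollified \<rho> \<psi> t) x
    = (\<integral>y. frechet_derivative \<rho> (at (x - y)) (u t x - u t y) * \<psi> (inv (\<eta> t) y) \<partial>lborel)"
proof -
  let ?D = "\<lambda>z v. frechet_derivative \<rho> (at (x - \<eta> t z)) v"
  have m: "mollified \<rho> \<psi> t \<in> test_functions" by (rule test_function_mollified[OF \<rho> \<psi>])
  note tf = test_function_partial[OF \<rho>]
  note expand = derivative_basis_expansion[OF test_function_differentiable[OF \<rho>]]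
  have i1: "integrable lborel (\<lambda>z. ?D z (u t (\<eta> t z)) * \<psi> z)"
    by (rule integrable_derivative_flow[OF \<rho> \<psi> continuous_u_flow])
  have i2: "integrable lborel (\<lambda>z. ?D z (u t x) * \<psi> z)"
    by (rule integrable_derivative_flow[OF \<rho> \<psi> continuous_on_const])
  have "advection t (mollified \<rho> \<psi> t) x
      = (\<Sum>b\<in>Basis. (u t x \<bullet> b) * transported_mollification (partial b \<rho>) (\<eta> t) \<psi> x)"
    unfolding advection_expansion[OF m] unfolding mollified_def
    by (intro sum.cong refl) (simp add: fun_cong[OF partial_transported_mollification[OF \<rho> flow_continuous(1) \<psi>]])
  also have "\<dots> = (\<Sum>b\<in>Basis. \<integral>z. (u t x \<bullet> b) * (partial b \<rho> (x - \<eta> t z) * \<psi> z) \<partial>lborel)"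
    unfolding transported_mollification_def by simp
  also have "\<dots> = (\<integral>z. (\<Sum>b\<in>Basis. (u t x \<bullet> b) * (partial b \<rho> (x - \<eta> t z) * \<psi> z)) \<partial>lborel)"
    by (rule Bochner_Integration.integral_sum[symmetric], rule integrable_mult_right)
      (rule integrable_transported_mollification[OF test_function_continuous[OF tf] flow_continuous(1) \<psi>])
  also have "\<dots> = (\<integral>z. ?D z (u t x) * \<psi> z \<partial>lborel)"
    unfolding expand[of _ "u t x"] sum_distrib_right by (simp only: mult.assoc)
  finally have "mollified_deriv \<rho> \<psi> t x + advection t (mollified \<rho> \<psi> t) x
      = (\<integral>z. ?D z (u t x) * \<psi> z - ?D z (u t (\<eta> t z)) * \<psi> z \<partial>lborel)"
    using i1 i2 by (simp add: mollified_deriv_def)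
  \<comment> \<open>Writing \<open>z\<close> as \<open>inv (\<eta> t) (\<eta> t z)\<close> makes the
    integrand a function of \<open>\<eta> t z\<close> alone.\<close>
  also have "\<dots> = (\<integral>z. ?D z (u t x - u t (\<eta> t z)) * \<psi> (inv (\<eta> t) (\<eta> t z)) \<partial>lborel)"
    by (simp add: linear_diff[OF linear_frechet_derivative[OF test_function_differentiable[OF \<rho>]]]
        flow_inverse left_diff_distrib)
  also have "\<dots> = (\<integral>y. frechet_derivative \<rho> (at (x - y)) (u t x - u t y) * \<psi> (inv (\<eta> t) y) \<partial>lborel)"
  proof (rule flow_integral)
    show "(\<lambda>y. frechet_derivative \<rho> (at (x - y)) (u t x - u t y) * \<psi> (inv (\<eta> t) y)) \<in> borel_measurable borel"
      by (intro borel_measurable_continuous_onI continuous_on_mult continuous_derivative_along \<rho>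
          continuous_intros continuous_u continuous_on_compose2[OF \<psi>(1) flow_continuous(2)]) auto
  qed
  finally show ?thesis .
qed

text \<open>This allows subtracting the constant \<open>\<psi> (inv (\<eta> t) x)\<close> from \<open>\<psi> \<circ> inv (\<eta> t)\<close> in the commutator.\<close>

lemma integral_divergence_free:
  assumes \<rho>: "\<rho> \<in> test_functions"
  shows "integrable lborel (\<lambda>y. frechet_derivative \<rho> (at (x - y)) (u t x - u t y))"
    "(\<integral>y. frechet_derivative \<rho> (at (x - y)) (u t x - u t y) \<partial>lborel) = 0"
proof -
  let ?D = "\<lambda>y v. frechet_derivative \<rho> (at (x - y)) v"
  obtain R where R: "R > 0" "\<And>x v. norm x > R \<Longrightarrow> frechet_derivative \<rho> (at x) v = 0"
    using derivative_zero_outside[OF \<rho>] by metis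
  have out: "?D y v = 0" if "norm y > norm x + R" for y v
    by (rule R(2)) (use that norm_triangle_sub[of y x] in \<open>simp add: norm_minus_commute\<close>)
  have int: "integrable lborel (\<lambda>y. ?D y (v y))" if "continuous_on UNIV v" for v
    by (rule integrable_zero_outside[of _ "norm x + R"])
      (intro continuous_derivative_along \<rho> continuous_intros that, rule out)
  have lin: "linear (?D y)" for y
    by (rule linear_frechet_derivative[OF test_function_differentiable[OF \<rho>]])
  have diff: "?D y (u t x - u t y) = ?D y (u t x) - ?D y (u t y)" for y by (rule linear_diff[OF lin])
  show "integrable lborel (\<lambda>y. ?D y (u t x - u t y))"
    by (intro int continuous_intros continuous_u)
  \<comment> \<open>The part with u t x: a constant vector against a gradient with zero
    integral.\<close>
  have "(\<integral>y. partial b \<rho> (x - y) \<partial>lborel) = 0" if "b \<in> Basis" for b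
    using lborel_integral_affine[OF test_function_measurable[OF test_function_partial[OF \<rho> that]], of "-1" x]
      integral_partial_test_function[OF \<rho> that] by simp
  moreover have "(\<integral>y. ?D y (u t x) \<partial>lborel) = (\<Sum>b\<in>Basis. \<integral>y. (u t x \<bullet> b) * partial b \<rho> (x - y) \<partial>lborel)"
    unfolding derivative_basis_expansion[OF test_function_differentiable[OF \<rho>], of _ "u t x"]
    by (rule Bochner_Integration.integral_sum, rule integrable_mult_right) (rule int[OF continuous_on_const])
  ultimately have 1: "(\<integral>y. ?D y (u t x) \<partial>lborel) = 0" by simp
  have A: "((\<lambda>y. x - y) has_derivative (\<lambda>v. - v)) (at y)" for y
    by (auto intro!: derivative_eq_intros)
  obtain S where S: "\<And>x. norm x > S \<Longrightarrow> \<rho> x = 0" using test_function_zero_outside[OF \<rho>] by metis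
  \<comment> \<open>The part with u t y: the reflected, translated \<rho> is admissible in the weak
    divergence condition.\<close>
  have "(\<lambda>y. \<rho> (x - y)) \<in> test_functions"
  proof (rule test_functionsI)
    show "smooth (\<lambda>y. \<rho> (x - y))"
      by (rule smooth_compose_affine[OF test_function_smooth[OF \<rho>] A])
    show "\<rho> (x - y) = 0" if "norm y > norm x + S" for y
      by (rule S) (use that norm_triangle_sub[of y x] in \<open>simp add: norm_minus_commute\<close>)
  qed
  then have "(\<integral>y. u t y \<bullet> grad (\<lambda>y. \<rho> (x - y)) y \<partial>lborel) = 0"
    using u by (simp add: C0_div_curve_def C0_div_def)
  moreover have "u t y \<bullet> grad (\<lambda>y. \<rho> (x - y)) y = - ?D y (u t y)" for y
  proof -
    have D: "((\<lambda>y. \<rho> (x - y)) has_derivative (\<lambda>v. ?D y (- v))) (at y)"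
      by (rule has_derivative_compose[OF A test_function_has_derivative[OF \<rho>]])
    then show ?thesis
      by (subst inner_grad) (auto simp: differentiable_def frechet_derivative_at[OF D, symmetric] linear_neg[OF lin])
  qed
  ultimately have 2: "(\<integral>y. ?D y (u t y) \<partial>lborel) = 0" by simp
  show "(\<integral>y. ?D y (u t x - u t y) \<partial>lborel) = 0"
    unfolding diff using 1 2 by (simp add: int continuous_u)
qed

text \<open>On the support of the mollifier |x - y| \<le> \<epsilon>, and this factor cancels the 1
  / \<epsilon> from the integrated gradient. What remains is \<open>e\<close> times a constant of
  the bump alone.\<close>

lemma commutator_bound:
  assumes \<psi>: "continuous_on UNIV \<psi>" "\<And>z. norm z > R \<Longrightarrow> \<psi> z = 0" and \<epsilon>: "\<epsilon> > 0" and e: "e \<ge> 0"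
    and modulus: "\<And>y. norm (x - y) \<le> \<epsilon> \<Longrightarrow>
      norm (u t x - u t y) * \<bar>\<psi> (inv (\<eta> t) x) - \<psi> (inv (\<eta> t) y)\<bar> \<le> e * norm (x - y)"
  shows "\<bar>mollified_deriv (mollifier \<epsilon>) \<psi> t x + advection t (mollified (mollifier \<epsilon>) \<psi> t) x\<bar>
    \<le> e * (\<Sum>b\<in>(Basis :: (real^2) set). (\<integral>x. \<bar>partial b bump x\<bar> \<partial>lborel) / (\<integral>x. bump x \<partial>(lborel :: (real^2) measure)))"
proof -
  let ?\<rho> = "mollifier \<epsilon> :: real^2 \<Rightarrow> real"
  have \<rho>: "?\<rho> \<in> test_functions" by (rule test_function_mollifier[OF \<epsilon>])
  let ?g = "\<lambda>y. frechet_derivative ?\<rho> (at (x - y)) (u t x - u t y)"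
  let ?c = "\<psi> (inv (\<eta> t) x)"
  let ?S = "\<lambda>y. \<Sum>b\<in>Basis. \<bar>partial b ?\<rho> y\<bar>"
  have gint: "integrable lborel ?g" "(\<integral>y. ?g y \<partial>lborel) = 0"
    by (rule integral_divergence_free[OF \<rho>])+
  have c\<psi>: "continuous_on UNIV (\<lambda>y. \<psi> (inv (\<eta> t) y))"
    by (rule continuous_on_compose2[OF \<psi>(1) flow_continuous(2)]) auto
  have supp\<rho>: "supp ?\<rho> \<subseteq> cball 0 \<epsilon>"
    unfolding supp_def
  proof (intro closure_minimal subsetI)
    fix y :: "real^2" assume "y \<in> {y. ?\<rho> y \<noteq> 0}"
    then show "y \<in> cball 0 \<epsilon>" using mollifier_zero_outside[OF \<epsilon>, of y] by (cases "\<epsilon> \<le> norm y") auto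
  qed simp
  have Dzero: "frechet_derivative ?\<rho> (at (x - y)) v = 0" if "norm (x - y) > \<epsilon>" for y v
    by (rule partial_outside_supp) (use supp\<rho> that in auto)
  have igp: "integrable lborel (\<lambda>y. ?g y * \<psi> (inv (\<eta> t) y))"
  proof (rule integrable_zero_outside[of _ "norm x + \<epsilon>"])
    show "continuous_on UNIV (\<lambda>y. ?g y * \<psi> (inv (\<eta> t) y))"
      by (intro continuous_on_mult c\<psi> continuous_derivative_along \<rho> continuous_intros continuous_u)
    show "?g y * \<psi> (inv (\<eta> t) y) = 0" if "norm y > norm x + \<epsilon>" for y
      using Dzero[of y] that norm_triangle_sub[of y x] by (simp add: norm_minus_commute)
  qed
  have iS: "integrable lborel (\<lambda>y. \<bar>partial b ?\<rho> y\<bar>)" if "b \<in> Basis" for b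
    by (intro integrable_abs test_function_integrable test_function_partial \<rho> that)
  have mS: "?S \<in> borel_measurable borel"
    by (intro borel_measurable_sum borel_measurable_abs test_function_measurable test_function_partial \<rho>)
  have iSx: "integrable lborel (\<lambda>y. ?S (x - y))"
  proof (rule integrable_zero_outside[of _ "norm x + \<epsilon>"])
    show "continuous_on UNIV (\<lambda>y. ?S (x - y))"
      by (intro continuous_on_sum continuous_on_rabs continuous_on_compose2[OF test_function_continuous[OF test_function_partial[OF \<rho>], of _ UNIV]]
          continuous_intros) auto
    show "?S (x - y) = 0" if "norm y > norm x + \<epsilon>" for y
      using Dzero[of y] that norm_triangle_sub[of y x] by (simp add: norm_minus_commute)
  qed
  have "mollified_deriv ?\<rho> \<psi> t x + advection t (mollified ?\<rho> \<psi> t) x = (\<integral>y. ?g y * \<psi> (inv (\<eta> t) y) \<partial>lborel)"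
    by (rule commutator_eq[OF \<rho> \<psi>])
  also have "\<dots> = (\<integral>y. ?g y * \<psi> (inv (\<eta> t) y) - ?g y * ?c \<partial>lborel)"
    using igp gint by simp
  finally have eq: "mollified_deriv ?\<rho> \<psi> t x + advection t (mollified ?\<rho> \<psi> t) x
      = (\<integral>y. ?g y * \<psi> (inv (\<eta> t) y) - ?g y * ?c \<partial>lborel)" .
  have "\<bar>mollified_deriv ?\<rho> \<psi> t x + advection t (mollified ?\<rho> \<psi> t) x\<bar> \<le> (\<integral>y. (e * \<epsilon>) * ?S (x - y) \<partial>lborel)"
    unfolding eq
  proof (rule order_trans[OF integral_abs_bound integral_mono])
    show "integrable lborel (\<lambda>y. \<bar>?g y * \<psi> (inv (\<eta> t) y) - ?g y * ?c\<bar>)" using igp gint by auto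
    show "integrable lborel (\<lambda>y. (e * \<epsilon>) * ?S (x - y))" using iSx by (rule integrable_mult_right)
    fix y
    show "\<bar>?g y * \<psi> (inv (\<eta> t) y) - ?g y * ?c\<bar> \<le> (e * \<epsilon>) * ?S (x - y)"
    proof (cases "norm (x - y) \<le> \<epsilon>")
      case True
      have S0: "0 \<le> ?S (x - y)" by (intro sum_nonneg) auto
      have "\<bar>?g y * \<psi> (inv (\<eta> t) y) - ?g y * ?c\<bar> = \<bar>?g y\<bar> * \<bar>?c - \<psi> (inv (\<eta> t) y)\<bar>"
        by (simp add: right_diff_distrib[symmetric] abs_mult abs_minus_commute)
      also have "\<dots> \<le> (?S (x - y) * norm (u t x - u t y)) * \<bar>?c - \<psi> (inv (\<eta> t) y)\<bar>"
        by (intro mult_right_mono abs_derivative_le[OF \<rho>]) auto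
      also have "\<dots> = ?S (x - y) * (norm (u t x - u t y) * \<bar>?c - \<psi> (inv (\<eta> t) y)\<bar>)" by (simp only: mult.assoc)
      also have "\<dots> \<le> ?S (x - y) * (e * \<epsilon>)"
        using modulus[OF True] mult_left_mono[OF True e] S0 by (intro mult_left_mono) auto
      finally show ?thesis by (simp only: mult.commute)
    next
      case False
      then show ?thesis using Dzero[of y] e \<epsilon> by (simp add: sum_nonneg)
    qed
  qed
  also have "\<dots> = (e * \<epsilon>) * (\<integral>y. ?S y \<partial>lborel)"
    using lborel_integral_affine[OF mS, of "-1" x] by simp
  also have "(\<integral>y. ?S y \<partial>lborel) = (\<Sum>b\<in>Basis. \<integral>y. \<bar>partial b ?\<rho> y\<bar> \<partial>lborel)"
    by (rule Bochner_Integration.integral_sum[OF iS])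
  also have "\<dots> = (\<Sum>b\<in>(Basis :: (real^2) set). (\<integral>x. \<bar>partial b bump x\<bar> \<partial>lborel) / (\<integral>x. bump x \<partial>(lborel :: (real^2) measure)) / \<epsilon>)"
    by (intro sum.cong refl integral_abs_partial_mollifier \<epsilon>)
  finally show ?thesis using \<epsilon> by (simp add: sum_divide_distrib[symmetric])
qed

text \<open>After the volume-preserving change of variables the mollified function is a weighted
  mean of \<psi> composed with the inverse flow over the ball of radius \<epsilon>.\<close>

lemma mollified_close:
  assumes \<psi>: "continuous_on UNIV \<psi>" and \<epsilon>: "\<epsilon> > 0"
    and modulus: "\<And>y. norm (x - y) \<le> \<epsilon> \<Longrightarrow> \<bar>\<psi> (inv (\<eta> t) x) - \<psi> (inv (\<eta> t) y)\<bar> \<le> e"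
  shows "\<bar>mollified (mollifier \<epsilon>) \<psi> t x - \<psi> (inv (\<eta> t) x)\<bar> \<le> e"
proof -
  let ?\<rho> = "mollifier \<epsilon> :: real^2 \<Rightarrow> real"
  let ?f = "\<lambda>y. ?\<rho> (x - y) * \<psi> (inv (\<eta> t) y)"
  have cr: "continuous_on UNIV (\<lambda>y. ?\<rho> (x - y))"
    by (intro continuous_on_compose2[OF test_function_continuous[OF test_function_mollifier[OF \<epsilon>], of UNIV]] continuous_intros) auto
  have c\<psi>: "continuous_on UNIV (\<lambda>y. \<psi> (inv (\<eta> t) y))"
    by (rule continuous_on_compose2[OF \<psi> flow_continuous(2)]) auto
  have m: "?f \<in> borel_measurable borel"
    by (intro borel_measurable_continuous_onI continuous_on_mult cr c\<psi>)
  have "mollified ?\<rho> \<psi> t x = (\<integral>z. ?f (\<eta> t z) \<partial>lborel)"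
    by (simp add: mollified_def transported_mollification_def flow_inverse)
  also have "\<dots> = (\<integral>y. ?f y \<partial>lborel)" by (rule flow_integral[OF m])
  also have "\<dots> = (\<integral>y. ?\<rho> y * \<psi> (inv (\<eta> t) (x - y)) \<partial>lborel)"
    using lborel_integral_affine[OF m, of "-1" x] by simp
  finally have "mollified ?\<rho> \<psi> t x = (\<integral>y. ?\<rho> y * \<psi> (inv (\<eta> t) (x - y)) \<partial>lborel)" .
  moreover have "\<bar>(\<integral>y. ?\<rho> y * \<psi> (inv (\<eta> t) (x - y)) \<partial>lborel) - \<psi> (inv (\<eta> t) x)\<bar> \<le> e"
  proof (rule mollifier_average[OF \<epsilon>])
    show "continuous_on UNIV (\<lambda>y. \<psi> (inv (\<eta> t) (x - y)))"
      by (intro continuous_on_compose2[OF c\<psi>] continuous_intros) auto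
    show "\<bar>\<psi> (inv (\<eta> t) (x - y)) - \<psi> (inv (\<eta> t) x)\<bar> \<le> e" if "norm y \<le> \<epsilon>" for y
      using modulus[of "x - y"] that by (simp add: abs_minus_commute)
  qed
  ultimately show ?thesis by simp
qed

end

section \<open>Conservation along the flow\<close>

text \<open>The Lipschitz cut-offs are bounded by 1 and tend to the indicator, since the distance to
  a closed set is positive off it. The set has to be nonempty because \<open>infdist\<close> to the
  empty set is 0 by convention.\<close>

lemma signed_integral_tendsto_closed:
  fixes q :: "'a::euclidean_space set \<Rightarrow> real"
  assumes q: "q \<in> signed_measures" and C: "closed C" "C \<noteq> {}"
  shows "(\<lambda>n. signed_integral q (\<lambda>x. max 0 (1 - real n * infdist x C))) \<longlonglongrightarrow> q C"
proof -
  have lim: "(\<lambda>n. max 0 (1 - real n * infdist x C)) \<longlonglongrightarrow> indicator C x" for x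
  proof (cases "x \<in> C")
    case False
    then have "infdist x C > 0" using C in_closed_iff_infdist_zero[of C x] infdist_nonneg[of x C] by linarith
    then obtain N where N: "1 < real N * infdist x C" using reals_Archimedean3 by blast
    have "\<forall>\<^sub>F n in sequentially. max 0 (1 - real n * infdist x C) = 0"
      unfolding eventually_sequentially
    proof (intro exI[of _ N] allI impI)
      fix n assume "N \<le> n"
      then have "real N * infdist x C \<le> real n * infdist x C" by (intro mult_right_mono infdist_nonneg) auto
      then show "max 0 (1 - real n * infdist x C) = 0" using N by simp
    qed
    then show ?thesis using False by (simp add: tendsto_eventually)
  qed simp
  have M: "(\<lambda>n. \<integral>x. max 0 (1 - real n * infdist x C) \<partial>M) \<longlonglongrightarrow> measure M C"
    if M: "finite_measure M" "sets M = sets borel" for M :: "'a measure"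
  proof -
    interpret finite_measure M by (rule M(1))
    have CM: "C \<in> sets M" using C M by auto
    have "(\<lambda>n. \<integral>x. max 0 (1 - real n * infdist x C) \<partial>M) \<longlonglongrightarrow> (\<integral>x. indicator C x \<partial>M)"
    proof (rule integral_dominated_convergence[where w = "\<lambda>x. 1"])
      have "(\<lambda>x. max 0 (1 - real n * infdist x C)) \<in> borel_measurable borel" for n
        by (intro borel_measurable_continuous_onI continuous_intros)
      then show "(\<lambda>x. max 0 (1 - real n * infdist x C)) \<in> borel_measurable M" for n
        using measurable_cong_sets[OF M(2) refl] by blast
      show "AE x in M. norm (max 0 (1 - real n * infdist x C)) \<le> 1" for n
        by (intro always_eventually allI) (auto simp: infdist_nonneg)
    qed (use CM lim in auto)
    then show ?thesis using CM by simp
  qed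
  have "q C = measure (upper_variation q) C - measure (lower_variation q) C"
    using C by (intro Jordan_decomposition[OF q]) auto
  then show ?thesis
    unfolding signed_integral_def
    by (simp only:) (intro tendsto_diff M finite_upper_variation finite_lower_variation q, simp_all)
qed

text \<open>Cut-offs of the distance to a compact set are Lipschitz, bounded and compactly
  supported, so compact sets are decided; closed sets are increasing unions of them and form an
  intersection-stable generator. Off the Borel sets both functions are 0 by definition.\<close>

lemma signed_measures_eqI:
  fixes p q :: "'a::euclidean_space set \<Rightarrow> real"
  assumes p: "p \<in> signed_measures" and q: "q \<in> signed_measures"
    and eq: "\<And>\<psi> L B R. continuous_on UNIV \<psi> \<Longrightarrow> (\<And>x y. \<bar>\<psi> x - \<psi> y\<bar> \<le> L * norm (x - y)) \<Longrightarrow>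
      (\<And>x. \<bar>\<psi> x\<bar> \<le> B) \<Longrightarrow> (\<And>x. norm x > R \<Longrightarrow> \<psi> x = 0) \<Longrightarrow> signed_integral p \<psi> = signed_integral q \<psi>"
  shows "p = q"
proof -
  have compact: "p C = q C" if C: "compact C" for C
  proof (cases "C = {}")
    case True
    then show ?thesis using p q by (simp add: signed_measure_empty)
  next
    case False
    obtain R where R: "\<And>x. x \<in> C \<Longrightarrow> norm x \<le> R"
      using compact_imp_bounded[OF C] by (auto simp: bounded_iff)
    have "signed_integral p (\<lambda>x. max 0 (1 - real n * infdist x C)) = signed_integral q (\<lambda>x. max 0 (1 - real n * infdist x C))"
      if n: "n > 0" for n
    proof (rule eq[where L = "real n" and B = 1 and R = "R + 1"])
      show "continuous_on UNIV (\<lambda>x. max 0 (1 - real n * infdist x C))" by (intro continuous_intros)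
      fix x y :: 'a
      have "\<bar>infdist x C - infdist y C\<bar> \<le> norm (x - y)"
        using infdist_triangle_abs[of x C y] by (simp add: dist_norm)
      then have "\<bar>real n * infdist x C - real n * infdist y C\<bar> \<le> real n * norm (x - y)"
        unfolding right_diff_distrib[symmetric] abs_mult by (simp add: mult_left_mono)
      then show "\<bar>max 0 (1 - real n * infdist x C) - max 0 (1 - real n * infdist y C)\<bar> \<le> real n * norm (x - y)"
        by linarith
      show "\<bar>max 0 (1 - real n * infdist x C)\<bar> \<le> 1" using infdist_nonneg[of x C] by (simp add: max_def)
      show "max 0 (1 - real n * infdist x C) = 0" if x: "norm x > R + 1"
      proof -
        obtain c where c: "c \<in> C" "infdist x C = dist x c"
          using infdist_attains_inf[OF compact_imp_closed[OF C] False] by metis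
        have "infdist x C \<ge> 1"
          using R[OF c(1)] x norm_triangle_sub[of x c] unfolding c(2) dist_norm by linarith
        then have "1 * 1 \<le> real n * infdist x C" using n by (intro mult_mono) auto
        then show ?thesis by simp
      qed
    qed
    then have "\<forall>\<^sub>F n in sequentially. signed_integral p (\<lambda>x. max 0 (1 - real n * infdist x C))
        = signed_integral q (\<lambda>x. max 0 (1 - real n * infdist x C))"
      using eventually_gt_at_top[of "0::nat"] by (rule eventually_mono[rotated])
    from Lim_transform_eventually[OF signed_integral_tendsto_closed[OF p compact_imp_closed[OF C] False] this]
    show ?thesis
      using signed_integral_tendsto_closed[OF q compact_imp_closed[OF C] False] by (rule LIMSEQ_unique)
  qed
  have closed: "p C = q C" if C: "closed C" for C
  proof -
    have lim: "(\<lambda>n. r (C \<inter> cball 0 (real n))) \<longlonglongrightarrow> r C" if r: "r \<in> signed_measures" for r :: "'a set \<Rightarrow> real"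
    proof -
      have M: "(\<lambda>n. measure M (C \<inter> cball 0 (real n))) \<longlonglongrightarrow> measure M C"
        if M: "finite_measure M" "sets M = sets borel" for M :: "'a measure"
      proof -
        interpret finite_measure M by (rule M(1))
        have "(\<lambda>n. measure M (C \<inter> cball 0 (real n))) \<longlonglongrightarrow> measure M (\<Union>n. C \<inter> cball 0 (real n))"
        proof (rule finite_Lim_measure_incseq)
          show "range (\<lambda>n. C \<inter> cball 0 (real n)) \<subseteq> sets M" unfolding M(2) using C by auto
          show "incseq (\<lambda>n. C \<inter> cball 0 (real n))"
            unfolding incseq_def by (intro allI impI Int_mono subset_cball) auto
        qed
        moreover have "(\<Union>n. C \<inter> cball 0 (real n)) = C" by (auto simp: real_arch_simple)
        ultimately show ?thesis by simp
      qed
      have "(\<lambda>n. measure (upper_variation r) (C \<inter> cball 0 (real n)) - measure (lower_variation r) (C \<inter> cball 0 (real n)))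
          \<longlonglongrightarrow> measure (upper_variation r) C - measure (lower_variation r) C"
        by (intro tendsto_diff M finite_upper_variation finite_lower_variation r) simp_all
      then show ?thesis using C by (simp add: Jordan_decomposition[OF r])
    qed
    have "(\<lambda>n. p (C \<inter> cball 0 (real n))) = (\<lambda>n. q (C \<inter> cball 0 (real n)))"
      using C by (intro ext compact closed_Int_compact) auto
    with lim[OF p] have "(\<lambda>n. q (C \<inter> cball 0 (real n))) \<longlonglongrightarrow> p C" by (simp only:)
    then show ?thesis by (rule LIMSEQ_unique[OF _ lim[OF q]])
  qed
  have borel: "p A = q A" if A: "A \<in> sets borel" for A
  proof -
    have b: "sets borel = sigma_sets UNIV (Collect closed :: 'a set set)"
      by (subst borel_eq_closed) (simp add: sets_measure_of)
    have "A \<in> sigma_sets UNIV (Collect closed)" using A b by simp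
    then show ?thesis
    proof (rule sigma_sets_induct_disjoint[rotated 2])
      show "Int_stable (Collect closed :: 'a set set)" by (auto simp: Int_stable_def)
      show "p A = q A" if "A \<in> Collect closed" for A using closed that by simp
      show "p {} = q {}" using p q by (simp add: signed_measure_empty)
      show "p (UNIV - A) = q (UNIV - A)" if "A \<in> sigma_sets UNIV (Collect closed)" "p A = q A" for A
        using that closed[of UNIV] by (simp add: signed_measure_Diff[OF p] signed_measure_Diff[OF q] b)
      show "p (\<Union>i. A i) = q (\<Union>i. A i)"
        if "disjoint_family A" "range A \<subseteq> sigma_sets UNIV (Collect closed)" "\<And>i. p (A i) = q (A i)" for A :: "nat \<Rightarrow> 'a set"
        using signed_measure_sums[OF p, of A] signed_measure_sums[OF q, of A] that b by (simp add: sums_unique2)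
    qed auto
  qed
  have "p A = 0" "q A = 0" if "A \<notin> sets borel" for A
    using p q that by (auto simp: signed_measures_def)
  then show ?thesis using borel by (metis ext)
qed

section \<open>Conserved integrals and the orbit\<close>

context blob_solution
begin

lemma vanishing_transported:
  assumes \<psi>: "continuous_on UNIV \<psi>" "\<And>z. norm z > R \<Longrightarrow> \<psi> z = 0"
  shows "vanishing (\<lambda>x. \<psi> (inv (\<eta> t) x))"
proof -
  have "compact (\<eta> t ` cball 0 R)" by (intro compact_continuous_image flow_continuous) simp
  then have "bounded (\<eta> t ` cball 0 R)" by (rule compact_imp_bounded)
  then obtain S where S: "\<And>x. x \<in> \<eta> t ` cball 0 R \<Longrightarrow> norm x \<le> S"
    unfolding bounded_iff by blast
  show ?thesis
  proof (rule vanishing_zero_outside)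
    show "continuous_on UNIV (\<lambda>x. \<psi> (inv (\<eta> t) x))"
      by (rule continuous_on_compose2[OF \<psi>(1) flow_continuous(2)]) auto
    show "\<psi> (inv (\<eta> t) x) = 0" if "norm x > S" for x
    proof (rule ccontr)
      assume "\<psi> (inv (\<eta> t) x) \<noteq> 0"
      then have "inv (\<eta> t) x \<in> cball 0 R" using \<psi>(2)[of "inv (\<eta> t) x"] by force
      then have "\<eta> t (inv (\<eta> t) x) \<in> \<eta> t ` cball 0 R" by blast
      then show False using S that by (fastforce simp: flow_inverse)
    qed
  qed
qed

lemma transported_integral_constant:
  fixes \<psi> :: "real^2 \<Rightarrow> real"
  assumes \<psi>: "continuous_on UNIV \<psi>" "\<And>z. norm z > R \<Longrightarrow> \<psi> z = 0"
    and L: "\<And>x y. \<bar>\<psi> x - \<psi> y\<bar> \<le> L * norm (x - y)" and B: "\<And>x. \<bar>\<psi> x\<bar> \<le> B"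
  shows "signed_integral (q T) (\<lambda>x. \<psi> (inv (\<eta> T) x)) = signed_integral q\<^sub>0 \<psi>"
proof -
  obtain A where A: "A \<ge> 0" "\<And>t f B. \<bar>t\<bar> \<le> \<bar>T\<bar> \<Longrightarrow> vanishing f \<Longrightarrow> (\<And>x. \<bar>f x\<bar> \<le> B) \<Longrightarrow> \<bar>signed_integral (q t) f\<bar> \<le> A * B"
    using measure_curve_uniform_bound[OF measure_curve_q] by metis
  define K where "K = (\<Sum>b\<in>(Basis :: (real^2) set). (\<integral>x. \<bar>partial b bump x\<bar> \<partial>lborel) / (\<integral>x. bump x \<partial>(lborel :: (real^2) measure)))"
  have K: "K \<ge> 0" unfolding K_def using integral_bump_pos[where 'a = "real^2"]
    by (intro sum_nonneg divide_nonneg_pos) auto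
  let ?I = "\<lambda>t. signed_integral (q t) (\<lambda>x. \<psi> (inv (\<eta> t) x))"
  \<comment> \<open>The term 2 A e is the cost of mollifying at both end times; A K |T| e is the
    accumulated commutator.\<close>
  have bound: "\<bar>?I T - ?I 0\<bar> \<le> (2 * A + A * K * \<bar>T\<bar>) * e" if e: "e > 0" for e
  proof -
    obtain \<epsilon> where \<epsilon>: "\<epsilon> > 0"
      "\<And>t x y. \<bar>t\<bar> \<le> \<bar>T\<bar> \<Longrightarrow> norm (x - y) \<le> \<epsilon> \<Longrightarrow> \<bar>\<psi> (inv (\<eta> t) x) - \<psi> (inv (\<eta> t) y)\<bar> \<le> e"
      "\<And>t x y. \<bar>t\<bar> \<le> \<bar>T\<bar> \<Longrightarrow> norm (x - y) \<le> \<epsilon> \<Longrightarrow>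
        norm (u t x - u t y) * \<bar>\<psi> (inv (\<eta> t) x) - \<psi> (inv (\<eta> t) y)\<bar> \<le> e * norm (x - y)"
      using commutator_modulus[OF L B e, of "\<bar>T\<bar>"] by blast
    let ?\<rho> = "mollifier \<epsilon> :: real^2 \<Rightarrow> real"
    have \<rho>: "?\<rho> \<in> test_functions" by (rule test_function_mollifier[OF \<epsilon>(1)])
    have m: "mollified ?\<rho> \<psi> t \<in> test_functions" for t by (rule test_function_mollified[OF \<rho> \<psi>])
    let ?F = "\<lambda>t. signed_integral (q t) (mollified ?\<rho> \<psi> t)"
    let ?c = "\<lambda>t x. mollified_deriv ?\<rho> \<psi> t x + advection t (mollified ?\<rho> \<psi> t) x"
    have "norm (?F T - ?F 0) \<le> A * (e * K) * norm (T - 0)"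
    proof (rule field_differentiable_bound[of "{- \<bar>T\<bar>..\<bar>T\<bar>}" ?F "\<lambda>t. signed_integral (q t) (?c t)"])
      fix t assume "t \<in> {- \<bar>T\<bar>..\<bar>T\<bar>}"
      then have t: "\<bar>t\<bar> \<le> \<bar>T\<bar>" by auto
      show "(?F has_field_derivative signed_integral (q t) (?c t)) (at t within {- \<bar>T\<bar>..\<bar>T\<bar>})"
        by (rule has_field_derivative_at_within[OF mollified_DERIV[OF \<rho> \<psi>]])
      have "vanishing (?c t)"
        by (rule vanishing_add[OF vanishing_mollified_deriv[OF \<rho> \<psi>] vanishing_advection[OF m]])
      moreover have "\<bar>?c t x\<bar> \<le> e * K" for x
        unfolding K_def using e by (intro commutator_bound[OF \<psi> \<epsilon>(1)] \<epsilon>(3) t) auto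
      ultimately show "norm (signed_integral (q t) (?c t)) \<le> A * (e * K)"
        using A(2)[OF t] by simp
    qed auto
    moreover have "\<bar>?F t - ?I t\<bar> \<le> A * e" if t: "\<bar>t\<bar> \<le> \<bar>T\<bar>" for t
    proof -
      note v = test_function_vanishing[OF m] vanishing_transported[OF \<psi>]
      have "?F t - ?I t = signed_integral (q t) (\<lambda>x. mollified ?\<rho> \<psi> t x - \<psi> (inv (\<eta> t) x))"
        by (rule signed_integral_diff[symmetric]) (intro measure_curve_integrable[OF measure_curve_q] v)+
      also have "\<bar>\<dots>\<bar> \<le> A * e"
        by (intro A(2) t vanishing_diff v mollified_close[OF \<psi>(1) \<epsilon>(1)] \<epsilon>(2))
      finally show ?thesis .
    qed
    from this[of T] this[of 0] have "\<bar>?F T - ?I T\<bar> \<le> A * e" "\<bar>?F 0 - ?I 0\<bar> \<le> A * e" by auto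
    ultimately show ?thesis by (simp add: algebra_simps)
  qed
  have "\<bar>?I T - ?I 0\<bar> \<le> 0"
  proof (rule field_le_epsilon)
    fix e :: real assume e: "e > 0"
    define k where "k = 2 * A + A * K * \<bar>T\<bar>"
    have k: "k \<ge> 0" unfolding k_def using A K by auto
    have "\<bar>?I T - ?I 0\<bar> \<le> k * (e / (k + 1))"
      unfolding k_def by (rule bound) (use e k in \<open>simp add: k_def\<close>)
    also have "\<dots> \<le> e" using k e by (simp add: field_simps)
    finally show "\<bar>?I T - ?I 0\<bar> \<le> 0 + e" by simp
  qed
  moreover have "?I 0 = signed_integral q\<^sub>0 \<psi>" by (simp add: flow_zero q_zero inv_id)
  ultimately show ?thesis by simp
qed

text \<open>Pulling back by the flow undoes the transport; the conserved integrals are precisely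
  those that determine a signed measure.\<close>

lemma pullback_solution: "pullback_measure (q T) (\<eta> T) = q\<^sub>0"
proof (rule signed_measures_eqI)
  have qT: "q t \<in> signed_measures" for t by (rule measure_curve_signed[OF measure_curve_q])
  show "pullback_measure (q T) (\<eta> T) \<in> signed_measures"
    by (rule pullback_measure_in_signed_measures[OF qT flow_homeomorphism])
  show "q\<^sub>0 \<in> signed_measures" using qT[of 0] by (simp add: q_zero)
  fix \<psi> :: "real^2 \<Rightarrow> real" and L B R
  assume \<psi>: "continuous_on UNIV \<psi>" "\<And>x y. \<bar>\<psi> x - \<psi> y\<bar> \<le> L * norm (x - y)" "\<And>x. \<bar>\<psi> x\<bar> \<le> B"
    "\<And>x. norm x > R \<Longrightarrow> \<psi> x = 0"
  show "signed_integral (pullback_measure (q T) (\<eta> T)) \<psi> = signed_integral q\<^sub>0 \<psi>"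
    using transported_integral_constant[OF \<psi>(1,4,2,3), of R T]
      signed_integral_pullback[OF qT flow_homeomorphism borel_measurable_continuous_onI[OF \<psi>(1)]]
    by (simp add: o_def)
qed

text \<open>The orbit acts by pullback, so its element is the inverse flow map; it remains to see
  that this inverse again belongs to the group.\<close>

lemma coadjoint_orbit_solution: "q t \<in> coadjoint_orbit q\<^sub>0"
proof -
  let ?\<theta> = "inv (\<eta> t)"
  have inv_inv: "inv ?\<theta> = \<eta> t"
    using homeomorphism_inv_facts(1)[OF flow_homeomorphism] by (rule inv_inv_eq)
  have hom: "homeomorphism UNIV UNIV ?\<theta> (inv ?\<theta>)"
    unfolding inv_inv using flow_homeomorphism homeomorphism_symD by blast
  have m: "\<eta> t \<in> borel_measurable borel" "?\<theta> \<in> borel_measurable borel"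
    using homeomorphism_inv_facts(2,3)[OF flow_homeomorphism] by auto
  \<comment> \<open>Lebesgue measure is replaced by its image under the flow, after which the two
    maps cancel.\<close>
  have "distr lborel borel ?\<theta> = distr (distr lborel borel (\<eta> t)) borel ?\<theta>"
    by (simp add: flow_preserving)
  also have "\<dots> = distr lborel borel (?\<theta> \<circ> \<eta> t)"
    using m by (intro distr_distr) auto
  also have "?\<theta> \<circ> \<eta> t = id" by (simp add: fun_eq_iff flow_inverse)
  also have "distr lborel borel id = (lborel :: (real^2) measure)"
    by (simp add: id_def distr_id2)
  finally have "?\<theta> \<in> measure_preserving_homeos"
    using hom by (simp add: measure_preserving_homeos_def)
  moreover have "q t = pullback_measure q\<^sub>0 ?\<theta>"
  proof
    fix A
    have "\<eta> t ` (?\<theta> ` A) = A" by (simp add: image_image flow_inverse)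
    moreover have "q t A = 0" if "A \<notin> sets borel"
      using that measure_curve_signed[OF measure_curve_q, of t] by (simp add: signed_measures_def)
    ultimately show "q t A = pullback_measure q\<^sub>0 ?\<theta> A"
      unfolding pullback_solution[of t, symmetric]
      using homeomorphism_image_borel[OF hom, of A] by (simp add: pullback_measure_def)
  qed
  ultimately show ?thesis by (auto simp: coadjoint_orbit_def)
qed

end

theorem theorem7:
  fixes \<alpha> :: real
  assumes "\<alpha> > 0"
  shows "(\<forall>u q. C0_div_curve u \<and> measure_curve q \<longrightarrow>
            (\<forall>\<phi>\<in>test_functions. w_ad_integrable u q \<phi>) \<and> distribution (w_ad u q)) \<and>
         (\<forall>q\<^sub>0\<in>signed_measures. \<forall>\<eta> u q. weak_solution \<alpha> q\<^sub>0 \<eta> u q \<longrightarrow>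
            (\<forall>t. q t \<in> coadjoint_orbit q\<^sub>0))"
proof (intro conjI allI ballI impI, goal_cases)
  case (1 u q \<phi>)
  then interpret transport_curves u q by unfold_locales auto
  show ?case using 1 by (intro w_ad_integrable_test_function)
next
  case (2 u q)
  then interpret transport_curves u q by unfold_locales auto
  show ?case by (rule distribution_w_ad)
next
  case (3 q\<^sub>0 \<eta> u q t)
  interpret blob_solution \<alpha> q\<^sub>0 \<eta> u q
    by unfold_locales (use assms 3 in auto)
  show ?case by (rule coadjoint_orbit_solution)
qed

end
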